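(* For an integer $d\ge 1$, let $Q^{\mathrm{mid}}_{2d-1}$ be the middle-layers graph defined below and fix an arbitrary vertex $v_0\in L_{d-1}$. Let $\mathbf h$ be a uniformly random element of $\mathrm{Hom}_{v_0}(Q^{\mathrm{mid}}_{2d-1})$. Then $\mathbb{P}(R(\mathbf h)\le 5)\to 1$ as $d\to\infty$ (uniformly in the choice of $v_0\in L_{d-1}$).
   Context: $Q_{2d-1}$ is the Hamming cube on $\{0,1\}^{2d-1}$ (two vectors adjacent iff they differ in exactly one coordinate). For $v\in\{0,1\}^{2d-1}$, $\|v\|$ is its number of ones, and $L_k=\{v:\|v\|=k\}$. $Q^{\mathrm{mid}}_{2d-1}$ is the subgraph of $Q_{2d-1}$ induced on $L_{d-1}\cup L_d$; it is a $d$-regular bipartite graph with parts $L_{d-1},L_d$. For a connected bipartite graph $\Gamma=(V,E)$ and $v_0\in V$, $\mathrm{Hom}_{v_0}(\Gamma)$ is the set of maps $h:V\to\mathbb{Z}$ with $h(v_0)=0$ and $|h(u)-h(v)|=1$ for every edge $\{u,v\}$. The range of $h$ is $R(h)=|\{h(x):x\in V\}|$. *)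

theory Defs
  imports "HOL-Probability.Probability_Mass_Function"
begin

text \<open>A simple graph is a pair of its vertex set and its set of (two-element) edges.\<close>

type_synonym 'a graph = "'a set \<times> 'a set set"

definition verts :: "'a graph \<Rightarrow> 'a set" where
  "verts G = fst G"

definition edges :: "'a graph \<Rightarrow> 'a set set" where
  "edges G = snd G"

definition induced :: "'a graph \<Rightarrow> 'a set \<Rightarrow> 'a graph" where
  "induced G W = (W, {e \<in> edges G. e \<subseteq> W})"

definition cube_verts :: "nat \<Rightarrow> (nat \<Rightarrow> nat) set" where
  "cube_verts n = {..<n} \<rightarrow>\<^sub>E {0, 1}"

definition hamming_cube :: "nat \<Rightarrow> (nat \<Rightarrow> nat) graph" where
  "hamming_cube n =
     (cube_verts n,
      {{u, v} | u v. u \<in> cube_verts n \<and> v \<in> cube_verts n \<and> card {i \<in> {..<n}. u i \<noteq> v i} = 1})"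

definition weight :: "nat \<Rightarrow> (nat \<Rightarrow> nat) \<Rightarrow> nat" where
  "weight n v = card {i \<in> {..<n}. v i = 1}"

definition layer :: "nat \<Rightarrow> nat \<Rightarrow> (nat \<Rightarrow> nat) set" where
  "layer n k = {v \<in> cube_verts n. weight n v = k}"

text \<open>The natural-number subtractions below are only meaningful for \<open>d \<ge> 1\<close>.\<close>

definition middle_layers_graph :: "nat \<Rightarrow> (nat \<Rightarrow> nat) graph" where
  "middle_layers_graph d =
     induced (hamming_cube (2 * d - 1)) (layer (2 * d - 1) (d - 1) \<union> layer (2 * d - 1) d)"

text \<open>Maps on the vertex set are represented by extensional functions, so that each map
  \<open>V \<rightarrow> \<int>\<close> is counted exactly once.\<close>

definition Hom_at :: "'a graph \<Rightarrow> 'a \<Rightarrow> ('a \<Rightarrow> int) set" where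
  "Hom_at G v0 = {h \<in> verts G \<rightarrow>\<^sub>E UNIV. h v0 = 0 \<and>
     (\<forall>u v. {u, v} \<in> edges G \<longrightarrow> \<bar>h u - h v\<bar> = 1)}"

definition hom_range :: "'a graph \<Rightarrow> ('a \<Rightarrow> int) \<Rightarrow> nat" where
  "hom_range G h = card (h ` verts G)"

text \<open>The remaining facts show that for \<open>d \<ge> 1\<close> the set of homomorphisms is finite and nonempty,
  which \<^const>\<open>pmf_of_set\<close> requires in order to denote the uniform distribution.\<close>

lemma finite_cube_verts: "finite (cube_verts n)"
  by (simp add: cube_verts_def finite_PiE)

lemma verts_mid:
  "verts (middle_layers_graph d) = layer (2 * d - 1) (d - 1) \<union> layer (2 * d - 1) d"
  by (simp add: middle_layers_graph_def induced_def verts_def)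

lemma finite_verts_mid: "finite (verts (middle_layers_graph d))"
  by (rule finite_subset[OF _ finite_cube_verts[of "2 * d - 1"]]) (auto simp: verts_mid layer_def)

lemma edge_mid_iff:
  "{u, v} \<in> edges (middle_layers_graph d) \<longleftrightarrow>
     u \<in> verts (middle_layers_graph d) \<and> v \<in> verts (middle_layers_graph d) \<and>
     card {i \<in> {..<2 * d - 1}. u i \<noteq> v i} = 1" (is "?l \<longleftrightarrow> ?r")
proof -
  define n where "n = 2 * d - 1"
  define W where "W = verts (middle_layers_graph d)"
  define P where "P = (\<lambda>x y :: nat \<Rightarrow> nat. card {i \<in> {..<n}. x i \<noteq> y i} = 1)"
  have "{i \<in> {..<n}. x i \<noteq> y i} = {i \<in> {..<n}. y i \<noteq> x i}" for x y :: "nat \<Rightarrow> nat" by auto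
  then have sym: "P x y = P y x" for x y unfolding P_def by metis
  have W: "W \<subseteq> cube_verts n" by (auto simp: W_def n_def verts_mid layer_def)
  have "?l \<longleftrightarrow> {u, v} \<subseteq> W \<and> (\<exists>x y. {u, v} = {x, y} \<and> x \<in> cube_verts n \<and> y \<in> cube_verts n \<and> P x y)"
    unfolding W_def n_def P_def verts_mid
    unfolding middle_layers_graph_def induced_def hamming_cube_def edges_def by auto
  also have "\<dots> \<longleftrightarrow> u \<in> W \<and> v \<in> W \<and> P u v"
  proof
    assume L: "{u, v} \<subseteq> W \<and> (\<exists>x y. {u, v} = {x, y} \<and> x \<in> cube_verts n \<and> y \<in> cube_verts n \<and> P x y)"
    then obtain x y where "{u, v} = {x, y}" "P x y" by blast
    then have "P u v" using sym[of u v] unfolding doubleton_eq_iff by blast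
    then show "u \<in> W \<and> v \<in> W \<and> P u v" using L by blast
  next
    assume "u \<in> W \<and> v \<in> W \<and> P u v"
    then show "{u, v} \<subseteq> W \<and> (\<exists>x y. {u, v} = {x, y} \<and> x \<in> cube_verts n \<and> y \<in> cube_verts n \<and> P x y)"
      using W by blast
  qed
  finally show ?thesis by (simp only: W_def P_def n_def)
qed

lemma cube_flip:
  assumes "u \<in> cube_verts n" "i < n" "b \<in> {0, 1}"
  shows "u(i := b) \<in> cube_verts n"
  using assms by (auto simp: cube_verts_def PiE_iff extensional_def)

lemma card_diff_flip:
  assumes "i < n" "u i \<noteq> b"
  shows "card {j \<in> {..<n}. u j \<noteq> (u(i := b)) j} = 1"
proof -
  have "{j \<in> {..<n}. u j \<noteq> (u(i := b)) j} = {i}" using assms by auto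
  then show ?thesis by simp
qed

lemma weight_up:
  assumes "i < n" "u i = 0"
  shows "weight n (u(i := 1)) = Suc (weight n u)"
proof -
  have "{j \<in> {..<n}. (u(i := 1)) j = 1} = insert i {j \<in> {..<n}. u j = 1}" using assms by auto
  then show ?thesis using assms by (simp add: weight_def)
qed

lemma weight_down:
  assumes "i < n" "u i = 1"
  shows "Suc (weight n (u(i := 0))) = weight n u"
  using weight_up[of i n "u(i := 0)"] assms by (simp add: fun_upd_idem)

lemma weight_step_neq:
  assumes "u \<in> cube_verts n" "v \<in> cube_verts n" "card {i \<in> {..<n}. u i \<noteq> v i} = 1"
  shows "weight n u \<noteq> weight n v"
proof -
  obtain i where i: "{j \<in> {..<n}. u j \<noteq> v j} = {i}" using assms(3) card_1_singletonE by blast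
  have in': "i < n" "u i \<noteq> v i" using i by auto
  have vals: "u i \<in> {0, 1}" "v i \<in> {0, 1}" using assms in' by (auto simp: cube_verts_def PiE_iff)
  have v: "v = u(i := v i)"
  proof
    fix j show "v j = (u(i := v i)) j"
      using i assms(1,2) by (cases "j < n") (auto simp: cube_verts_def PiE_iff extensional_def)
  qed
  show ?thesis
  proof (cases "u i = 0")
    case True
    then have "v i = 1" using vals in' by auto
    then have "v = u(i := 1)" using v by metis
    then show ?thesis using weight_up[of i n u] True in' by simp
  next
    case False
    then have "u i = 1" "v i = 0" using vals in' by auto
    then have "v = u(i := 0)" using v by metis
    then show ?thesis using weight_down[of i n u] \<open>u i = 1\<close> in' by simp
  qed
qed

lemma Hom_at_mid_nonempty:
  assumes "d \<ge> 1" "v0 \<in> layer (2 * d - 1) (d - 1)"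
  shows "Hom_at (middle_layers_graph d) v0 \<noteq> {}"
proof -
  let ?h = "restrict (\<lambda>v. int (weight (2 * d - 1) v) - int (d - 1)) (verts (middle_layers_graph d))"
  have v0: "v0 \<in> verts (middle_layers_graph d)" "weight (2 * d - 1) v0 = d - 1"
    using assms by (auto simp: verts_mid layer_def)
  have "\<bar>?h u - ?h v\<bar> = 1" if e: "{u, v} \<in> edges (middle_layers_graph d)" for u v
  proof -
    have uv: "u \<in> verts (middle_layers_graph d)" "v \<in> verts (middle_layers_graph d)"
      "card {i \<in> {..<2 * d - 1}. u i \<noteq> v i} = 1" using e edge_mid_iff by blast+
    then have "weight (2 * d - 1) u \<noteq> weight (2 * d - 1) v"
      by (intro weight_step_neq) (auto simp: verts_mid layer_def)
    moreover have "weight (2 * d - 1) u \<in> {d - 1, d}" "weight (2 * d - 1) v \<in> {d - 1, d}"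
      using uv by (auto simp: verts_mid layer_def)
    ultimately show ?thesis using uv assms(1) by auto
  qed
  then have "?h \<in> Hom_at (middle_layers_graph d) v0" using v0 by (auto simp: Hom_at_def)
  then show ?thesis by blast
qed

lemma Hom_at_mid_Lipschitz:
  assumes d: "d \<ge> 1" and h: "h \<in> Hom_at (middle_layers_graph d) v0"
    and "u \<in> layer (2 * d - 1) (d - 1)" "w \<in> layer (2 * d - 1) (d - 1)"
  shows "\<bar>h u - h w\<bar> \<le> 2 * int (card {i \<in> {..<2 * d - 1}. u i \<noteq> w i})"
  using assms(3,4)
proof (induction "card {i \<in> {..<2 * d - 1}. u i \<noteq> w i}" arbitrary: u rule: less_induct)
  case less
  define n where "n = 2 * d - 1"
  have u: "u \<in> cube_verts n" "weight n u = d - 1" and w: "w \<in> cube_verts n" "weight n w = d - 1"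
    using less.prems by (auto simp: layer_def n_def)
  show ?case
  proof (cases "u = w")
    case False
    let ?U = "{i \<in> {..<n}. u i = 1}" and ?W = "{i \<in> {..<n}. w i = 1}"
    have ne: "?U \<noteq> ?W"
    proof
      assume eq: "?U = ?W"
      have "u i = w i" for i
      proof (cases "i < n")
        case True
        then have "u i \<in> {0, 1}" "w i \<in> {0, 1}" using u w by (auto simp: cube_verts_def PiE_iff)
        moreover have "u i = 1 \<longleftrightarrow> w i = 1" using eq True by blast
        ultimately show ?thesis by auto
      next
        case False
        then show ?thesis using u w by (auto simp: cube_verts_def PiE_iff extensional_def)
      qed
      then show False using \<open>u \<noteq> w\<close> by auto
    qed
    have cards: "card ?U = card ?W" using u w by (simp add: weight_def)
    have "\<not> ?W \<subseteq> ?U" using card_subset_eq[of ?U ?W] ne cards by auto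
    then obtain i where i: "i < n" "w i = 1" "u i \<noteq> 1" by auto
    have "\<not> ?U \<subseteq> ?W" using card_subset_eq[of ?W ?U] ne cards by auto
    then obtain j where j: "j < n" "u j = 1" "w j \<noteq> 1" by auto
    have i0: "u i = 0" and j0: "w j = 0" using u w i j by (auto simp: cube_verts_def PiE_iff)
    have "i \<noteq> j" using i j by auto
    define a where "a = u(i := 1)"
    define b where "b = a(j := 0)"
    have aj: "a j = 1" using \<open>i \<noteq> j\<close> j by (simp add: a_def)
    have a: "a \<in> cube_verts n" "weight n a = d"
      using cube_flip[of u n i 1] weight_up[of i n u] u i i0 d by (auto simp: a_def)
    have b: "b \<in> cube_verts n" "weight n b = d - 1"
      using cube_flip[of a n j 0] weight_down[of j n a] a j aj d by (auto simp: b_def)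
    have V: "u \<in> verts (middle_layers_graph d)" "a \<in> verts (middle_layers_graph d)"
      "b \<in> verts (middle_layers_graph d)"
      using u a b by (auto simp: verts_mid layer_def n_def)
    have "{u, a} \<in> edges (middle_layers_graph d)"
      using V card_diff_flip[of i n u 1] i i0 by (auto simp: edge_mid_iff a_def n_def)
    then have 1: "\<bar>h u - h a\<bar> = 1" using h by (auto simp: Hom_at_def)
    have "{a, b} \<in> edges (middle_layers_graph d)"
      using V card_diff_flip[of j n a 0] j aj by (auto simp: edge_mid_iff b_def n_def)
    then have 2: "\<bar>h a - h b\<bar> = 1" using h by (auto simp: Hom_at_def)
    have bk: "b k = (if k = j then w j else if k = i then w i else u k)" for k
      using i j0 by (simp add: a_def b_def)
    have "{k \<in> {..<n}. b k \<noteq> w k} \<subseteq> {k \<in> {..<n}. u k \<noteq> w k} - {i}"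
      by (auto simp: bk)
    moreover have "i \<in> {k \<in> {..<n}. u k \<noteq> w k}" using i by simp
    ultimately have "{k \<in> {..<n}. b k \<noteq> w k} \<subset> {k \<in> {..<n}. u k \<noteq> w k}" by blast
    then have lt: "card {k \<in> {..<n}. b k \<noteq> w k} < card {k \<in> {..<n}. u k \<noteq> w k}"
      by (intro psubset_card_mono) auto
    have "\<bar>h b - h w\<bar> \<le> 2 * int (card {k \<in> {..<n}. b k \<noteq> w k})"
      using less.hyps[of b] lt b less.prems by (simp add: n_def layer_def)
    then show ?thesis using 1 2 lt unfolding n_def by linarith
  qed simp
qed

lemma finite_Hom_at_mid:
  assumes d: "d \<ge> 1" and v0: "v0 \<in> layer (2 * d - 1) (d - 1)"
  shows "finite (Hom_at (middle_layers_graph d) v0)"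
proof -
  let ?V = "verts (middle_layers_graph d)" and ?N = "2 * int (2 * d - 1) + 1"
  have low: "\<bar>h v\<bar> \<le> 2 * int (2 * d - 1)"
    if h: "h \<in> Hom_at (middle_layers_graph d) v0" and v: "v \<in> layer (2 * d - 1) (d - 1)" for h v
  proof -
    have "card {i \<in> {..<2 * d - 1}. v i \<noteq> v0 i} \<le> card {..<2 * d - 1}"
      by (intro card_mono) auto
    moreover have "h v0 = 0" using h by (simp add: Hom_at_def)
    ultimately show ?thesis using Hom_at_mid_Lipschitz[OF d h v v0] by simp
  qed
  have "h v \<in> {-?N..?N}" if h: "h \<in> Hom_at (middle_layers_graph d) v0" and v: "v \<in> ?V" for h v
  proof (cases "v \<in> layer (2 * d - 1) (d - 1)")
    case True
    then show ?thesis using low[OF h] by force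
  next
    case False
    then have v': "v \<in> cube_verts (2 * d - 1)" "weight (2 * d - 1) v = d"
      using v by (auto simp: verts_mid layer_def)
    then have "card {i \<in> {..<2 * d - 1}. v i = 1} \<noteq> 0" using d by (simp add: weight_def)
    then have "{i \<in> {..<2 * d - 1}. v i = 1} \<noteq> {}" by (metis card.empty)
    then obtain i where i: "i < 2 * d - 1" "v i = 1" by auto
    have u: "v(i := 0) \<in> layer (2 * d - 1) (d - 1)"
      using cube_flip[of v "2 * d - 1" i 0] weight_down[of i "2 * d - 1" v] v' i
      by (auto simp: layer_def)
    have "{v, v(i := 0)} \<in> edges (middle_layers_graph d)"
      using v u card_diff_flip[of i "2 * d - 1" v 0] i by (auto simp: edge_mid_iff verts_mid)
    then have "\<bar>h v - h (v(i := 0))\<bar> = 1" using h by (auto simp: Hom_at_def)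
    then show ?thesis using low[OF h u] by auto
  qed
  then have "Hom_at (middle_layers_graph d) v0 \<subseteq> ?V \<rightarrow>\<^sub>E {-?N..?N}"
    unfolding Hom_at_def PiE_def extensional_def by blast
  then show ?thesis by (rule finite_subset) (simp add: finite_PiE finite_verts_mid)
qed

end

theory Submission
  imports Defs "HOL-Real_Asymp.Real_Asymp"
begin

text \<open>
  Write \<open>N\<close> for the number of vertices on each side. There are at least \<open>2 ^ N\<close> homomorphisms: freeze
  one side and choose the other freely.

  Cut \<open>h\<close> at a level \<open>k\<close>: the part above and the part below are independent one-sided
  homomorphisms, and if \<open>C\<close> is the closure of the level set, there are about \<open>2 ^ (N - t)\<close> of them, where
  \<open>t = |N(C)| - |C|\<close>. Containers in the style of Sapozhenko show that summing over the possible \<open>C\<close> costs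
  only a fraction of \<open>t\<close>, and recursion over the levels controls the one-sided homomorphisms. Since \<open>t\<close> is
  bounded below by the Kruskal--Katona theorem, with high probability every level set is tiny or
  co-tiny, so one side of the graph is constant, equal to \<open>c\<close>, outside a set of density
  \<open>2 ^ (- d ^ (1/10) / 4)\<close> (up to polynomial factors).

  It remains to exclude that the other side takes a value \<open>\<ge> c + 3\<close> (or \<open>\<le> c - 3\<close>) at a single
  vertex. By vertex transitivity and Daykin's inequality the probability \<open>p\<close> of this satisfies
  \<open>p ^ s \<lesssim> P(h \<ge> c + 3 on S)\<close> for every set \<open>S\<close> of \<open>s\<close> vertices; for a large well spread \<open>S\<close> the
  level-set estimate bounds the right-hand side by \<open>2 ^ (- 4 d s)\<close>, which beats the union bound over
  all vertices. With the frozen side at \<open>c\<close> and the other side at \<open>c \<plusminus> 1\<close>, the range lies in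
  \<open>{c - 2..c + 2}\<close>.
\<close>

section \<open>Subset counts, Daykin's inequality and the Kruskal--Katona theorem\<close>

text \<open>The container estimate starts at the threshold \<open>t0\<close>: every level of the
  recursion pays a factor \<open>Mfac\<close>, about 2 ^ (L d t0), for the closed sets of smaller
  defect. The level set of an isolated excursion may have a defect of at most d ^ 2, far below that
  threshold, so no direct estimate can exclude it. This obstacle forces the detour through Daykin's
  inequality: s far-apart excursions together have a defect of order at least s d jj, which is above
  \<open>t0\<close>, and an s-th root brings the estimate back to one vertex.

  Two scales are needed. \<open>t1\<close> exceeds \<open>t0\<close> by a factor 2 ^ (L/4), which
  beats every polynomial in d; hence \<open>Mfac\<close> to a power of order d is negligible against
  2 ^ (\<gamma> t1 / 2). The factor \<open>jj\<close>, of order L, is the extra expansion that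
  Kruskal--Katona gives to sets of density at most 3 ^ (- jj). It is essential: the saving per unit
  of defect is only \<gamma>, which tends to 0, and \<gamma> jj \<ge> 48 makes the exponent per
  vertex beat the 2 d bits that the union over N \<le> 4 ^ d vertices costs.\<close>

lemma card_subsets_le:
  fixes n k :: real
  assumes "finite U" "real (card U) \<le> n" "0 < k" "k \<le> n"
  shows "real (card {T. T \<subseteq> U \<and> real (card T) \<le> k}) \<le> (exp 1 * n / k) powr k"
proof -
  \<comment> \<open>Exponential weights: since z \<le> 1, every counted set has weight z ^ (|T| - k)
    \<ge> 1, and over all subsets the weights sum to (1 + z) ^ |U| * z ^ (- k) \<le> exp (z n) * z ^
    (- k). The choice z = k / n turns this into (e n / k) ^ k.\<close>
  define z where "z = k / n"
  have n: "n > 0" using assms by linarith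
  have z: "0 < z" "z \<le> 1" using assms n by (auto simp: z_def)
  have "real (card {T. T \<subseteq> U \<and> real (card T) \<le> k}) = (\<Sum>T \<in> {T. T \<subseteq> U \<and> real (card T) \<le> k}. 1)" by simp
  also have "\<dots> \<le> (\<Sum>T \<in> {T. T \<subseteq> U \<and> real (card T) \<le> k}. z powr (real (card T) - k))"
    using z by (intro sum_mono) (auto intro: ge_one_powr_ge_zero simp: powr_mono2 powr_def ln_le_zero_iff mult_nonpos_nonpos)
  also have "\<dots> \<le> (\<Sum>T \<in> Pow U. z powr (real (card T) - k))"
    using assms by (intro sum_mono2) auto
  also have "\<dots> = (\<Sum>T \<in> Pow U. z ^ card T) * z powr (- k)"
    using z by (simp add: sum_distrib_right powr_diff powr_minus powr_realpow divide_inverse)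
  also have "(\<Sum>T \<in> Pow U. z ^ card T) = (1 + z) ^ card U"
    using prod_add[OF assms(1), of "\<lambda>_. z" "\<lambda>_. 1"] by (simp add: add.commute)
  also have "(1 + z) ^ card U = (1 + z) powr real (card U)" using z by (simp add: powr_realpow)
  also have "\<dots> \<le> exp z powr real (card U)"
    using z by (intro powr_mono2) (auto simp: exp_ge_add_one_self)
  also have "\<dots> = exp (z * real (card U))" by (simp add: powr_def mult.commute)
  also have "\<dots> \<le> exp k"
    using z n assms by (simp add: z_def field_simps mult_left_mono)
  also have "exp k * z powr (- k) = (exp 1 * n / k) powr k"
    using assms n by (simp add: z_def powr_minus powr_divide powr_mult powr_def[of "exp 1"] field_simps)
  finally show ?thesis using z by (simp add: mult_right_mono)
qed

text \<open>As long as some \<open>P i\<close> meets the uncovered part in more than \<psi> points,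
  it is added; each addition removes more than \<psi> points of \<open>B\<close>, which bounds the
  number of additions.\<close>

lemma greedy_cover:
  fixes P :: "'i \<Rightarrow> 'b set" and \<psi> :: real
  assumes "finite B" "\<psi> > 0"
  shows "\<exists>T \<subseteq> I. finite T \<and> real (card T) * \<psi> \<le> real (card B) \<and>
    (\<forall>i\<in>I. real (card (P i \<inter> (B - (\<Union>j\<in>T. P j)))) \<le> \<psi>)"
  using assms(1)
proof (induction "card B" arbitrary: B rule: less_induct)
  case less
  show ?case
  proof (cases "\<forall>i\<in>I. real (card (P i \<inter> B)) \<le> \<psi>")
    case True
    then show ?thesis by (intro exI[of _ "{}"]) auto
  next
    case False
    then obtain i where i: "i \<in> I" "real (card (P i \<inter> B)) > \<psi>" by force
    define B' where "B' = B - P i"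
    have c: "card B = card B' + card (P i \<inter> B)"
      using card_Int_Diff[OF less.prems, of "P i"] by (simp add: B'_def Int_commute add.commute)
    have "card (P i \<inter> B) > 0" using i assms(2) by linarith
    then have lt: "card B' < card B" using c by simp
    obtain T where T: "T \<subseteq> I" "finite T" "real (card T) * \<psi> \<le> real (card B')"
      "\<forall>i\<in>I. real (card (P i \<inter> (B' - (\<Union>j\<in>T. P j)))) \<le> \<psi>"
      using less.hyps[OF lt] less.prems by (auto simp: B'_def)
    have "real (card (insert i T)) * \<psi> \<le> (real (card T) + 1) * \<psi>"
      using assms(2) T(2) by (intro mult_right_mono) (auto simp: card_insert_if)
    also have "\<dots> \<le> real (card B)" using T(3) i(2) c by (simp add: algebra_simps)
    finally have 1: "real (card (insert i T)) * \<psi> \<le> real (card B)" .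
    have "B - (\<Union>j\<in>insert i T. P j) = B' - (\<Union>j\<in>T. P j)" by (auto simp: B'_def)
    then show ?thesis using T 1 i by (intro exI[of _ "insert i T"]) auto
  qed
qed

section \<open>Daykin's inequality, by induction from the four functions theorem on a chain\<close>

lemma four_sums:
  fixes a b c e :: "'i::linorder \<Rightarrow> real"
  assumes "finite I" and nn: "\<And>i. a i \<ge> 0" "\<And>i. b i \<ge> 0" "\<And>i. c i \<ge> 0" "\<And>i. e i \<ge> 0"
    and le: "\<And>i j. a i * b j \<le> c (max i j) * e (min i j)"
  shows "sum a I * sum b I \<le> sum c I * sum e I"
proof -
  have lt: "a i * b j + a j * b i \<le> c i * e j + c j * e i" if "i < j" for i j
  proof -
    let ?c = "c j * e i"
    have 1: "a i * b j \<le> ?c" "a j * b i \<le> ?c"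
      using le[of i j] le[of j i] that by (simp_all add: max_absorb1 max_absorb2 min_absorb1 min_absorb2 less_imp_le)
    show ?thesis
    proof (cases "?c = 0")
      case True
      then show ?thesis using 1 nn by (smt (verit) mult_nonneg_nonneg)
    next
      case False
      then have c: "?c > 0" using nn by (simp add: less_le)
      have "(a i * b j) * (a j * b i) = (a i * b i) * (a j * b j)" by simp
      also have "\<dots> \<le> (c i * e i) * (c j * e j)"
        using le[of i i] le[of j j] nn
        by (intro mult_mono[of "a i * b i" _ "a j * b j"]) (auto intro: mult_nonneg_nonneg)
      finally have 2: "(a i * b j) * (a j * b i) \<le> ?c * (c i * e j)" by (simp add: algebra_simps)
      \<comment> \<open>Two numbers x, y \<le> \<open>?c\<close> satisfy x + y \<le>
        \<open>?c\<close> + x y / \<open>?c\<close>, and the two diagonal instances of the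
        hypothesis bound x y by \<open>?c * (c i * e j)\<close>.\<close>
      have "0 \<le> (?c - a i * b j) * (?c - a j * b i)" using 1 by simp
      then have "?c * (a i * b j + a j * b i) \<le> ?c * (?c + c i * e j)"
        using 2 by (simp add: algebra_simps)
      then have "a i * b j + a j * b i \<le> ?c + c i * e j" using c by (simp only: mult_le_cancel_left_pos)
      then show ?thesis by simp
    qed
  qed
  have all: "a i * b j + a j * b i \<le> c i * e j + c j * e i" for i j
    using lt[of i j] lt[of j i] le[of i i] by (cases i j rule: linorder_cases) auto
  have "2 * (sum a I * sum b I) = (\<Sum>i\<in>I. \<Sum>j\<in>I. a i * b j) + (\<Sum>j\<in>I. \<Sum>i\<in>I. a i * b j)"
    by (simp add: sum_product sum.swap[of "\<lambda>i j. a i * b j"])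
  also have "\<dots> = (\<Sum>i\<in>I. \<Sum>j\<in>I. a i * b j + a j * b i)" by (simp add: sum.distrib)
  also have "\<dots> \<le> (\<Sum>i\<in>I. \<Sum>j\<in>I. c i * e j + c j * e i)" by (intro sum_mono all)
  also have "\<dots> = (\<Sum>i\<in>I. \<Sum>j\<in>I. c i * e j) + (\<Sum>j\<in>I. \<Sum>i\<in>I. c i * e j)" by (simp add: sum.distrib)
  also have "\<dots> = 2 * (sum c I * sum e I)"
    by (simp add: sum_product sum.swap[of "\<lambda>i j. c i * e j"])
  finally show ?thesis by simp
qed

text \<open>Daykin's inequality; the fibres over one coordinate reduce it to the chain case.\<close>

lemma daykin:
  fixes A B :: "('a \<Rightarrow> int) set"
  assumes "finite V" "finite A" "finite B" "A \<subseteq> extensional V" "B \<subseteq> extensional V"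
  shows "card A * card B \<le> card {(\<lambda>v. max (f v) (g v)) | f g. f \<in> A \<and> g \<in> B}
     * card {(\<lambda>v. min (f v) (g v)) | f g. f \<in> A \<and> g \<in> B}"
  using assms
proof (induction V arbitrary: A B rule: finite_induct)
  case empty
  have "A \<subseteq> {\<lambda>_. undefined}" "B \<subseteq> {\<lambda>_. undefined}" using empty by (auto simp: extensional_def)
  then have "A = {} \<or> A = {\<lambda>_. undefined}" "B = {} \<or> B = {\<lambda>_. undefined}" by blast+
  then show ?case by auto
next
  case (insert v V)
  define J where "J = (\<lambda>A B. {(\<lambda>v::'a. max (f v) (g v :: int)) | f g. f \<in> A \<and> g \<in> B})"
  define M where "M = (\<lambda>A B. {(\<lambda>v::'a. min (f v) (g v :: int)) | f g. f \<in> A \<and> g \<in> B})"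
  define fib where "fib = (\<lambda>(A :: ('a \<Rightarrow> int) set) i. {f(v := undefined) | f. f \<in> A \<and> f v = i})"
  have J_im: "J A B = (\<lambda>(f, g). (\<lambda>v. max (f v) (g v))) ` (A \<times> B)" for A B by (auto simp: J_def)
  have M_im: "M A B = (\<lambda>(f, g). (\<lambda>v. min (f v) (g v))) ` (A \<times> B)" for A B by (auto simp: M_def)
  have finJ: "finite (J A B)" and finM: "finite (M A B)" if "finite A" "finite B" for A B
    using that by (auto simp: J_im M_im)
  have fibf: "finite (fib A i)" if "finite A" for A i
    using finite_imageI[OF that, of "\<lambda>f. f(v := undefined)"]
    by (rule rev_finite_subset) (auto simp: fib_def)
  have fib_card: "card {f \<in> A. f v = i} = card (fib A i)" for A i
  proof -
    have "fib A i = (\<lambda>f. f(v := undefined)) ` {f \<in> A. f v = i}" by (auto simp: fib_def)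
    moreover have "inj_on (\<lambda>f. f(v := undefined)) {f \<in> A. f v = i}"
    proof (rule inj_onI)
      fix f g :: "'a \<Rightarrow> int"
      assume fg: "f \<in> {f \<in> A. f v = i}" "g \<in> {f \<in> A. f v = i}"
        and eq: "f(v := undefined) = g(v := undefined)"
      show "f = g"
      proof
        fix w show "f w = g w" using fg fun_cong[OF eq, of w] by (cases "w = v") auto
      qed
    qed
    ultimately show ?thesis by (simp add: card_image)
  qed
  \<comment> \<open>One index set for the values at \<open>v\<close> in all four families, so that
    their cardinalities become sums over the same chain.\<close>
  define I where "I = (\<lambda>f. f v) ` (A \<union> B \<union> J A B \<union> M A B)"
  have finI: "finite I" using insert.prems finJ finM by (auto simp: I_def)
  have tot: "card C = (\<Sum>i\<in>I. card (fib C i))" if "finite C" "(\<lambda>f. f v) ` C \<subseteq> I" for C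
  proof -
    have "card C = (\<Sum>i\<in>I. card {f \<in> C. f v = i})"
      using sum.group[OF that(1) finI that(2), of "\<lambda>_. 1::nat"] by simp
    then show ?thesis by (simp add: fib_card)
  qed
  have step: "card (fib A i) * card (fib B j) \<le> card (fib (J A B) (max i j)) * card (fib (M A B) (min i j))" for i j
  proof -
    have ext: "fib A i \<subseteq> extensional V" "fib B j \<subseteq> extensional V"
      using insert.prems by (auto simp: fib_def extensional_def)
    have "card (fib A i) * card (fib B j) \<le> card (J (fib A i) (fib B j)) * card (M (fib A i) (fib B j))"
      using insert.IH[OF fibf fibf ext] insert.prems by (simp add: J_def M_def)
    also have "\<dots> \<le> card (fib (J A B) (max i j)) * card (fib (M A B) (min i j))"
    proof (intro mult_mono card_mono)
      show "J (fib A i) (fib B j) \<subseteq> fib (J A B) (max i j)"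
      proof
        fix h assume "h \<in> J (fib A i) (fib B j)"
        then obtain f g where fg: "f \<in> A" "f v = i" "g \<in> B" "g v = j"
          "h = (\<lambda>w. max ((f(v := undefined)) w) ((g(v := undefined)) w))" by (auto simp: J_def fib_def)
        have "h = (\<lambda>w. max (f w) (g w))(v := undefined)" using fg by (auto simp: fun_eq_iff)
        then show "h \<in> fib (J A B) (max i j)" using fg unfolding fib_def J_def by blast
      qed
      show "M (fib A i) (fib B j) \<subseteq> fib (M A B) (min i j)"
      proof
        fix h assume "h \<in> M (fib A i) (fib B j)"
        then obtain f g where fg: "f \<in> A" "f v = i" "g \<in> B" "g v = j"
          "h = (\<lambda>w. min ((f(v := undefined)) w) ((g(v := undefined)) w))" by (auto simp: M_def fib_def)
        have "h = (\<lambda>w. min (f w) (g w))(v := undefined)" using fg by (auto simp: fun_eq_iff)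
        then show "h \<in> fib (M A B) (min i j)" using fg unfolding fib_def M_def by blast
      qed
    qed (use insert.prems finJ finM fibf in auto)
    finally show ?thesis .
  qed
  have "real (card A) * real (card B) \<le> real (card (J A B)) * real (card (M A B))"
  proof -
    have "(\<Sum>i\<in>I. real (card (fib A i))) * (\<Sum>i\<in>I. real (card (fib B i)))
      \<le> (\<Sum>i\<in>I. real (card (fib (J A B) i))) * (\<Sum>i\<in>I. real (card (fib (M A B) i)))"
    proof (rule four_sums[OF finI])
      fix i j
      show "real (card (fib A i)) * real (card (fib B j))
        \<le> real (card (fib (J A B) (max i j))) * real (card (fib (M A B) (min i j)))"
        using step[of i j] by (metis of_nat_le_iff of_nat_mult)
    qed auto
    moreover have "card C = (\<Sum>i\<in>I. card (fib C i))" if "C \<in> {A, B, J A B, M A B}" for C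
      using that insert.prems finJ finM by (intro tot) (auto simp: I_def)
    ultimately show ?thesis by (simp flip: of_nat_sum)
  qed
  then have "card A * card B \<le> card (J A B) * card (M A B)" by (metis of_nat_le_iff of_nat_mult)
  then show ?case by (simp add: J_def M_def)
qed

section \<open>Shadows and the Kruskal--Katona theorem\<close>

definition shadow :: "'a set set \<Rightarrow> 'a set set" where
  "shadow A = {s - {i} | s i. s \<in> A \<and> i \<in> s}"

lemma finite_shadow:
  assumes "finite A" "\<And>s. s \<in> A \<Longrightarrow> finite s"
  shows "finite (shadow A)"
proof -
  have "shadow A = (\<Union>s\<in>A. (\<lambda>i. s - {i}) ` s)" by (auto simp: shadow_def)
  then show ?thesis using assms by auto
qed

text \<open>Lovasz's form of the Kruskal--Katona theorem at integer arguments. Either one link is so large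
  that it alone forces the bound, or every link satisfies the hypothesis one dimension lower and the
  bounds add up.\<close>

theorem kruskal_katona:
  fixes A :: "'a set set"
  assumes "finite A" "\<And>s. s \<in> A \<Longrightarrow> finite s \<and> card s = k" "k \<ge> 1" "card A \<le> m choose k" "k \<le> m"
  shows "k * card A \<le> (m + 1 - k) * card (shadow A)"
  using assms(3,1,2,4,5)
proof (induction k arbitrary: A m rule: dec_induct)
  case base
  show ?case
  proof (cases "A = {}")
    case False
    then obtain s where s: "s \<in> A" by auto
    then have "finite s" "card s = 1" using base by auto
    then obtain i where "s = {i}" by (auto simp: card_1_singleton_iff)
    then have "{} \<in> shadow A" using s by (force simp: shadow_def)
    moreover have "finite (shadow A)" using base by (intro finite_shadow) auto
    ultimately have "card (shadow A) \<ge> 1" by (metis One_nat_def Suc_leI card_gt_0_iff empty_iff)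
    then have "m * 1 \<le> m * card (shadow A)" by (intro mult_left_mono) auto
    moreover have "card A \<le> m" using base by simp
    ultimately have "card A \<le> m * card (shadow A)" by linarith
    then show ?thesis by simp
  qed simp
next
  case (step e)
  define link where "link = (\<lambda>v. {s - {v} | s. s \<in> A \<and> v \<in> s})"
  have finS: "finite (shadow A)" using step by (intro finite_shadow) auto
  have link_im: "link v = (\<lambda>s. s - {v}) ` {s \<in> A. v \<in> s}" for v by (auto simp: link_def)
  have finl: "finite (link v)" for v using step by (simp add: link_im)
  have linkel: "finite s \<and> card s = e" if "s \<in> link v" for s v
    using that step.prems(2) by (auto simp: link_def)
  have linkcard: "card (link v) = card {s \<in> A. v \<in> s}" for v
    unfolding link_im by (intro card_image inj_onI) (metis insert_Diff mem_Collect_eq)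
  have linknot: "v \<notin> s" if "s \<in> link v" for s v using that by (auto simp: link_def)
  have shlink: "insert v r \<in> shadow A" "v \<notin> r" if r: "r \<in> shadow (link v)" for r v
  proof -
    obtain s i where si: "s \<in> A" "v \<in> s" "i \<in> s - {v}" "r = s - {v} - {i}"
      using r unfolding shadow_def link_def by blast
    then have "insert v r = s - {i}" by auto
    then show "insert v r \<in> shadow A" using si by (auto simp: shadow_def)
    show "v \<notin> r" using si by auto
  qed
  have finsl: "finite (shadow (link v))" for v using finl linkel by (intro finite_shadow) auto
  have inj_ins: "inj_on (insert v) (shadow (link v))" for v
    using shlink(2) by (intro inj_onI) (metis insert_ident)
  have m1: "m \<ge> Suc e" "e \<ge> 1" using step by auto
  show ?case
  proof (cases "\<exists>v. card (link v) \<ge> (m - 1) choose e")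
    case True
    then obtain v where v: "card (link v) \<ge> (m - 1) choose e" by auto
    \<comment> \<open>The link is cut down to exactly (m - 1 choose e) sets, where the induction
      hypothesis is tight and yields a shadow of (m - 1 choose (e - 1)) sets.\<close>
    obtain B where B: "B \<subseteq> link v" "card B = (m - 1) choose e" "finite B"
      using obtain_subset_with_card_n[OF v] by metis
    have "e * card B \<le> (m - 1 + 1 - e) * card (shadow B)"
      using B linkel m1 by (intro step.IH) auto
    moreover have "e * ((m - 1) choose e) = (m - e) * ((m - 1) choose (e - 1))"
    proof -
      obtain e' where e': "e = Suc e'" using m1 by (cases e) auto
      obtain m' where m': "m = Suc m'" using m1 by (cases m) auto
      have "Suc e' * (m' choose Suc e') = (m' - e') * (m' choose e')"
        by (simp only: binomial_absorb_comp binomial_absorption)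
      then show ?thesis by (simp add: e' m')
    qed
    ultimately have "(m - e) * ((m - 1) choose (e - 1)) \<le> (m - e) * card (shadow B)"
      using B m1 by simp
    then have 1: "(m - 1) choose (e - 1) \<le> card (shadow B)" using m1 by simp
    have "shadow B \<subseteq> shadow (link v)" using B by (auto simp: shadow_def)
    then have 2: "(m - 1) choose (e - 1) \<le> card (shadow (link v))"
      using 1 card_mono[OF finsl] by (meson le_trans)
    \<comment> \<open>The link consists of members of the shadow avoiding \<open>v\<close>, the
      other family of members containing \<open>v\<close>; Pascal's rule adds the two lower
      bounds.\<close>
    have sub: "link v \<union> insert v ` shadow (link v) \<subseteq> shadow A"
    proof (intro Un_least image_subsetI)
      show "link v \<subseteq> shadow A" unfolding link_def shadow_def by blast
    qed (rule shlink(1))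
    have disj: "link v \<inter> insert v ` shadow (link v) = {}" using linknot by blast
    have "m choose e = ((m - 1) choose e) + ((m - 1) choose (e - 1))"
      using m1 choose_reduce_nat[of m e] by simp
    also have "\<dots> \<le> card (link v) + card (insert v ` shadow (link v))"
      using v 2 by (simp add: card_image[OF inj_ins])
    also have "\<dots> = card (link v \<union> insert v ` shadow (link v))"
      using disj finl finsl by (simp add: card_Un_disjoint)
    also have "\<dots> \<le> card (shadow A)" using sub finS by (rule card_mono[rotated])
    finally have 3: "m choose e \<le> card (shadow A)" .
    have "Suc e * card A \<le> Suc e * (m choose Suc e)" using step by (intro mult_left_mono) auto
    also have "\<dots> = (m - e) * (m choose e)"
      by (simp only: binomial_absorb_comp binomial_absorption)
    also have "\<dots> \<le> (m - e) * card (shadow A)" using 3 by simp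
    finally show ?thesis by simp
  next
    case False
    define U where "U = \<Union>A"
    have finU: "finite U" using step by (auto simp: U_def)
    have ih: "e * card (link v) \<le> (m - e) * card (shadow (link v))" for v
    proof -
      have "e * card (link v) \<le> (m - 1 + 1 - e) * card (shadow (link v))"
        using False linkel m1 finl by (intro step.IH) (auto simp: not_le intro: less_imp_le)
      then show ?thesis using m1 by simp
    qed
    \<comment> \<open>Double counting over \<open>v\<close>: a set of \<open>A\<close> appears in
      \<open>Suc e\<close> links, whereas a member r of the shadow is reached as
      \<open>insert v (r - {v})\<close> for at most its e elements \<open>v\<close>. The surplus
      factor e cancels at the end.\<close>
    have s1: "(\<Sum>v\<in>U. card (link v)) = Suc e * card A"
    proof -
      have "(\<Sum>v\<in>U. card (link v)) = (\<Sum>v\<in>U. \<Sum>s\<in>A. if v \<in> s then 1 else 0)"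
        using step by (simp add: linkcard sum.If_cases Int_def)
      also have "\<dots> = (\<Sum>s\<in>A. \<Sum>v\<in>U. if v \<in> s then 1 else 0)" by (rule sum.swap)
      also have "\<dots> = (\<Sum>s\<in>A. card s)"
      proof (rule sum.cong[OF refl])
        fix s assume "s \<in> A"
        then have "U \<inter> s = s" by (auto simp: U_def)
        then show "(\<Sum>v\<in>U. if v \<in> s then 1 else 0) = card s" using finU by (simp add: sum.If_cases Int_def)
      qed
      also have "\<dots> = (\<Sum>s\<in>A. Suc e)" using step by (intro sum.cong) auto
      finally show ?thesis by simp
    qed
    have s2: "(\<Sum>v\<in>U. card (shadow (link v))) \<le> e * card (shadow A)"
    proof -
      have "card (shadow (link v)) \<le> card {r \<in> shadow A. v \<in> r}" for v
      proof -
        have "insert v ` shadow (link v) \<subseteq> {r \<in> shadow A. v \<in> r}" using shlink by auto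
        then have "card (insert v ` shadow (link v)) \<le> card {r \<in> shadow A. v \<in> r}"
          using finS by (intro card_mono) auto
        then show ?thesis by (simp add: card_image[OF inj_ins])
      qed
      then have "(\<Sum>v\<in>U. card (shadow (link v))) \<le> (\<Sum>v\<in>U. card {r \<in> shadow A. v \<in> r})"
        by (rule sum_mono)
      also have "\<dots> = (\<Sum>v\<in>U. \<Sum>r\<in>shadow A. if v \<in> r then 1 else 0)"
        using finS by (simp add: sum.If_cases Int_def)
      also have "\<dots> = (\<Sum>r\<in>shadow A. \<Sum>v\<in>U. if v \<in> r then 1 else 0)" by (rule sum.swap)
      also have "\<dots> \<le> (\<Sum>r\<in>shadow A. e)"
      proof (rule sum_mono)
        fix r assume "r \<in> shadow A"
        then obtain s i where si: "s \<in> A" "i \<in> s" "r = s - {i}" by (auto simp: shadow_def)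
        then have r: "finite r" "card r = e" using step.prems(2)[of s] by auto
        have "(\<Sum>v\<in>U. if v \<in> r then 1 else 0) = card (U \<inter> r)" using finU by (simp add: sum.If_cases Int_def)
        also have "\<dots> \<le> e" using r card_mono[of r "U \<inter> r"] by auto
        finally show "(\<Sum>v\<in>U. if v \<in> r then 1 else 0) \<le> e" .
      qed
      finally show ?thesis by (simp add: mult.commute)
    qed
    have "e * (Suc e * card A) = (\<Sum>v\<in>U. e * card (link v))" by (simp only: s1[symmetric] sum_distrib_left)
    also have "\<dots> \<le> (\<Sum>v\<in>U. (m - e) * card (shadow (link v)))" by (intro sum_mono ih)
    also have "\<dots> = (m - e) * (\<Sum>v\<in>U. card (shadow (link v)))" by (simp add: sum_distrib_left)
    also have "\<dots> \<le> (m - e) * (e * card (shadow A))" using s2 by (rule mult_left_mono) simp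
    finally have "e * (Suc e * card A) \<le> e * ((m - e) * card (shadow A))" by (simp add: ac_simps)
    then show ?thesis using m1 by simp
  qed
qed

section \<open>Containers in biregular graphs\<close>

definition nbhd :: "('a \<Rightarrow> 'a set) \<Rightarrow> 'a set \<Rightarrow> 'a set" where
  "nbhd nb A = (\<Union>v\<in>A. nb v)"

text \<open>All that the container argument uses of the graph. The axioms are symmetric in
  \<open>X\<close> and \<open>Y\<close>, so every result holds for both sides through
  \<open>swap\<close>. The isoperimetric axioms express a dichotomy: with t = |N(A)| - |A|, either
  \<open>A\<close> or the complement of N(A) has at most d t elements.\<close>

locale bireg =
  fixes X Y :: "'a set" and nb :: "'a \<Rightarrow> 'a set" and d N :: nat
  assumes finite_X: "finite X" and finite_Y: "finite Y" and disj: "X \<inter> Y = {}"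
    and card_X: "card X = N" and card_Y: "card Y = N" and d_pos: "d > 0"
    and nb_X: "x \<in> X \<Longrightarrow> nb x \<subseteq> Y" and nb_Y: "y \<in> Y \<Longrightarrow> nb y \<subseteq> X"
    and deg_X: "x \<in> X \<Longrightarrow> card (nb x) = d" and deg_Y: "y \<in> Y \<Longrightarrow> card (nb y) = d"
    and nb_sym: "x \<in> X \<Longrightarrow> y \<in> Y \<Longrightarrow> y \<in> nb x \<longleftrightarrow> x \<in> nb y"
    and codeg_X: "x \<in> X \<Longrightarrow> x' \<in> X \<Longrightarrow> x \<noteq> x' \<Longrightarrow> card (nb x \<inter> nb x') \<le> 1"
    and codeg_Y: "y \<in> Y \<Longrightarrow> y' \<in> Y \<Longrightarrow> y \<noteq> y' \<Longrightarrow> card (nb y \<inter> nb y') \<le> 1"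
    and iso_X: "A \<subseteq> X \<Longrightarrow>
      min (real (card A)) (real N - real (card (nbhd nb A))) \<le> real d * (real (card (nbhd nb A)) - real (card A))"
    and iso_Y: "A \<subseteq> Y \<Longrightarrow>
      min (real (card A)) (real N - real (card (nbhd nb A))) \<le> real d * (real (card (nbhd nb A)) - real (card A))"
begin

abbreviation Nb :: "'a set \<Rightarrow> 'a set" where "Nb \<equiv> nbhd nb"

lemma swap: "bireg Y X nb d N"
proof
  show "Y \<inter> X = {}" using disj by blast
  show "y \<in> nb x \<longleftrightarrow> x \<in> nb y" if "x \<in> Y" "y \<in> X" for x y using nb_sym[OF that(2,1)] by simp
qed (fact finite_X finite_Y card_X card_Y d_pos nb_X nb_Y deg_X deg_Y codeg_X codeg_Y iso_X iso_Y)+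

lemma Nb_subset: "A \<subseteq> X \<Longrightarrow> Nb A \<subseteq> Y"
  using nb_X by (auto simp: nbhd_def)

lemma finite_Nb: "A \<subseteq> X \<Longrightarrow> finite (Nb A)"
  using Nb_subset finite_Y finite_subset by blast

lemma nb_sub_Nb: "x \<in> A \<Longrightarrow> nb x \<subseteq> Nb A"
  by (auto simp: nbhd_def)

lemma finite_sub: "A \<subseteq> X \<Longrightarrow> finite A" "B \<subseteq> Y \<Longrightarrow> finite B"
  using finite_X finite_Y finite_subset by blast+

lemma finite_nb: "x \<in> X \<Longrightarrow> finite (nb x)" "y \<in> Y \<Longrightarrow> finite (nb y)"
  using nb_X nb_Y finite_sub by blast+

section \<open>Double counting of edges and two-step paths\<close>

lemma double_count_weighted:
  fixes f :: "'a \<Rightarrow> real"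
  assumes "B \<subseteq> Y" "C \<subseteq> X"
  shows "(\<Sum>y\<in>B. \<Sum>x\<in>nb y \<inter> C. f x) = (\<Sum>x\<in>C. real (card (nb x \<inter> B)) * f x)"
proof -
  have fin: "finite B" "finite C" using assms finite_sub by auto
  have "(\<Sum>y\<in>B. \<Sum>x\<in>nb y \<inter> C. f x) = (\<Sum>y\<in>B. \<Sum>x\<in>C. if x \<in> nb y then f x else 0)"
    using fin by (simp add: sum.If_cases Int_def conj_commute)
  also have "\<dots> = (\<Sum>x\<in>C. \<Sum>y\<in>B. if x \<in> nb y then f x else 0)" by (rule sum.swap)
  also have "\<dots> = (\<Sum>x\<in>C. real (card (nb x \<inter> B)) * f x)"
  proof (rule sum.cong[OF refl])
    fix x assume x: "x \<in> C"
    have "{y \<in> B. x \<in> nb y} = nb x \<inter> B" using assms x nb_sym by blast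
    then show "(\<Sum>y\<in>B. if x \<in> nb y then f x else 0) = real (card (nb x \<inter> B)) * f x"
      using fin by (simp add: sum.If_cases Int_def)
  qed
  finally show ?thesis .
qed

lemma double_count:
  assumes "B \<subseteq> Y" "C \<subseteq> X"
  shows "(\<Sum>y\<in>B. real (card (nb y \<inter> C))) = (\<Sum>x\<in>C. real (card (nb x \<inter> B)))"
  using double_count_weighted[OF assms, of "\<lambda>_. 1"] by simp

text \<open>All d |C| edges at \<open>C\<close> are among the d |N(C)| edges at N(C); the remaining
  ones lead out of \<open>C\<close>. A small t therefore means few stray edges.\<close>

lemma sum_nb_diff:
  assumes "C \<subseteq> X"
  shows "(\<Sum>v\<in>Nb C. real (card (nb v - C))) = real d * (real (card (Nb C)) - real (card C))"
proof -
  have sub: "Nb C \<subseteq> Y" using assms by (rule Nb_subset)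
  have "real (card (nb v - C)) = real d - real (card (nb v \<inter> C))" if "v \<in> Nb C" for v
  proof -
    have "card (nb v) = card (nb v \<inter> C) + card (nb v - C)"
      using card_Int_Diff finite_nb that sub by blast
    then show ?thesis using that sub deg_Y by fastforce
  qed
  then have "(\<Sum>v\<in>Nb C. real (card (nb v - C))) = (\<Sum>v\<in>Nb C. real d - real (card (nb v \<inter> C)))"
    by simp
  also have "\<dots> = real d * real (card (Nb C)) - (\<Sum>x\<in>C. real (card (nb x \<inter> Nb C)))"
    using double_count[OF sub assms] by (simp add: sum_subtractf)
  also have "(\<Sum>x\<in>C. real (card (nb x \<inter> Nb C))) = (\<Sum>x\<in>C. real d)"
    using assms nb_sub_Nb deg_X by (intro sum.cong) (auto simp: Int_absorb2)
  finally show ?thesis by (simp add: algebra_simps)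
qed

lemma card_le_Nb: "C \<subseteq> X \<Longrightarrow> card C \<le> card (Nb C)"
proof -
  assume C: "C \<subseteq> X"
  have "0 \<le> real d * (real (card (Nb C)) - real (card C))"
    unfolding sum_nb_diff[OF C, symmetric] by (intro sum_nonneg) auto
  then show ?thesis using d_pos by (simp add: zero_le_mult_iff)
qed

text \<open>Markov's inequality for the edges that lead from N(C) out of \<open>C\<close>.\<close>

lemma card_many_bad:
  fixes \<beta> t :: real
  assumes "C \<subseteq> X" "B \<subseteq> Nb C" "\<And>v. v \<in> B \<Longrightarrow> real (card (nb v - C)) \<ge> \<beta>"
    "t = real (card (Nb C)) - real (card C)"
  shows "\<beta> * real (card B) \<le> real d * t"
proof -
  have "real (card B) * \<beta> \<le> (\<Sum>v\<in>B. real (card (nb v - C)))"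
    using assms(3) by (intro sum_bounded_below) auto
  also have "\<dots> \<le> (\<Sum>v\<in>Nb C. real (card (nb v - C)))"
    using assms(1,2) finite_Nb by (intro sum_mono2) auto
  finally show ?thesis unfolding sum_nb_diff[OF assms(1)] assms(4) by (simp add: mult.commute)
qed

text \<open>Apart from those returning to \<open>v\<close>, two-step paths from \<open>v\<close>
  have distinct ends: two neighbours of \<open>v\<close> share \<open>v\<close> and, by the codegree
  bound, nothing else. At most d paths return.\<close>

lemma paths_le:
  assumes v: "v \<in> Y" and C: "C \<subseteq> X" and B: "B \<subseteq> Y"
  shows "(\<Sum>x\<in>nb v \<inter> C. real (card (nb x \<inter> B))) \<le> real (card (Nb (nb v \<inter> C) \<inter> B)) + real d"
proof -
  let ?M = "nb v \<inter> C"
  have finM: "finite ?M" using v finite_nb by auto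
  have MX: "?M \<subseteq> X" using C by auto
  have "card (nb x \<inter> B) \<le> card (nb x \<inter> B - {v}) + 1" for x
    using card_Diff1_le[of "nb x \<inter> B" v] by (metis Suc_eq_plus1 card_Diff_singleton_if le_SucI diff_Suc_1 le_diff_conv order_refl)
  then have "(\<Sum>x\<in>?M. card (nb x \<inter> B)) \<le> (\<Sum>x\<in>?M. card (nb x \<inter> B - {v}) + 1)" by (rule sum_mono)
  also have "\<dots> = (\<Sum>x\<in>?M. card (nb x \<inter> B - {v})) + card ?M" by (simp add: sum_Suc)
  also have "(\<Sum>x\<in>?M. card (nb x \<inter> B - {v})) = card (\<Union>x\<in>?M. nb x \<inter> B - {v})"
  proof (rule card_UN_disjoint[symmetric, OF finM])
    show "\<forall>x\<in>?M. finite (nb x \<inter> B - {v})" using MX finite_nb by blast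
    show "\<forall>x\<in>?M. \<forall>x'\<in>?M. x \<noteq> x' \<longrightarrow> (nb x \<inter> B - {v}) \<inter> (nb x' \<inter> B - {v}) = {}"
    proof (intro ballI impI)
      fix x x' assume x: "x \<in> ?M" "x' \<in> ?M" "x \<noteq> x'"
      have xX: "x \<in> X" "x' \<in> X" using x MX by auto
      have "v \<in> nb x \<inter> nb x'" using x xX v nb_sym by auto
      moreover have "card (nb x \<inter> nb x') \<le> 1" "finite (nb x \<inter> nb x')"
        using codeg_X x xX finite_nb by auto
      ultimately have "nb x \<inter> nb x' = {v}"
        by (metis card_le_Suc0_iff_eq One_nat_def subsetI subset_singletonD empty_iff singletonI)
      then show "(nb x \<inter> B - {v}) \<inter> (nb x' \<inter> B - {v}) = {}" by auto
    qed
  qed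
  also have "\<dots> \<le> card (Nb ?M \<inter> B)"
    using MX finite_Nb by (intro card_mono) (auto simp: nbhd_def)
  also have "card ?M \<le> d" using card_mono[of "nb v" ?M] finite_nb v deg_Y by auto
  finally have "(\<Sum>x\<in>?M. card (nb x \<inter> B)) \<le> card (Nb ?M \<inter> B) + d" by simp
  then show ?thesis by (metis of_nat_add of_nat_le_iff of_nat_sum)
qed

text \<open>Averaging over paths v - x - y with v in N(C), x in \<open>C\<close> and y in the
  uncovered part \<open>B\<close>. There are at least d ^ 2 (|B| - t) of them. At most t / \<theta>
  vertices v have more than \<theta> d neighbours outside \<open>C\<close>, and they account for at
  most d ^ 2 paths each. If every other v reached less than the claimed share of \<open>B\<close>,
  the total would be too small.\<close>

lemma greedy_step:
  fixes \<theta> t :: real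
  assumes C: "C \<subseteq> X" and t: "t = real (card (Nb C)) - real (card C)" "t > 0"
    and g: "real (card (Nb C)) \<le> (real d + 1) * t" and \<theta>: "0 < \<theta>" "\<theta> \<le> 1/2"
    and B: "B \<subseteq> Nb C" "4 * t / \<theta> \<le> real (card B)"
  shows "\<exists>v\<in>Nb C. real (card (nb v - C)) \<le> \<theta> * real d \<and>
    real d ^ 2 / (4 * real (card (Nb C))) * real (card B) \<le> real (card (Nb (nb v \<inter> C) \<inter> B))"
proof (rule ccontr)
  assume neg: "\<not> ?thesis"
  define G where "G = Nb C"
  define g where "g = real (card G)"
  define D where "D = real d"
  define b where "b = real (card B)"
  define paths where "paths = (\<lambda>v. \<Sum>x\<in>nb v \<inter> C. real (card (nb x \<inter> B)))"
  define Bad where "Bad = {v\<in>G. real (card (nb v - C)) > \<theta> * D}"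
  have GY: "G \<subseteq> Y" and BY: "B \<subseteq> Y" using Nb_subset[OF C] B by (auto simp: G_def)
  have finG: "finite G" using GY finite_sub by auto
  have D: "D \<ge> 1" using d_pos by (simp add: D_def)
  have gpos: "g > 0" using t by (simp add: g_def G_def)
  have "(\<Sum>v\<in>G. paths v) = (\<Sum>x\<in>C. real (card (nb x \<inter> G)) * real (card (nb x \<inter> B)))"
    unfolding paths_def using double_count_weighted[OF GY C] by simp
  also have "\<dots> = (\<Sum>x\<in>C. D * real (card (nb x \<inter> B)))"
    using C nb_sub_Nb deg_X by (intro sum.cong) (auto simp: Int_absorb2 G_def D_def)
  also have "\<dots> = D * (\<Sum>y\<in>B. real (card (nb y \<inter> C)))"
    by (simp add: double_count[OF BY C] sum_distrib_left)
  also have "(\<Sum>y\<in>B. real (card (nb y \<inter> C))) = (\<Sum>y\<in>B. D - real (card (nb y - C)))"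
  proof (rule sum.cong[OF refl])
    fix y assume "y \<in> B"
    then have "card (nb y) = card (nb y \<inter> C) + card (nb y - C)" "card (nb y) = d"
      using card_Int_Diff finite_nb BY deg_Y by blast+
    then show "real (card (nb y \<inter> C)) = D - real (card (nb y - C))" by (simp add: D_def)
  qed
  also have "\<dots> = D * b - (\<Sum>y\<in>B. real (card (nb y - C)))" by (simp add: sum_subtractf b_def)
  finally have 1: "(\<Sum>v\<in>G. paths v) = D * (D * b - (\<Sum>y\<in>B. real (card (nb y - C))))" .
  have "(\<Sum>y\<in>B. real (card (nb y - C))) \<le> (\<Sum>y\<in>G. real (card (nb y - C)))"
    using B finG by (intro sum_mono2) (auto simp: G_def)
  also have "\<dots> = D * t" using sum_nb_diff[OF C] t by (simp add: G_def D_def)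
  finally have lower: "(\<Sum>v\<in>G. paths v) \<ge> D * (D * b - D * t)"
    unfolding 1 using D by (intro mult_left_mono) auto
  have "\<theta> * D * real (card Bad) \<le> real d * t"
    using t by (intro card_many_bad[OF C]) (auto simp: Bad_def G_def)
  then have bad: "real (card Bad) \<le> t / \<theta>" using \<theta> D by (simp add: D_def field_simps)
  have p1: "paths v \<le> D * D" if "v \<in> G" for v
  proof -
    have v: "v \<in> Y" using that GY by auto
    have "paths v \<le> real (card (nb v \<inter> C)) * D" unfolding paths_def
    proof (rule sum_bounded_above)
      fix x assume "x \<in> nb v \<inter> C"
      then have "x \<in> X" using C by auto
      then show "real (card (nb x \<inter> B)) \<le> D"
        using card_mono[of "nb x" "nb x \<inter> B"] finite_nb deg_X by (auto simp: D_def)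
    qed
    also have "\<dots> \<le> D * D"
      using card_mono[of "nb v" "nb v \<inter> C"] finite_nb deg_Y v D by (intro mult_right_mono) (auto simp: D_def)
    finally show ?thesis .
  qed
  have p2: "paths v \<le> D\<^sup>2 / (4 * g) * b + D" if "v \<in> G - Bad" for v
  proof -
    have "paths v \<le> real (card (Nb (nb v \<inter> C) \<inter> B)) + D"
      unfolding paths_def D_def using that GY by (intro paths_le C BY) auto
    moreover have "real (card (Nb (nb v \<inter> C) \<inter> B)) < D\<^sup>2 / (4 * g) * b"
      using neg that unfolding Bad_def D_def g_def b_def G_def by (auto simp: not_le not_less)
    ultimately show ?thesis by simp
  qed
  have "(\<Sum>v\<in>G. paths v) = (\<Sum>v\<in>G - Bad. paths v) + (\<Sum>v\<in>Bad. paths v)"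
    using finG by (intro sum.subset_diff) (auto simp: Bad_def)
  also have "\<dots> \<le> real (card (G - Bad)) * (D\<^sup>2 / (4 * g) * b + D) + real (card Bad) * (D * D)"
    using p1 p2 by (intro add_mono sum_bounded_above) (auto simp: Bad_def)
  also have "\<dots> \<le> g * (D\<^sup>2 / (4 * g) * b + D) + t / \<theta> * (D * D)"
  proof (intro add_mono mult_right_mono bad)
    show "real (card (G - Bad)) \<le> g" using finG by (auto simp: g_def intro: card_mono)
    show "0 \<le> D\<^sup>2 / (4 * g) * b + D" using D gpos by (auto simp: b_def)
  qed (use D in auto)
  also have "g * (D\<^sup>2 / (4 * g) * b + D) = D\<^sup>2 * b / 4 + g * D" using gpos by (simp add: field_simps)
  finally have upper: "(\<Sum>v\<in>G. paths v) \<le> D\<^sup>2 * b / 4 + g * D + t / \<theta> * (D * D)" by simp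
  \<comment> \<open>With u \<ge> 2 t, and g d \<le> 2 d ^ 2 t for the returning paths, the
    comparison becomes (3/4) b \<le> 3 t + u \<le> (5/2) u, against b \<ge> 4 u.\<close>
  define u where "u = t / \<theta>"
  have tu: "t \<le> u / 2" using \<theta> t(2) by (simp add: u_def field_simps)
  have bu: "b \<ge> 4 * u" using B by (simp add: b_def u_def)
  have gu: "g \<le> (D + 1) * t" using g by (simp add: g_def G_def D_def)
  have upos: "u > 0" using \<theta> t by (simp add: u_def)
  have "D * (D * b - D * t) \<le> D\<^sup>2 * b / 4 + g * D + u * (D * D)"
    using lower upper by (simp add: u_def)
  then have "D\<^sup>2 * (3 / 4 * b) \<le> D\<^sup>2 * t + D\<^sup>2 * u + g * D" by (simp add: power2_eq_square algebra_simps)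
  also have "g * D \<le> ((D + 1) * t) * D" using gu D by (intro mult_right_mono) auto
  also have "\<dots> \<le> (2 * D * t) * D" using D t(2) by (intro mult_right_mono) auto
  also have "\<dots> = 2 * D\<^sup>2 * t" by (simp add: power2_eq_square)
  finally have "D\<^sup>2 * (3 / 4 * b) \<le> D\<^sup>2 * (3 * t + u)" by (simp add: algebra_simps)
  then have "3 / 4 * b \<le> 3 * t + u" using D by simp
  then show False using tu bu upos by linarith
qed

text \<open>Every step covers a share q of what is left and so multiplies it by at most exp (- q).
  The maximum records that the process stops once at most 4 t / \<theta> vertices are left, where
  \<open>greedy_step\<close> no longer applies.\<close>

lemma greedy_iter:
  fixes \<theta> t :: real
  assumes C: "C \<subseteq> X" and t: "t = real (card (Nb C)) - real (card C)" "t > 0"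
    and g: "real (card (Nb C)) \<le> (real d + 1) * t" and \<theta>: "0 < \<theta>" "\<theta> \<le> 1/2"
  shows "\<exists>T \<subseteq> {v \<in> Nb C. real (card (nb v - C)) \<le> \<theta> * real d}. card T \<le> n \<and>
    real (card (Nb C - (\<Union>v\<in>T. Nb (nb v \<inter> C)))) \<le>
    max (4 * t / \<theta>) (exp (- (real d ^ 2 / (4 * real (card (Nb C))) * real n)) * real (card (Nb C)))"
proof (induction n)
  case 0
  show ?case by (intro exI[of _ "{}"]) auto
next
  case (Suc n)
  define q where "q = real d ^ 2 / (4 * real (card (Nb C)))"
  define F where "F = (\<lambda>T. \<Union>v\<in>T. Nb (nb v \<inter> C))"
  obtain T where T: "T \<subseteq> {v \<in> Nb C. real (card (nb v - C)) \<le> \<theta> * real d}" "card T \<le> n"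
    "real (card (Nb C - F T)) \<le> max (4 * t / \<theta>) (exp (- (q * real n)) * real (card (Nb C)))"
    using Suc by (auto simp: q_def F_def)
  define B where "B = Nb C - F T"
  have finG: "finite (Nb C)" using finite_Nb C by auto
  show ?case
  proof (cases "real (card B) \<le> 4 * t / \<theta>")
    case True
    then show ?thesis using T(1,2) by (intro exI[of _ T]) (auto simp: B_def F_def)
  next
    case False
    then obtain v where v: "v \<in> Nb C" "real (card (nb v - C)) \<le> \<theta> * real d"
      "q * real (card B) \<le> real (card (Nb (nb v \<inter> C) \<inter> B))"
      using greedy_step[OF C t g \<theta>, of B] by (auto simp: B_def q_def)
    have "Nb C - F (insert v T) = B - Nb (nb v \<inter> C)" by (auto simp: B_def F_def)
    moreover have "card B = card (B \<inter> Nb (nb v \<inter> C)) + card (B - Nb (nb v \<inter> C))"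
      using finG by (intro card_Int_Diff) (auto simp: B_def)
    ultimately have "real (card (Nb C - F (insert v T))) = real (card B) - real (card (Nb (nb v \<inter> C) \<inter> B))"
      by (simp add: Int_commute)
    also have "\<dots> \<le> (1 - q) * real (card B)" using v by (simp add: algebra_simps)
    also have "\<dots> \<le> exp (- q) * real (card B)"
      using exp_ge_add_one_self[of "- q"] by (intro mult_right_mono) auto
    also have "\<dots> \<le> exp (- q) * (exp (- (q * real n)) * real (card (Nb C)))"
      using False T(3) by (intro mult_left_mono) (auto simp: B_def)
    also have "\<dots> = exp (- (q * real (Suc n))) * real (card (Nb C))"
      by (simp add: exp_add[symmetric] algebra_simps)
    finally have "real (card (Nb C - F (insert v T))) \<le> exp (- (q * real (Suc n))) * real (card (Nb C))" .
    moreover have "card (insert v T) \<le> Suc n"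
      using T(2) finite_subset[OF T(1)] finG by (simp add: card_insert_if)
    ultimately show ?thesis using T(1) v unfolding F_def q_def
      by (intro exI[of _ "insert v T"]) (auto intro: max.coboundedI2)
  qed
qed

text \<open>A container is encoded by a set \<open>T0\<close> of vertices, each with its exceptional neighbours (those
  outside the approximated set), whose second neighbourhoods cover most of the target, and by two
  correction sets \<open>T1\<close>, \<open>T2\<close>.\<close>

definition conF1 :: "('a \<times> 'a set) set \<Rightarrow> 'a set \<Rightarrow> 'a set" where
  "conF1 T0 T1 = (\<Union>(v, E)\<in>T0. Nb (nb v - E)) \<union> Nb T1"

definition conS :: "real \<Rightarrow> ('a \<times> 'a set) set \<Rightarrow> 'a set \<Rightarrow> 'a set \<Rightarrow> 'a set" where
  "conS \<psi> T0 T1 T2 = {x \<in> X. real (card (nb x - conF1 T0 T1)) \<le> \<psi>} - Nb T2"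

definition conF :: "real \<Rightarrow> ('a \<times> 'a set) set \<Rightarrow> 'a set \<Rightarrow> 'a set \<Rightarrow> 'a set" where
  "conF \<psi> T0 T1 T2 = conF1 T0 T1 \<union> {y \<in> Y. real (card (nb y \<inter> conS \<psi> T0 T1 T2)) > \<psi>}"

text \<open>A \<psi>-approximating pair in the sense of Sapozhenko. Edges between \<open>S\<close>
  and \<open>Y - F\<close> are sparse seen from either end, which is what forces |S| to exceed |F|
  only slightly (\<open>sandwich_bounds\<close>).\<close>

definition sandwich :: "real \<Rightarrow> 'a set \<Rightarrow> 'a set \<Rightarrow> 'a set \<Rightarrow> 'a set \<Rightarrow> bool" where
  "sandwich \<psi> C G S F \<longleftrightarrow> C \<subseteq> S \<and> S \<subseteq> X \<and> F \<subseteq> G \<and>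
    (\<forall>x\<in>S. real (card (nb x - F)) \<le> \<psi>) \<and> (\<forall>y\<in>Y - F. real (card (nb y \<inter> S)) \<le> \<psi>)"

text \<open>\<open>E\<close> stands for the neighbours of \<open>v\<close> outside the approximated
  set. Admitting only small \<open>E\<close> keeps the cost of a mark well below d bits.\<close>

definition marked :: "real \<Rightarrow> ('a \<times> 'a set) set" where
  "marked \<theta> = (SIGMA v:Y. {E. E \<subseteq> nb v \<and> real (card E) \<le> \<theta> * real d})"

text \<open>Three greedy choices. \<open>T0\<close> covers N(C) up to 4 t / \<theta> vertices by
  second neighbourhoods; \<open>T1\<close>, inside \<open>C\<close>, enlarges the inner set until
  every vertex of \<open>C\<close> misses at most \<psi> of it; \<open>T2\<close>, outside N(C),
  deletes neighbourhoods that cannot meet \<open>C\<close>, until every vertex outside N(C) sees at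
  most \<psi> of the outer set.\<close>

lemma container_exists:
  fixes \<theta> \<psi> t :: real
  assumes C: "C \<subseteq> X" and t: "t = real (card (Nb C)) - real (card C)" "t > 0"
    and g: "real (card (Nb C)) \<le> (real d + 1) * t" and \<theta>: "0 < \<theta>" "\<theta> \<le> 1/2"
    and \<psi>: "0 < \<psi>" "\<psi> \<le> real d / 2" and d: "d \<ge> 4" and td: "t * ln (real d) \<ge> real d"
  shows "\<exists>T0 T1 T2. T0 \<subseteq> marked \<theta> \<and> T1 \<subseteq> X \<and> T2 \<subseteq> Y \<and>
    real (card T0) \<le> 6 * t * ln (real d) / real d \<and> real (card T1) \<le> 4 * t / (\<theta> * \<psi>) \<and>
    real (card T2) \<le> 2 * t / \<psi> \<and> sandwich \<psi> C (Nb C) (conS \<psi> T0 T1 T2) (conF \<psi> T0 T1 T2)"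
proof -
  define G where "G = Nb C"
  define D where "D = real d"
  \<comment> \<open>So many steps shrink |G| by exp (- ln D) = 1 / D, to at most 2 t. They number at
    most 5 t ln D / D + 1, and t ln D \<ge> D absorbs the 1 from rounding, giving the constant
    6.\<close>
  define n where "n = nat \<lceil>4 * real (card G) * ln D / D\<^sup>2\<rceil>"
  have D: "D \<ge> 4" using d by (simp add: D_def)
  have lnD: "ln D > 0" using D by simp
  have GY: "G \<subseteq> Y" using Nb_subset C by (simp add: G_def)
  have finG: "finite G" using GY finite_sub by auto
  have gpos: "real (card G) > 0" using t by (simp add: G_def)
  obtain T where T: "T \<subseteq> {v \<in> G. real (card (nb v - C)) \<le> \<theta> * D}" "card T \<le> n"
    "real (card (G - (\<Union>v\<in>T. Nb (nb v \<inter> C)))) \<le>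
      max (4 * t / \<theta>) (exp (- (D ^ 2 / (4 * real (card G)) * real n)) * real (card G))"
    using greedy_iter[OF C t g \<theta>, of n] unfolding G_def D_def by blast
  have nlow: "4 * real (card G) * ln D / D\<^sup>2 \<le> real n" unfolding n_def by linarith
  have "real n \<le> 4 * real (card G) * ln D / D\<^sup>2 + 1"
    using lnD D unfolding n_def by (simp add: ceiling_less_iff)
  also have "4 * real (card G) * ln D / D\<^sup>2 \<le> 4 * ((D + 1) * t) * ln D / D\<^sup>2"
    using g lnD by (intro divide_right_mono mult_right_mono mult_left_mono) (auto simp: G_def D_def)
  also have "\<dots> \<le> 4 * (5 / 4 * D * t) * ln D / D\<^sup>2"
    using lnD D t by (intro divide_right_mono mult_right_mono mult_left_mono) auto
  also have "\<dots> = 5 * t * ln D / D" using D by (simp add: power2_eq_square)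
  also have "1 \<le> t * ln D / D" using td D by (simp add: D_def)
  finally have nup: "real n \<le> 6 * t * ln D / D" by (simp add: algebra_simps add_divide_distrib[symmetric])
  have "exp (- (D ^ 2 / (4 * real (card G)) * real n)) * real (card G) \<le> exp (- ln D) * real (card G)"
  proof -
    have "ln D = D ^ 2 / (4 * real (card G)) * (4 * real (card G) * ln D / D\<^sup>2)" using gpos D by simp
    also have "\<dots> \<le> D ^ 2 / (4 * real (card G)) * real n" using nlow gpos by (intro mult_left_mono) auto
    finally show ?thesis by (intro mult_right_mono) auto
  qed
  also have "\<dots> = real (card G) / D" using D by (simp add: exp_minus inverse_eq_divide)
  also have "\<dots> \<le> (D + 1) * t / D" using g D by (intro divide_right_mono) (auto simp: G_def D_def)
  also have "\<dots> \<le> 4 * t / \<theta>"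
  proof -
    have "(D + 1) * t / D \<le> 2 * t" using D t by (simp add: field_simps)
    also have "\<dots> \<le> 4 * t / \<theta>" using \<theta> t by (simp add: field_simps)
    finally show ?thesis .
  qed
  finally have B1: "real (card (G - (\<Union>v\<in>T. Nb (nb v \<inter> C)))) \<le> 4 * t / \<theta>" using T(3) by simp
  define T0 where "T0 = (\<lambda>v. (v, nb v - C)) ` T"
  have TY: "T \<subseteq> Y" using T GY by auto
  have finT: "finite T" using TY finite_sub by auto
  have F1eq: "(\<Union>(v, E)\<in>T0. Nb (nb v - E)) = (\<Union>v\<in>T. Nb (nb v \<inter> C))"
    by (auto simp: T0_def Diff_Diff_Int)
  define F1 where "F1 = (\<Union>v\<in>T. Nb (nb v \<inter> C))"
  have F1G: "F1 \<subseteq> G" by (auto simp: F1_def G_def nbhd_def)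
  have T0m: "T0 \<subseteq> marked \<theta>" using T TY by (auto simp: T0_def marked_def D_def)
  have T0c: "real (card T0) \<le> 6 * t * ln D / D"
  proof -
    have "card T0 \<le> n" using T(2) card_image_le[OF finT, of "\<lambda>v. (v, nb v - C)"] by (simp add: T0_def)
    then show ?thesis using nup by linarith
  qed
  have "finite (G - F1)" using finG by auto
  from greedy_cover[OF this \<psi>(1), of C nb] obtain T1 where T1: "T1 \<subseteq> C"
    "real (card T1) * \<psi> \<le> real (card (G - F1))"
    "\<forall>x\<in>C. real (card (nb x \<inter> (G - F1 - (\<Union>j\<in>T1. nb j)))) \<le> \<psi>" by blast
  define F2 where "F2 = conF1 T0 T1"
  have F2: "F2 = F1 \<union> Nb T1" by (simp add: F2_def conF1_def F1eq F1_def)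
  have F2G: "F2 \<subseteq> G" using F2 F1G T1 by (auto simp: G_def nbhd_def)
  have T1c: "real (card T1) \<le> 4 * t / (\<theta> * \<psi>)"
  proof -
    have "real (card T1) * \<psi> \<le> 4 * t / \<theta>" using T1(2) B1 by (simp add: F1_def)
    then show ?thesis using \<psi> \<theta> by (simp add: field_simps)
  qed
  define S1 where "S1 = {x \<in> X. real (card (nb x - F2)) \<le> \<psi>}"
  have CS1: "C \<subseteq> S1"
  proof
    fix x assume x: "x \<in> C"
    have "nb x - F2 = nb x \<inter> (G - F1 - (\<Union>j\<in>T1. nb j))"
      using x nb_sub_Nb[of x C] by (auto simp: F2 nbhd_def G_def)
    then show "x \<in> S1" using T1(3) x C by (auto simp: S1_def)
  qed
  \<comment> \<open>A vertex of \<open>S1 - C\<close> sends at least d - \<psi> \<ge> d / 2 edges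
    into G, but only d t edges lead from G out of \<open>C\<close>.\<close>
  have bound: "real (card S) \<le> 2 * t" if S: "S \<subseteq> S1 - C" for S
  proof -
    have sub: "S \<subseteq> X" using S by (auto simp: S1_def)
    have "(D - \<psi>) * real (card S) \<le> (\<Sum>x\<in>S. real (card (nb x \<inter> G)))"
    proof -
      have "D - \<psi> \<le> real (card (nb x \<inter> G))" if "x \<in> S" for x
      proof -
        have xX: "x \<in> X" "real (card (nb x - F2)) \<le> \<psi>" using that S by (auto simp: S1_def)
        have "card (nb x) = card (nb x \<inter> F2) + card (nb x - F2)" "card (nb x) = d"
          using card_Int_Diff finite_nb deg_X xX by blast+
        moreover have "card (nb x \<inter> F2) \<le> card (nb x \<inter> G)"
          using F2G finite_nb xX by (intro card_mono) auto
        ultimately show ?thesis using xX by (simp add: D_def)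
      qed
      then have "real (card S) * (D - \<psi>) \<le> (\<Sum>x\<in>S. real (card (nb x \<inter> G)))"
        by (rule sum_bounded_below)
      then show ?thesis by (simp add: mult.commute)
    qed
    also have "\<dots> = (\<Sum>y\<in>G. real (card (nb y \<inter> S)))" using double_count[OF GY sub] by simp
    also have "\<dots> \<le> (\<Sum>y\<in>G. real (card (nb y - C)))"
      using S GY finite_nb by (intro sum_mono) (auto intro!: card_mono)
    also have "\<dots> = D * t" using sum_nb_diff[OF C] t by (simp add: G_def D_def)
    finally have "(D - \<psi>) * real (card S) \<le> D * t" .
    moreover have "D / 2 * real (card S) \<le> (D - \<psi>) * real (card S)"
      using \<psi> by (intro mult_right_mono) (auto simp: D_def)
    ultimately have "D * (real (card S)) \<le> D * (2 * t)" by simp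
    then show ?thesis using D by simp
  qed
  have "finite (S1 - C)" using finite_X by (auto simp: S1_def)
  from greedy_cover[OF this \<psi>(1), of "Y - G" nb] obtain T2 where T2: "T2 \<subseteq> Y - G"
    "real (card T2) * \<psi> \<le> real (card (S1 - C))"
    "\<forall>y\<in>Y - G. real (card (nb y \<inter> (S1 - C - (\<Union>j\<in>T2. nb j)))) \<le> \<psi>" by blast
  have T2c: "real (card T2) \<le> 2 * t / \<psi>"
    using T2(2) bound[of "S1 - C"] \<psi> by (simp add: field_simps)
  define S where "S = conS \<psi> T0 T1 T2"
  define F where "F = conF \<psi> T0 T1 T2"
  have S: "S = S1 - Nb T2" by (simp add: S_def conS_def S1_def F2_def)
  have F: "F = F2 \<union> {y \<in> Y. real (card (nb y \<inter> S)) > \<psi>}" by (simp add: F_def conF_def F2_def S_def)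
  have away: "nb y \<inter> C = {}" if "y \<in> Y - G" for y
    using that C nb_sym by (force simp: G_def nbhd_def)
  have "C \<inter> Nb T2 = {}" using T2(1) away by (force simp: nbhd_def)
  then have CS: "C \<subseteq> S" using CS1 by (auto simp: S)
  have small: "real (card (nb y \<inter> S)) \<le> \<psi>" if y: "y \<in> Y - G" for y
  proof -
    have "nb y \<inter> S = nb y \<inter> (S1 - C - (\<Union>j\<in>T2. nb j))" using away[OF y] by (auto simp: S nbhd_def)
    then show ?thesis using T2(3) y by simp
  qed
  have FG: "F \<subseteq> G" using F2G small by (force simp: F)
  have "sandwich \<psi> C G S F"
    unfolding sandwich_def
  proof (intro conjI ballI)
    show "S \<subseteq> X" by (auto simp: S S1_def)
    fix x assume x: "x \<in> S"
    then have "card (nb x - F) \<le> card (nb x - F2)"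
      using finite_nb by (intro card_mono) (auto simp: F S S1_def)
    then show "real (card (nb x - F)) \<le> \<psi>" using x by (auto simp: S S1_def)
  next
    fix y assume "y \<in> Y - F"
    then show "real (card (nb y \<inter> S)) \<le> \<psi>" by (auto simp: F)
  qed (use CS FG in auto)
  moreover have "T1 \<subseteq> X" "T2 \<subseteq> Y" using T1(1) C T2(1) by auto
  ultimately show ?thesis using T0m T0c T1c T2c unfolding S_def F_def G_def D_def
    by (intro exI[of _ T0] exI[of _ T1] exI[of _ T2]) simp
qed

end

section \<open>Summation over containers\<close>

lemma powr_shift:
  fixes a b c :: real
  shows "c * 2 powr a * 2 powr (- b) = c * 2 powr (a - b)"
  by (simp add: powr_diff powr_minus divide_inverse)

lemma sum_cover_le:
  fixes f :: "'b \<Rightarrow> real"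
  assumes "finite I" "\<And>i. i \<in> I \<Longrightarrow> finite (B i)" "A \<subseteq> (\<Union>i\<in>I. B i)"
    "\<And>i x. i \<in> I \<Longrightarrow> x \<in> B i \<Longrightarrow> 0 \<le> f x"
  shows "sum f A \<le> (\<Sum>i\<in>I. sum f (B i))"
proof -
  have "sum f A \<le> sum f (\<Union>i\<in>I. B i)" using assms by (intro sum_mono2) auto
  also have "\<dots> \<le> (\<Sum>i\<in>I. sum f (B i))" using assms
  proof (induction I arbitrary: A rule: finite_induct)
    case (insert i I)
    have fin: "finite (B i)" "finite (\<Union>j\<in>I. B j)" using insert by auto
    have "sum f (\<Union>j\<in>insert i I. B j) = sum f (B i \<union> (\<Union>j\<in>I. B j))" by simp
    also have "\<dots> \<le> sum f (B i) + sum f (\<Union>j\<in>I. B j)"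
      using fin insert.prems(3)
      by (subst sum.union_inter[symmetric, OF fin, THEN eq_diff_eq[THEN iffD2]]) (auto intro!: sum_nonneg insert.prems(3))
    also have "\<dots> \<le> sum f (B i) + (\<Sum>j\<in>I. sum f (B j))"
      using insert.prems by (intro add_left_mono insert.IH) blast+
    finally show ?case using insert by simp
  qed simp
  finally show ?thesis .
qed

lemma card_image_UN_le:
  assumes "finite I" "\<And>i. i \<in> I \<Longrightarrow> finite (K i)" "\<And>i. i \<in> I \<Longrightarrow> real (card (K i)) \<le> b"
  shows "real (card (\<Union>i\<in>I. f ` K i)) \<le> real (card I) * b"
proof -
  have "card (\<Union>i\<in>I. f ` K i) \<le> (\<Sum>i\<in>I. card (f ` K i))" using assms by (intro card_UN_le)
  also have "\<dots> \<le> (\<Sum>i\<in>I. card (K i))" using assms by (intro sum_mono card_image_le)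
  finally have "real (card (\<Union>i\<in>I. f ` K i)) \<le> (\<Sum>i\<in>I. real (card (K i)))" by (metis of_nat_le_iff of_nat_sum)
  also have "\<dots> \<le> real (card I) * b" by (intro sum_bounded_above assms)
  finally show ?thesis .
qed

context bireg begin

section \<open>Closures, defects and the number of containers\<close>

definition cl :: "'a set \<Rightarrow> 'a set" where
  "cl A = {x \<in> X. nb x \<subseteq> Nb A}"

text \<open>The subtraction is exact on subsets of \<open>X\<close>: by regularity a closure is no
  larger than its neighbourhood (\<open>real_defect\<close>).\<close>

definition defect :: "'a set \<Rightarrow> nat" where
  "defect A = card (Nb A) - card (cl A)"

lemma cl_subset: "cl A \<subseteq> X" by (auto simp: cl_def)

lemma subset_cl: "A \<subseteq> X \<Longrightarrow> A \<subseteq> cl A" by (auto simp: cl_def nbhd_def)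

lemma Nb_cl: "A \<subseteq> X \<Longrightarrow> Nb (cl A) = Nb A"
  using subset_cl by (auto simp: cl_def nbhd_def)

lemma card_cl_le: "A \<subseteq> X \<Longrightarrow> card (cl A) \<le> card (Nb A)"
  using card_le_Nb[OF cl_subset] Nb_cl by metis

lemma real_defect: "A \<subseteq> X \<Longrightarrow> real (defect A) = real (card (Nb A)) - real (card (cl A))"
  using card_cl_le by (simp add: defect_def of_nat_diff)

lemma card_Nb_le_N: "A \<subseteq> X \<Longrightarrow> card (Nb A) \<le> N"
  using card_mono[OF finite_Y Nb_subset] card_Y by metis

text \<open>For the second bound the d |S| edges at \<open>S\<close> are split. At most d |F| end in
  \<open>F\<close>. The others start in \<open>S - C\<close>, at most \<psi> from each of 2 t
  vertices, or join \<open>C\<close> to N(C) - F, where each of at most 2 t vertices receives at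
  most \<psi>.\<close>

lemma sandwich_bounds:
  fixes \<psi> t :: real
  assumes C: "C \<subseteq> X" and t: "t = real (card (Nb C)) - real (card C)"
    and \<psi>: "0 < \<psi>" "\<psi> \<le> real d / 2" and sw: "sandwich \<psi> C (Nb C) S F"
  shows "real (card (S - C)) \<le> 2 * t" "real (card S) \<le> real (card F) + 4 * \<psi> * t / real d"
proof -
  define G where "G = Nb C"
  define D where "D = real d"
  have D: "D > 0" using d_pos by (simp add: D_def)
  have s: "C \<subseteq> S" "S \<subseteq> X" "F \<subseteq> G" "\<And>x. x \<in> S \<Longrightarrow> real (card (nb x - F)) \<le> \<psi>"
    "\<And>y. y \<in> Y - F \<Longrightarrow> real (card (nb y \<inter> S)) \<le> \<psi>"
    using sw by (auto simp: sandwich_def G_def)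
  have GY: "G \<subseteq> Y" using Nb_subset C by (simp add: G_def)
  have FY: "F \<subseteq> Y" using s GY by auto
  have fin: "finite S" "finite C" "finite G" "finite F" using s C GY FY finite_sub by auto
  have split: "real (card (nb x \<inter> F)) = D - real (card (nb x - F))" if "x \<in> S" for x
  proof -
    have "card (nb x) = card (nb x \<inter> F) + card (nb x - F)" "card (nb x) = d"
      using card_Int_Diff finite_nb deg_X s that by blast+
    then show ?thesis by (simp add: D_def)
  qed
  have "(D / 2) * real (card (S - C)) \<le> (\<Sum>x\<in>S - C. real (card (nb x \<inter> G)))"
  proof -
    have "D / 2 \<le> real (card (nb x \<inter> G))" if "x \<in> S - C" for x
    proof -
      have "card (nb x \<inter> F) \<le> card (nb x \<inter> G)" using s fin by (intro card_mono) auto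
      then show ?thesis using split[of x] s(4)[of x] that \<psi> by (simp add: D_def)
    qed
    then have "real (card (S - C)) * (D / 2) \<le> (\<Sum>x\<in>S - C. real (card (nb x \<inter> G)))"
      by (rule sum_bounded_below)
    then show ?thesis by (simp add: mult.commute)
  qed
  also have "\<dots> = (\<Sum>y\<in>G. real (card (nb y \<inter> (S - C))))" using double_count[OF GY, of "S - C"] s(2) by (metis Diff_subset subset_trans)
  also have "\<dots> \<le> (\<Sum>y\<in>G. real (card (nb y - C)))"
    using GY finite_nb by (intro sum_mono) (auto intro!: card_mono)
  also have "\<dots> = D * t" using sum_nb_diff[OF C] t by (simp add: G_def D_def)
  finally have "D * real (card (S - C)) \<le> D * (2 * t)" by simp
  then show SC: "real (card (S - C)) \<le> 2 * t" using D by simp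
  have "(D / 2) * real (card (G - F)) \<le> real d * t"
  proof (rule card_many_bad[OF C _ _ t])
    show "G - F \<subseteq> Nb C" by (auto simp: G_def)
    fix y assume y: "y \<in> G - F"
    then have yY: "y \<in> Y" using GY by auto
    have "card (nb y) = card (nb y \<inter> C) + card (nb y - C)" "card (nb y) = d"
      using card_Int_Diff finite_nb deg_Y yY by blast+
    moreover have "card (nb y \<inter> C) \<le> card (nb y \<inter> S)" using s fin by (intro card_mono) auto
    moreover have "real (card (nb y \<inter> S)) \<le> \<psi>" using s(5) y yY by auto
    ultimately show "D / 2 \<le> real (card (nb y - C))" using \<psi> by (simp add: D_def)
  qed
  then have "D * real (card (G - F)) \<le> D * (2 * t)" by (simp add: D_def)
  then have GF: "real (card (G - F)) \<le> 2 * t" using D by simp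
  have "D * real (card S) = (\<Sum>x\<in>S. real (card (nb x \<inter> F))) + (\<Sum>x\<in>S. real (card (nb x - F)))"
    by (simp add: split sum_subtractf)
  also have "(\<Sum>x\<in>S. real (card (nb x \<inter> F))) = (\<Sum>y\<in>F. real (card (nb y \<inter> S)))"
    using double_count[OF FY s(2)] by simp
  also have "\<dots> \<le> real (card F) * D"
  proof (rule sum_bounded_above)
    fix y assume "y \<in> F"
    then have "finite (nb y)" "card (nb y) = d" using FY finite_nb deg_Y by auto
    then show "real (card (nb y \<inter> S)) \<le> D" using card_mono[of "nb y" "nb y \<inter> S"] by (auto simp: D_def)
  qed
  also have "(\<Sum>x\<in>S. real (card (nb x - F))) = (\<Sum>x\<in>S - C. real (card (nb x - F))) + (\<Sum>x\<in>C. real (card (nb x - F)))"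
    using s fin by (intro sum.subset_diff) auto
  also have "(\<Sum>x\<in>S - C. real (card (nb x - F))) \<le> real (card (S - C)) * \<psi>"
    using s by (intro sum_bounded_above) auto
  also have "(\<Sum>x\<in>C. real (card (nb x - F))) = (\<Sum>x\<in>C. real (card (nb x \<inter> (G - F))))"
  proof (rule sum.cong[OF refl])
    fix x assume "x \<in> C"
    then have "nb x - F = nb x \<inter> (G - F)" using nb_sub_Nb by (auto simp: G_def)
    then show "real (card (nb x - F)) = real (card (nb x \<inter> (G - F)))" by simp
  qed
  also have "\<dots> = (\<Sum>y\<in>G - F. real (card (nb y \<inter> C)))" using double_count[of "G - F" C] GY C by (metis Diff_subset subset_trans)
  also have "\<dots> \<le> real (card (G - F)) * \<psi>"
  proof (rule sum_bounded_above)
    fix y assume y: "y \<in> G - F"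
    have "card (nb y \<inter> C) \<le> card (nb y \<inter> S)" using s fin by (intro card_mono) auto
    then show "real (card (nb y \<inter> C)) \<le> \<psi>" using s(5)[of y] y GY by auto
  qed
  finally have "D * real (card S) \<le> real (card F) * D + (real (card (S - C)) * \<psi> + real (card (G - F)) * \<psi>)"
    by simp
  also have "\<dots> \<le> real (card F) * D + (2 * t * \<psi> + 2 * t * \<psi>)"
    using SC GF \<psi> by (intro add_left_mono add_mono mult_right_mono) auto
  finally have "real (card S) \<le> (real (card F) * D + 4 * \<psi> * t) / D"
    using D by (simp add: pos_le_divide_eq algebra_simps)
  then show "real (card S) \<le> real (card F) + 4 * \<psi> * t / real d"
    using D by (simp add: add_divide_distrib D_def)
qed

definition containers :: "real \<Rightarrow> real \<Rightarrow> real \<Rightarrow> ('a set \<times> 'a set) set" where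
  "containers \<theta> \<psi> t = (\<lambda>(T0, T1, T2). (conS \<psi> T0 T1 T2, conF \<psi> T0 T1 T2)) `
    ({T0. T0 \<subseteq> marked \<theta> \<and> real (card T0) \<le> 6 * ln (real d) / real d * t} \<times>
     {T1. T1 \<subseteq> X \<and> real (card T1) \<le> 4 / (\<theta> * \<psi>) * t} \<times> {T2. T2 \<subseteq> Y \<and> real (card T2) \<le> 2 / \<psi> * t})"

lemma finite_marked: "finite (marked \<theta>)"
  unfolding marked_def using finite_Y finite_nb by (intro finite_SigmaI) auto

lemma card_marked_le:
  assumes "0 < \<theta>" "\<theta> \<le> 1/2"
  shows "real (card (marked \<theta>)) \<le> real N * 2 powr (\<theta> * real d * log 2 (exp 1 / \<theta>))"
proof -
  have "real (card {E. E \<subseteq> nb v \<and> real (card E) \<le> \<theta> * real d}) \<le> 2 powr (\<theta> * real d * log 2 (exp 1 / \<theta>))"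
    if v: "v \<in> Y" for v
  proof -
    have "\<theta> * real d \<le> real d" using assms mult_right_mono[of \<theta> 1 "real d"] by simp
    then have "real (card {E. E \<subseteq> nb v \<and> real (card E) \<le> \<theta> * real d})
      \<le> (exp 1 * real d / (\<theta> * real d)) powr (\<theta> * real d)"
      using assms d_pos v finite_nb deg_Y by (intro card_subsets_le) auto
    also have "exp 1 * real d / (\<theta> * real d) = 2 powr (log 2 (exp 1 / \<theta>))"
      using d_pos assms by simp
    finally show ?thesis by (simp add: powr_powr mult.commute)
  qed
  then have "(\<Sum>v\<in>Y. real (card {E. E \<subseteq> nb v \<and> real (card E) \<le> \<theta> * real d}))
    \<le> real (card Y) * 2 powr (\<theta> * real d * log 2 (exp 1 / \<theta>))" by (rule sum_bounded_above)
  moreover have "card (marked \<theta>) = (\<Sum>v\<in>Y. card {E. E \<subseteq> nb v \<and> real (card E) \<le> \<theta> * real d})"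
    unfolding marked_def using finite_Y finite_nb by (intro card_SigmaI) auto
  ultimately show ?thesis by (simp add: card_Y)
qed

end

text \<open>\<open>L\<close> is the number of bits paid per vertex named in an encoding.
  \<open>cost\<close> keeps the total description of a container within \<gamma> / 16 bits per unit
  of t, \<open>caseR\<close> allows t / 4 bits for correcting a neighbourhood inside
  \<open>R0\<close>, \<open>slope\<close> limits by how much the outer set may exceed the inner one,
  and \<open>poly\<close> pays for the union over all defects and neighbourhood sizes.\<close>

locale bireg_num = bireg +
  fixes \<theta> \<psi> \<gamma> L t0 :: real
  assumes \<theta>: "0 < \<theta>" "\<theta> \<le> 1/2" and \<psi>: "0 < \<psi>" "\<psi> \<le> real d / 2" and d4: "d \<ge> 4"
    and \<gamma>: "0 < \<gamma>" "\<gamma> \<le> 1" and t0: "t0 \<ge> 1" "t0 * ln (real d) \<ge> real d"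
    and frac: "6 * ln (real d) / real d \<le> 1" "4 / (\<theta> * \<psi>) \<le> 1"
    and L: "exp 1 * real N \<le> 2 powr L * (6 * ln (real d) / real d * t0)"
      "exp 1 * real N \<le> 2 powr L * (2 / \<psi> * t0)"
    and cost: "6 * ln (real d) / real d * (L + \<theta> * real d * log 2 (exp 1 / \<theta>)) + 4 / (\<theta> * \<psi>) * L + 2 / \<psi> * L \<le> \<gamma> / 16"
    and caseR: "\<gamma> * log 2 (2 * exp 1 * real d ^ 2 / \<gamma>) \<le> 1 / 4"
    and slope: "4 * \<psi> / real d \<le> \<gamma> / 4"
    and poly: "4 * (real N + 1) ^ 2 \<le> 2 powr (\<gamma> * t0 / 16)"
begin

lemma swap_num: "bireg_num Y X nb d N \<theta> \<psi> \<gamma> L t0"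
  by (intro bireg_num.intro swap, unfold_locales)
    (fact \<theta> \<psi> d4 \<gamma> t0 frac L cost caseR slope poly)+

text \<open>Every element costs \<open>L\<close> bits, plus log M for its mark. The ratio N /
  (\<kappa> t) decreases in t, so the single inequality \<open>L'\<close> at \<open>t0\<close>
  serves all larger t.\<close>

lemma card_family_le:
  fixes \<kappa> t M n :: real
  assumes "finite U" "real (card U) \<le> real N * M" "M \<ge> 1" "t0 \<le> t" "t \<le> real N" "0 < \<kappa>" "\<kappa> \<le> 1"
    and L': "exp 1 * real N \<le> 2 powr L * (\<kappa> * t0)"
  shows "real (card {T. T \<subseteq> U \<and> real (card T) \<le> \<kappa> * t}) \<le> 2 powr (\<kappa> * (L + log 2 M) * t)"
proof -
  have t: "t > 0" using assms t0 by linarith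
  have "\<kappa> * t \<le> 1 * t" using assms t by (intro mult_right_mono) auto
  also have "\<dots> \<le> real N * M" using assms mult_left_mono[of 1 M "real N"] by simp
  finally have "\<kappa> * t \<le> real N * M" .
  then have "real (card {T. T \<subseteq> U \<and> real (card T) \<le> \<kappa> * t}) \<le> (exp 1 * (real N * M) / (\<kappa> * t)) powr (\<kappa> * t)"
    using assms t by (intro card_subsets_le) auto
  also have "\<dots> \<le> (2 powr L * M) powr (\<kappa> * t)"
  proof (rule powr_mono2)
    have "exp 1 * real N \<le> 2 powr L * (\<kappa> * t)"
      by (rule order_trans[OF L']) (use assms in \<open>auto intro!: mult_left_mono\<close>)
    then have "exp 1 * real N * M \<le> 2 powr L * (\<kappa> * t) * M" using assms by (intro mult_right_mono) auto
    then show "exp 1 * (real N * M) / (\<kappa> * t) \<le> 2 powr L * M"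
      using assms t by (simp add: pos_divide_le_eq algebra_simps)
  qed (use assms t in auto)
  also have "2 powr L * M = 2 powr (L + log 2 M)" using assms by (simp add: powr_add)
  finally show ?thesis by (simp add: powr_powr algebra_simps)
qed

lemma finite_containers: "finite (containers \<theta> \<psi> t)"
  unfolding containers_def using finite_marked finite_X finite_Y by auto

lemma card_containers_le:
  assumes t: "t0 \<le> t" "t \<le> real N"
  shows "real (card (containers \<theta> \<psi> t)) \<le> 2 powr (\<gamma> / 16 * t)"
proof -
  define P0 where "P0 = {T0. T0 \<subseteq> marked \<theta> \<and> real (card T0) \<le> 6 * ln (real d) / real d * t}"
  define P1 where "P1 = {T1. T1 \<subseteq> X \<and> real (card T1) \<le> 4 / (\<theta> * \<psi>) * t}"
  define P2 where "P2 = {T2. T2 \<subseteq> Y \<and> real (card T2) \<le> 2 / \<psi> * t}"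
  have fin: "finite P0" "finite P1" "finite P2"
    using finite_marked finite_X finite_Y by (auto simp: P0_def P1_def P2_def)
  have "2 / \<psi> \<le> 4 / (\<theta> * \<psi>)" using \<theta> \<psi> by (simp add: field_simps)
  then have f2: "2 / \<psi> \<le> 1" using frac by linarith
  \<comment> \<open>\<open>T1\<close> is allowed to be at least as large as \<open>T2\<close>, so
    the condition on \<open>L\<close> stated for the latter carries over.\<close>
  have L1: "exp 1 * real N \<le> 2 powr L * (4 / (\<theta> * \<psi>) * t0)"
    by (rule order_trans[OF L(2)], intro mult_left_mono mult_right_mono)
      (use \<open>2 / \<psi> \<le> 4 / (\<theta> * \<psi>)\<close> t0 in auto)
  have lnd: "ln (real d) > 0" using d4 by simp
  have M1: "2 powr (\<theta> * real d * log 2 (exp 1 / \<theta>)) \<ge> 1"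
  proof -
    have "exp 1 / \<theta> \<ge> 1" using \<theta> exp_ge_add_one_self[of 1] by (simp add: pos_le_divide_eq)
    then show ?thesis using \<theta> by (intro ge_one_powr_ge_zero) (auto simp: zero_le_log_cancel_iff)
  qed
  have c0: "real (card P0) \<le> 2 powr (6 * ln (real d) / real d * (L + \<theta> * real d * log 2 (exp 1 / \<theta>)) * t)"
    using card_family_le[OF finite_marked card_marked_le[OF \<theta>] M1 t _ frac(1) L(1)] lnd d_pos
    by (simp add: P0_def)
  have c1: "real (card P1) \<le> 2 powr (4 / (\<theta> * \<psi>) * L * t)"
    using card_family_le[OF finite_X, of 1, OF _ _ t _ frac(2) L1] \<theta> \<psi> by (simp add: P1_def card_X)
  have c2: "real (card P2) \<le> 2 powr (2 / \<psi> * L * t)"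
    using card_family_le[OF finite_Y, of 1, OF _ _ t _ f2 L(2)] \<psi> by (simp add: P2_def card_Y)
  have "card (containers \<theta> \<psi> t) \<le> card (P0 \<times> P1 \<times> P2)"
    unfolding containers_def P0_def[symmetric] P1_def[symmetric] P2_def[symmetric]
    using fin by (intro card_image_le) auto
  also have "\<dots> = card P0 * (card P1 * card P2)" by (simp add: card_cartesian_product)
  finally have "real (card (containers \<theta> \<psi> t)) \<le> real (card P0) * (real (card P1) * real (card P2))"
    by (metis of_nat_le_iff of_nat_mult)
  also have "\<dots> \<le> 2 powr (6 * ln (real d) / real d * (L + \<theta> * real d * log 2 (exp 1 / \<theta>)) * t)
      * (2 powr (4 / (\<theta> * \<psi>) * L * t) * 2 powr (2 / \<psi> * L * t))"
    using c0 c1 c2 by (intro mult_mono) auto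
  also have "\<dots> = 2 powr ((6 * ln (real d) / real d * (L + \<theta> * real d * log 2 (exp 1 / \<theta>)) + 4 / (\<theta> * \<psi>) * L + 2 / \<psi> * L) * t)"
    unfolding powr_add[symmetric] by (simp only: distrib_right add.assoc)
  also have "\<dots> \<le> 2 powr (\<gamma> / 16 * t)"
    using cost t t0 by (intro powr_mono mult_right_mono) auto
  finally show ?thesis .
qed

text \<open>A set of size at most \<open>2 d\<^sup>2 t\<close> that contains the part of the neighbourhood missed by the inner
  container, for both kinds of containers in the family below.\<close>

definition R0 :: "real \<Rightarrow> 'a set \<Rightarrow> 'a set \<Rightarrow> 'a set" where
  "R0 t S F = (if real (card (Y - F)) \<le> 2 * real d ^ 2 * t then Y - F else Nb S - F)"

definition family :: "real \<Rightarrow> ('a set \<times> 'a set) set" where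
  "family t = containers \<theta> \<psi> t \<union> (\<lambda>(S, F). (X - F, Y - S)) ` bireg.containers Y X nb d \<theta> \<psi> t"

lemma card_family:
  assumes t: "t0 \<le> t" "t \<le> real N"
  shows "finite (family t)" "real (card (family t)) \<le> 2 * 2 powr (\<gamma> / 16 * t)"
proof -
  interpret sw: bireg_num Y X nb d N \<theta> \<psi> \<gamma> L t0 by (rule swap_num)
  let ?B = "(\<lambda>(S, F). (X - F, Y - S)) ` sw.containers \<theta> \<psi> t"
  show "finite (family t)" using finite_containers sw.finite_containers by (simp add: family_def)
  have "card (family t) \<le> card (containers \<theta> \<psi> t) + card ?B"
    unfolding family_def by (rule card_Un_le)
  also have "\<dots> \<le> card (containers \<theta> \<psi> t) + card (sw.containers \<theta> \<psi> t)"
    using sw.finite_containers by (intro add_left_mono card_image_le)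
  finally show "real (card (family t)) \<le> 2 * 2 powr (\<gamma> / 16 * t)"
    using card_containers_le[OF t] sw.card_containers_le[OF t] by linarith
qed

lemma containerI:
  assumes "T0 \<subseteq> marked \<theta>" "T1 \<subseteq> X" "T2 \<subseteq> Y"
    "real (card T0) \<le> 6 * t * ln (real d) / real d" "real (card T1) \<le> 4 * t / (\<theta> * \<psi>)"
    "real (card T2) \<le> 2 * t / \<psi>"
  shows "(conS \<psi> T0 T1 T2, conF \<psi> T0 T1 T2) \<in> containers \<theta> \<psi> t"
  unfolding containers_def using assms by (intro image_eqI[of _ _ "(T0, T1, T2)"]) (auto simp: algebra_simps)

text \<open>The isoperimetric dichotomy decides between the two kinds of containers: either
  \<open>cl A\<close> has at most d t elements and is approximated itself, or the complement of N(A)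
  has, and it is approximated in the swapped graph. Either bound provides the hypothesis |N(C)|
  \<le> (d + 1) t of \<open>container_exists\<close>.\<close>

lemma sandwich_family:
  assumes A: "A \<subseteq> X" and t: "t = real (defect A)" "t0 \<le> t"
  shows "\<exists>(S, F) \<in> family t. sandwich \<psi> (cl A) (Nb A) S F \<and>
    Nb A - F \<subseteq> R0 t S F \<and> real (card (R0 t S F)) \<le> 2 * real d ^ 2 * t"
proof -
  interpret sw: bireg_num Y X nb d N \<theta> \<psi> \<gamma> L t0 by (rule swap_num)
  define C where "C = cl A"
  define G where "G = Nb A"
  have C: "C \<subseteq> X" "Nb C = G" using cl_subset Nb_cl[OF A] by (auto simp: C_def G_def)
  have GY: "G \<subseteq> Y" using Nb_subset A by (simp add: G_def)
  have tC: "t = real (card (Nb C)) - real (card C)" using real_defect[OF A] t C by (simp add: C_def G_def)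
  have tpos: "t > 0" using t t0 by linarith
  have td: "t * ln (real d) \<ge> real d"
    by (rule order_trans[OF t0(2)], intro mult_right_mono) (use t d4 in auto)
  have D: "real d \<ge> 4" using d4 by simp
  \<comment> \<open>The bound d (d + 2) t arises for the neighbourhood of \<open>S\<close> in the
    first case, (d + 2) t for \<open>Y - F\<close> in the second; 2 d ^ 2 t dominates both.\<close>
  have D2: "real d * (real d + 2) * t \<le> 2 * real d ^ 2 * t"
    using D tpos by (intro mult_right_mono) (auto simp: power2_eq_square intro: mult_left_mono)
  have D3: "(real d + 2) * t \<le> 2 * real d ^ 2 * t"
  proof -
    have "(real d + 2) * 1 \<le> (real d + 2) * real d" using D by (intro mult_left_mono) auto
    then have "(real d + 2) * t \<le> real d * (real d + 2) * t" using tpos by (intro mult_right_mono) auto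
    then show ?thesis using D2 by linarith
  qed
  show ?thesis
  proof (cases "real (card C) \<le> real d * t")
    case True
    moreover have "(real d + 1) * t = real d * t + t" by (simp add: algebra_simps)
    ultimately have g: "real (card (Nb C)) \<le> (real d + 1) * t" using tC by linarith
    obtain T0 T1 T2 where T: "T0 \<subseteq> marked \<theta>" "T1 \<subseteq> X" "T2 \<subseteq> Y"
      "real (card T0) \<le> 6 * t * ln (real d) / real d" "real (card T1) \<le> 4 * t / (\<theta> * \<psi>)"
      "real (card T2) \<le> 2 * t / \<psi>" "sandwich \<psi> C (Nb C) (conS \<psi> T0 T1 T2) (conF \<psi> T0 T1 T2)"
      using container_exists[OF C(1) tC tpos g \<theta> \<psi> d4 td] by blast
    define S where "S = conS \<psi> T0 T1 T2"
    define F where "F = conF \<psi> T0 T1 T2"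
    have sw: "sandwich \<psi> C (Nb C) S F" using T by (simp add: S_def F_def)
    have fam: "(S, F) \<in> family t" using containerI[OF T(1-6)] by (simp add: family_def S_def F_def)
    have SX: "S \<subseteq> X" "C \<subseteq> S" using sw by (auto simp: sandwich_def)
    have finS: "finite S" using SX finite_sub by auto
    have "card (Nb S - F) \<le> card (Nb S)" using finite_Nb SX by (intro card_mono) auto
    also have "\<dots> \<le> (\<Sum>x\<in>S. card (nb x))" unfolding nbhd_def by (intro card_UN_le finS)
    also have "\<dots> = (\<Sum>x\<in>S. d)" using SX deg_X by (intro sum.cong) auto
    finally have "card (Nb S - F) \<le> d * card S" by (simp add: mult.commute)
    then have "real (card (Nb S - F)) \<le> real (d * card S)" by (simp only: of_nat_le_iff)
    also have "\<dots> = real d * real (card S)" by simp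
    also have "real (card S) = real (card C) + real (card (S - C))"
      using card_Diff_subset[of C S] SX finS finite_sub(1)[OF C(1)] card_mono[of S C] by (simp add: of_nat_diff)
    also have "real d * \<dots> \<le> real d * (real d * t + 2 * t)"
      using True sandwich_bounds(1)[OF C(1) tC \<psi> sw] by (intro mult_left_mono add_mono) auto
    finally have "real (card (Nb S - F)) \<le> 2 * real d ^ 2 * t" using D2 by (simp add: algebra_simps)
    then have "real (card (R0 t S F)) \<le> 2 * real d ^ 2 * t" by (simp add: R0_def)
    moreover have "Nb A - F \<subseteq> R0 t S F"
    proof -
      have "Nb C \<subseteq> Nb S" using SX(2) by (auto simp: nbhd_def)
      then have "Nb A \<subseteq> Nb S" using C by (simp add: G_def)
      then show ?thesis using GY unfolding R0_def G_def by auto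
    qed
    ultimately show ?thesis using sw C unfolding C_def G_def by (intro bexI[OF _ fam]) simp
  next
    case False
    then have co: "real N - real (card G) \<le> real d * t" using iso_X[OF C(1)] C tC by auto
    \<comment> \<open>Complementation exchanges the roles: N(Q) = X - C, and |N(Q)| - |Q| is again
      t. A sandwich (S', F') of \<open>Q\<close> becomes (X - F', Y - S') for \<open>C\<close>,
      since the two degree conditions are interchanged.\<close>
    define Q where "Q = Y - G"
    have QY: "Q \<subseteq> Y" by (auto simp: Q_def)
    have NQ: "Nb Q = X - C"
    proof
      show "Nb Q \<subseteq> X - C"
      proof
        fix x assume "x \<in> Nb Q"
        then obtain y where y: "y \<in> Y" "y \<notin> G" "x \<in> nb y" by (auto simp: nbhd_def Q_def)
        then have "x \<in> X" "y \<in> nb x" using nb_Y nb_sym by blast+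
        then show "x \<in> X - C" using y by (auto simp: C_def cl_def G_def)
      qed
      show "X - C \<subseteq> Nb Q"
      proof
        fix x assume "x \<in> X - C"
        then obtain y where y: "x \<in> X" "y \<in> nb x" "y \<notin> G" by (auto simp: C_def cl_def G_def)
        then have "y \<in> Q" "x \<in> nb y" using nb_X nb_sym by (auto simp: Q_def)
        then show "x \<in> Nb Q" by (auto simp: nbhd_def)
      qed
    qed
    have cQ: "real (card Q) = real N - real (card G)"
      using card_Diff_subset[of G Y] GY finite_sub(2)[OF GY] card_Y card_mono[OF finite_Y GY] by (simp add: Q_def of_nat_diff)
    have cNQ: "real (card (Nb Q)) = real N - real (card C)"
      using card_Diff_subset[of C X] C finite_sub(1)[OF C(1)] card_X card_mono[OF finite_X C(1)] by (simp add: NQ of_nat_diff)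
    have tQ: "t = real (card (Nb Q)) - real (card Q)" using cQ cNQ tC C by simp
    have "(real d + 1) * t = real d * t + t" by (simp add: algebra_simps)
    then have gQ: "real (card (Nb Q)) \<le> (real d + 1) * t" using tQ cQ co by linarith
    obtain T0 T1 T2 where T: "T0 \<subseteq> sw.marked \<theta>" "T1 \<subseteq> Y" "T2 \<subseteq> X"
      "real (card T0) \<le> 6 * t * ln (real d) / real d" "real (card T1) \<le> 4 * t / (\<theta> * \<psi>)"
      "real (card T2) \<le> 2 * t / \<psi>" "sw.sandwich \<psi> Q (Nb Q) (sw.conS \<psi> T0 T1 T2) (sw.conF \<psi> T0 T1 T2)"
      using sw.container_exists[OF QY tQ tpos gQ \<theta> \<psi> d4 td] by blast
    define S' where "S' = sw.conS \<psi> T0 T1 T2"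
    define F' where "F' = sw.conF \<psi> T0 T1 T2"
    have sand': "sw.sandwich \<psi> Q (Nb Q) S' F'" using T by (simp add: S'_def F'_def)
    define S where "S = X - F'"
    define F where "F = Y - S'"
    have fam: "(S, F) \<in> family t"
      using sw.containerI[OF T(1-6)] unfolding family_def S_def F_def S'_def F'_def by force
    have s: "Q \<subseteq> S'" "S' \<subseteq> Y" "F' \<subseteq> X - C" "\<And>y. y \<in> S' \<Longrightarrow> real (card (nb y - F')) \<le> \<psi>"
      "\<And>x. x \<in> X - F' \<Longrightarrow> real (card (nb x \<inter> S')) \<le> \<psi>"
      using sand' by (auto simp: sw.sandwich_def NQ)
    have sand: "sandwich \<psi> C G S F"
      unfolding sandwich_def
    proof (intro conjI ballI)
      fix x assume x: "x \<in> S"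
      then have "nb x - F = nb x \<inter> S'" using nb_X by (auto simp: S_def F_def)
      then show "real (card (nb x - F)) \<le> \<psi>" using s(5) x by (simp add: S_def)
    next
      fix y assume y: "y \<in> Y - F"
      then have "nb y \<inter> S = nb y - F'" using nb_Y by (auto simp: S_def F_def)
      then show "real (card (nb y \<inter> S)) \<le> \<psi>" using s(4) y by (simp add: F_def)
    qed (use s C in \<open>auto simp: S_def F_def Q_def\<close>)
    have "real (card (S' - Q)) \<le> 2 * t" by (rule sw.sandwich_bounds(1)[OF QY tQ \<psi> sand'])
    moreover have "real (card S') = real (card Q) + real (card (S' - Q))"
      using card_Diff_subset[of Q S'] s(1) finite_sub(2)[OF s(2)] finite_sub(2)[OF QY] card_mono[of S' Q] by (simp add: of_nat_diff)
    moreover have "(real d + 2) * t = real d * t + 2 * t" by (simp add: algebra_simps)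
    ultimately have "real (card S') \<le> (real d + 2) * t" using cQ co by linarith
    moreover have "Y - F = S'" using s by (auto simp: F_def)
    ultimately have yf: "real (card (Y - F)) \<le> 2 * real d ^ 2 * t" using D3 by simp
    then have "R0 t S F = Y - F" by (simp add: R0_def)
    then have "Nb A - F \<subseteq> R0 t S F" "real (card (R0 t S F)) \<le> 2 * real d ^ 2 * t"
      using GY yf by (auto simp: G_def)
    then show ?thesis using sand unfolding C_def G_def by (intro bexI[OF _ fam]) simp
  qed
qed

section \<open>The weight of the sets caught by the containers\<close>

definition captured :: "nat \<Rightarrow> 'a set \<Rightarrow> 'a set \<Rightarrow> nat \<Rightarrow> 'a set set" where
  "captured T S F g = {A. A \<subseteq> X \<and> defect A = T \<and> card (Nb A) = g \<and> sandwich \<psi> (cl A) (Nb A) S F \<and>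
    Nb A - F \<subseteq> R0 (real T) S F \<and> real (card (R0 (real T) S F)) \<le> 2 * real d ^ 2 * real T}"

lemma finite_captured: "finite (captured T S F g)"
  by (rule finite_subset[of _ "Pow X"]) (auto simp: captured_def finite_X)

text \<open>Sapozhenko's dichotomy. If N(A) exceeds \<open>F\<close> by more than \<gamma> t, then
  |S| is smaller than g by (3/4) \<gamma> t, and all subsets of \<open>S\<close> can be afforded.
  Otherwise N(A) - F is one of at most 2 ^ (t / 4) small subsets of \<open>R0\<close>; it determines
  N(A) and with it the closure C, whose subsets together weigh \<tau> 2 ^ (|C| - g) = \<tau> 2 ^ (-
  t).\<close>

lemma captured_sum_le:
  fixes W :: "'a set \<Rightarrow> real"
  assumes W: "\<And>A. W A \<ge> 0" and \<tau>: "\<tau> \<ge> 0"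
    and WS: "\<And>S. S \<subseteq> X \<Longrightarrow> (\<Sum>A\<in>Pow S. W A) \<le> \<tau> * 2 powr real (card S)"
    and T: "t0 \<le> real T"
  shows "(\<Sum>A\<in>captured T S F g. W A * 2 powr (- real g)) \<le> 2 * \<tau> * 2 powr (- (3/4 * \<gamma> * real T))"
proof -
  define t where "t = real T"
  have tpos: "t > 0" using T t0 by (simp add: t_def)
  define K1 where "K1 = {A \<in> captured T S F g. real (card (Nb A - F)) > \<gamma> * t}"
  define K2 where "K2 = {A \<in> captured T S F g. real (card (Nb A - F)) \<le> \<gamma> * t}"
  have "captured T S F g = K1 \<union> K2" "K1 \<inter> K2 = {}" by (auto simp: K1_def K2_def)
  moreover have fin: "finite K1" "finite K2" using finite_captured by (auto simp: K1_def K2_def)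
  ultimately have split: "(\<Sum>A\<in>captured T S F g. W A * 2 powr (- real g))
    = (\<Sum>A\<in>K1. W A * 2 powr (- real g)) + (\<Sum>A\<in>K2. W A * 2 powr (- real g))"
    by (simp add: sum.union_disjoint)
  have k1: "(\<Sum>A\<in>K1. W A * 2 powr (- real g)) \<le> \<tau> * 2 powr (- (3/4 * \<gamma> * t))"
  proof (cases "K1 = {}")
    case False
    then obtain A where A: "A \<in> K1" by auto
    then have Ac: "A \<subseteq> X" "t = real (defect A)" "card (Nb A) = g" "sandwich \<psi> (cl A) (Nb A) S F"
      "real (card (Nb A - F)) > \<gamma> * t" by (auto simp: K1_def captured_def t_def)
    have "t = real (card (Nb (cl A))) - real (card (cl A))" using real_defect Ac Nb_cl by simp
    then have SF: "real (card S) \<le> real (card F) + 4 * \<psi> * t / real d"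
      using sandwich_bounds(2)[OF cl_subset, of t A \<psi> S F] Ac \<psi> Nb_cl by simp
    have FG: "F \<subseteq> Nb A" and SX: "S \<subseteq> X" using Ac by (auto simp: sandwich_def)
    have "finite (Nb A)" using finite_Nb Ac by auto
    then have "real (card (Nb A - F)) = real g - real (card F)"
      using card_Diff_subset[of F "Nb A"] FG finite_subset[OF FG] card_mono[of "Nb A" F] Ac by (simp add: of_nat_diff)
    then have "real (card S) - real g \<le> - (\<gamma> * t) + 4 * \<psi> / real d * t" using SF Ac by simp
    also have "4 * \<psi> / real d * t \<le> \<gamma> / 4 * t" using slope tpos by (intro mult_right_mono) auto
    finally have e: "real (card S) - real g \<le> - (3/4 * \<gamma> * t)" by simp
    have "(\<Sum>A\<in>K1. W A * 2 powr (- real g)) = (\<Sum>A\<in>K1. W A) * 2 powr (- real g)"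
      by (simp add: sum_distrib_right)
    also have "(\<Sum>A\<in>K1. W A) \<le> (\<Sum>A\<in>Pow S. W A)"
    proof (rule sum_mono2)
      show "finite (Pow S)" using SX finite_sub by simp
      show "K1 \<subseteq> Pow S" 
      proof
        fix B assume "B \<in> K1"
        then have "B \<subseteq> X" "cl B \<subseteq> S" by (auto simp: K1_def captured_def sandwich_def)
        then show "B \<in> Pow S" using subset_cl by auto
      qed
    qed (use W in auto)
    also have "\<dots> \<le> \<tau> * 2 powr real (card S)" by (rule WS[OF SX])
    finally have "(\<Sum>A\<in>K1. W A * 2 powr (- real g)) \<le> \<tau> * 2 powr (real (card S) - real g)"
      by (simp add: powr_shift[symmetric])
    also have "\<dots> \<le> \<tau> * 2 powr (- (3/4 * \<gamma> * t))" using e \<tau> by (intro mult_left_mono) auto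
    finally show ?thesis .
  qed (use \<tau> in auto)
  have k2: "(\<Sum>A\<in>K2. W A * 2 powr (- real g)) \<le> \<tau> * 2 powr (- (3/4 * t))"
  proof (cases "K2 = {}")
    case False
    then obtain A0 where A0: "A0 \<in> K2" by auto
    define U where "U = R0 t S F"
    have Uc: "real (card U) \<le> 2 * real d ^ 2 * t" and UY: "U \<subseteq> Y"
      using A0 Nb_subset by (auto simp: K2_def captured_def U_def t_def R0_def sandwich_def)
    define \<R> where "\<R> = {R. R \<subseteq> U \<and> real (card R) \<le> \<gamma> * t}"
    have finU: "finite U" using UY finite_sub by auto
    have finR: "finite \<R>" using finU by (auto simp: \<R>_def)
    define BR where "BR = (\<lambda>R. {A \<in> K2. Nb A = F \<union> R})"
    have cover: "K2 \<subseteq> (\<Union>R\<in>\<R>. BR R)"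
    proof
      fix A assume A: "A \<in> K2"
      then have "Nb A - F \<in> \<R>" "Nb A = F \<union> (Nb A - F)"
        by (auto simp: K2_def captured_def \<R>_def U_def t_def sandwich_def)
      then show "A \<in> (\<Union>R\<in>\<R>. BR R)" using A by (auto simp: BR_def)
    qed
    have one: "(\<Sum>A\<in>BR R. W A * 2 powr (- real g)) \<le> \<tau> * 2 powr (- t)" for R
    proof (cases "BR R = {}")
      case False
      then obtain A where A: "A \<in> BR R" by auto
      define CR where "CR = {x \<in> X. nb x \<subseteq> F \<union> R}"
      have CRA: "CR = cl B" if "B \<in> BR R" for B using that by (auto simp: CR_def cl_def BR_def)
      have "t = real g - real (card CR)"
        using A CRA[OF A] real_defect[of A] by (auto simp: BR_def K2_def captured_def t_def)
      then have e: "real (card CR) - real g = - t" by simp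
      have "(\<Sum>A\<in>BR R. W A * 2 powr (- real g)) = (\<Sum>A\<in>BR R. W A) * 2 powr (- real g)"
        by (simp add: sum_distrib_right)
      also have "(\<Sum>A\<in>BR R. W A) \<le> (\<Sum>A\<in>Pow CR. W A)"
      proof (rule sum_mono2)
        show "finite (Pow CR)" using finite_X by (simp add: CR_def)
        show "BR R \<subseteq> Pow CR"
        proof
          fix B assume B: "B \<in> BR R"
          then have "B \<subseteq> X" by (auto simp: BR_def K2_def captured_def)
          then show "B \<in> Pow CR" using subset_cl CRA[OF B] by auto
        qed
      qed (use W in auto)
      also have "\<dots> \<le> \<tau> * 2 powr real (card CR)" by (rule WS) (auto simp: CR_def)
      finally have "(\<Sum>A\<in>BR R. W A * 2 powr (- real g)) \<le> \<tau> * 2 powr (real (card CR) - real g)"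
        by (simp add: powr_shift[symmetric])
      then show ?thesis using e by simp
    qed (use \<tau> in simp)
    have "(\<Sum>A\<in>K2. W A * 2 powr (- real g)) \<le> (\<Sum>R\<in>\<R>. \<Sum>A\<in>BR R. W A * 2 powr (- real g))"
      using finR fin cover W by (intro sum_cover_le) (auto simp: BR_def)
    also have "\<dots> \<le> real (card \<R>) * (\<tau> * 2 powr (- t))" by (intro sum_bounded_above one)
    also have "real (card \<R>) \<le> 2 powr (t / 4)"
    proof -
      have "\<gamma> * t \<le> 2 * real d ^ 2 * t"
      proof (intro mult_right_mono)
        have "1 \<le> real d ^ 2" using d4 by simp
        then show "\<gamma> \<le> 2 * real d ^ 2" using \<gamma> by linarith
      qed (use tpos in auto)
      then have "real (card \<R>) \<le> (exp 1 * (2 * real d ^ 2 * t) / (\<gamma> * t)) powr (\<gamma> * t)"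
        unfolding \<R>_def using finU Uc \<gamma> tpos by (intro card_subsets_le) auto
      also have "exp 1 * (2 * real d ^ 2 * t) / (\<gamma> * t) = 2 powr log 2 (2 * exp 1 * real d ^ 2 / \<gamma>)"
        using tpos \<gamma> d4 by (simp add: mult.commute)
      also have "\<dots> powr (\<gamma> * t) = 2 powr (\<gamma> * log 2 (2 * exp 1 * real d ^ 2 / \<gamma>) * t)"
        by (simp only: powr_powr) (simp add: algebra_simps)
      also have "\<dots> \<le> 2 powr (1 / 4 * t)" using caseR tpos by (intro powr_mono mult_right_mono) auto
      finally show ?thesis by simp
    qed
    also have "2 powr (t / 4) * (\<tau> * 2 powr (- t)) = \<tau> * 2 powr (- (3/4 * t))"
      by (simp add: powr_add[symmetric] algebra_simps)
    finally show ?thesis using \<tau> by (simp add: mult_right_mono)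
  qed (use \<tau> in auto)
  have "3/4 * \<gamma> * t \<le> 3/4 * t" using \<gamma> tpos mult_right_mono[of \<gamma> 1 t] by simp
  then have "\<tau> * 2 powr (- (3/4 * t)) \<le> \<tau> * 2 powr (- (3/4 * \<gamma> * t))" using \<tau> by (intro mult_left_mono) auto
  then show ?thesis using split k1 k2 unfolding t_def by linarith
qed

text \<open>The weight \<open>W\<close> stays abstract because the recursion supplies it:
  \<open>W A\<close> will be the number of one-sided homomorphisms with level set A, and
  \<open>WS\<close> the bound already proved for them. Of the saving 3/4 in the exponent, 1/16 pays
  for the containers and 1/16 for the polynomial factors, which leaves more than 1/2.\<close>

theorem container_sum:
  fixes W :: "'a set \<Rightarrow> real"
  assumes W: "\<And>A. W A \<ge> 0" and \<tau>: "\<tau> \<ge> 0"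
    and WS: "\<And>S. S \<subseteq> X \<Longrightarrow> (\<Sum>A\<in>Pow S. W A) \<le> \<tau> * 2 powr real (card S)"
    and t': "t0 \<le> t'"
  shows "(\<Sum>A | A \<subseteq> X \<and> t' \<le> real (defect A). W A * 2 powr (- real (card (Nb A)))) \<le> \<tau> * 2 powr (- (\<gamma> * t' / 2))"
proof -
  define f where "f = (\<lambda>A. W A * 2 powr (- real (card (Nb A))))"
  define I where "I = {T. T \<le> N \<and> t' \<le> real T}"
  have finI: "finite I" "card I \<le> N + 1"
    using card_mono[of "{..N}" I] by (auto simp: I_def)
  have f0: "f A \<ge> 0" for A using W by (simp add: f_def)
  have defN: "defect A \<le> N" if "A \<subseteq> X" for A using card_Nb_le_N[OF that] by (simp add: defect_def)
  have fin: "finite {A. A \<subseteq> X \<and> P A}" for P using finite_X by auto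
  have tpos: "t' > 0" using t' t0 by linarith
  have single: "(\<Sum>A | A \<subseteq> X \<and> defect A = T. f A) \<le> 4 * (real N + 1) * \<tau> * 2 powr (- (11/16 * \<gamma> * t'))"
    if T: "T \<in> I" for T
  proof -
    have t: "t0 \<le> real T" "real T \<le> real N" "t' \<le> real T" using T t' by (auto simp: I_def)
    have famf: "finite (family (real T))" and famc: "real (card (family (real T))) \<le> 2 * 2 powr (\<gamma> / 16 * real T)"
      using card_family[OF t(1,2)] by auto
    have "(\<Sum>A | A \<subseteq> X \<and> defect A = T. f A) \<le> (\<Sum>((S, F), g)\<in>family (real T) \<times> {..N}. \<Sum>A\<in>captured T S F g. f A)"
    proof -
      have "{A. A \<subseteq> X \<and> defect A = T} \<subseteq> (\<Union>i\<in>family (real T) \<times> {..N}. captured T (fst (fst i)) (snd (fst i)) (snd i))"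
      proof
        fix A assume "A \<in> {A. A \<subseteq> X \<and> defect A = T}"
        then have A: "A \<subseteq> X" "real T = real (defect A)" "defect A = T" by auto
        obtain S F where SF: "(S, F) \<in> family (real T)" "sandwich \<psi> (cl A) (Nb A) S F"
          "Nb A - F \<subseteq> R0 (real T) S F" "real (card (R0 (real T) S F)) \<le> 2 * real d ^ 2 * real T"
          using sandwich_family[OF A(1,2) t(1)] by blast
        have "A \<in> captured T S F (card (Nb A))" using A SF by (simp add: captured_def)
        then show "A \<in> (\<Union>i\<in>family (real T) \<times> {..N}. captured T (fst (fst i)) (snd (fst i)) (snd i))"
          using SF(1) card_Nb_le_N[OF A(1)] by (intro UN_I[of "((S, F), card (Nb A))"]) auto
      qed
      then have "(\<Sum>A | A \<subseteq> X \<and> defect A = T. f A) \<le>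
        (\<Sum>i\<in>family (real T) \<times> {..N}. \<Sum>A\<in>captured T (fst (fst i)) (snd (fst i)) (snd i). f A)"
        using famf finite_captured f0 by (intro sum_cover_le) auto
      then show ?thesis by (simp add: case_prod_beta)
    qed
    also have "\<dots> \<le> (\<Sum>((S, F), g)\<in>family (real T) \<times> {..N}. 2 * \<tau> * 2 powr (- (3/4 * \<gamma> * real T)))"
    proof (rule sum_mono, clarify)
      fix S F g
      have "(\<Sum>A\<in>captured T S F g. f A) = (\<Sum>A\<in>captured T S F g. W A * 2 powr (- real g))"
        by (intro sum.cong) (auto simp: captured_def f_def)
      then show "(\<Sum>A\<in>captured T S F g. f A) \<le> 2 * \<tau> * 2 powr (- (3/4 * \<gamma> * real T))"
        using captured_sum_le[OF W \<tau> WS t(1), where S = S and F = F and g = g] by simp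
    qed
    also have "\<dots> = real (card (family (real T))) * (real N + 1) * (2 * \<tau> * 2 powr (- (3/4 * \<gamma> * real T)))"
      by (simp add: case_prod_beta card_cartesian_product algebra_simps)
    also have "\<dots> \<le> (2 * 2 powr (\<gamma> / 16 * real T)) * (real N + 1) * (2 * \<tau> * 2 powr (- (3/4 * \<gamma> * real T)))"
      using famc \<tau> by (intro mult_right_mono) auto
    also have "\<dots> = 4 * (real N + 1) * \<tau> * (2 powr (\<gamma> / 16 * real T) * 2 powr (- (3/4 * \<gamma> * real T)))"
      by simp
    also have "2 powr (\<gamma> / 16 * real T) * 2 powr (- (3/4 * \<gamma> * real T)) = 2 powr (- (11/16 * \<gamma> * real T))"
      by (simp add: powr_add[symmetric] algebra_simps)
    also have "\<dots> \<le> 2 powr (- (11/16 * \<gamma> * t'))" using t \<gamma> by (intro powr_mono) auto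
    finally show ?thesis using \<tau> by (simp add: mult_left_mono)
  qed
  have "(\<Sum>A | A \<subseteq> X \<and> t' \<le> real (defect A). f A) \<le> (\<Sum>T\<in>I. \<Sum>A | A \<subseteq> X \<and> defect A = T. f A)"
    using finI fin f0 defN by (intro sum_cover_le) (auto simp: I_def)
  also have "\<dots> \<le> real (card I) * (4 * (real N + 1) * \<tau> * 2 powr (- (11/16 * \<gamma> * t')))"
    by (intro sum_bounded_above single)
  also have "\<dots> \<le> (real N + 1) * (4 * (real N + 1) * \<tau> * 2 powr (- (11/16 * \<gamma> * t')))"
    using finI \<tau> by (intro mult_right_mono) auto
  also have "\<dots> = 4 * (real N + 1) ^ 2 * (\<tau> * 2 powr (- (11/16 * \<gamma> * t')))"
    by (simp add: power2_eq_square)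
  also have "\<dots> \<le> 2 powr (\<gamma> * t0 / 16) * (\<tau> * 2 powr (- (11/16 * \<gamma> * t')))"
    using poly \<tau> by (intro mult_right_mono) auto
  also have "\<dots> = \<tau> * 2 powr (\<gamma> * t0 / 16 - 11/16 * \<gamma> * t')"
    unfolding powr_shift[symmetric] by simp
  also have "\<dots> \<le> \<tau> * 2 powr (- (\<gamma> * t' / 2))"
  proof -
    have "\<gamma> * t0 \<le> \<gamma> * t'" "\<gamma> * t' > 0" using \<gamma> t' tpos by auto
    then have "\<gamma> * t0 / 16 - 11/16 * \<gamma> * t' \<le> - (\<gamma> * t' / 2)" by simp
    then show ?thesis using \<tau> by (intro mult_left_mono powr_mono) auto
  qed
  finally show ?thesis by (simp add: f_def)
qed

end

section \<open>One-sided homomorphisms and level sets\<close>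

definition all_homs :: "'a set \<Rightarrow> 'a set \<Rightarrow> ('a \<Rightarrow> 'a set) \<Rightarrow> ('a \<Rightarrow> int) set" where
  "all_homs X Y nb = {h \<in> extensional (X \<union> Y). \<forall>x\<in>X. \<forall>y\<in>nb x. \<bar>h x - h y\<bar> = 1}"

definition even_homs :: "'a set \<Rightarrow> 'a set \<Rightarrow> ('a \<Rightarrow> 'a set) \<Rightarrow> ('a \<Rightarrow> int) set" where
  "even_homs X Y nb = {h \<in> all_homs X Y nb. (\<forall>x\<in>X. even (h x)) \<and> (\<forall>y\<in>Y. odd (h y))}"

text \<open>The ground state is 0 on \<open>X\<close> and 1 on \<open>Y\<close>; excursions go
  upwards only, and the cap \<open>j\<close> on the values is the recursion variable.\<close>

definition upper :: "'a set \<Rightarrow> 'a set \<Rightarrow> ('a \<Rightarrow> 'a set) \<Rightarrow> nat \<Rightarrow> ('a \<Rightarrow> int) set" where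
  "upper X Y nb j = {f \<in> even_homs X Y nb. (\<forall>x\<in>X. 0 \<le> f x \<and> f x \<le> int j) \<and> (\<forall>y\<in>Y. 1 \<le> f y \<and> f y \<le> int j)}"

definition high :: "'a set \<Rightarrow> ('a \<Rightarrow> int) \<Rightarrow> 'a set" where
  "high X f = {x \<in> X. 2 \<le> f x}"

lemma high_subset: "high X f \<subseteq> X" by (auto simp: high_def)

lemma card_between:
  assumes "finite S" "K \<subseteq> S"
  shows "card {B. K \<subseteq> B \<and> B \<subseteq> S} \<le> 2 ^ (card S - card K)"
proof -
  have "inj_on (\<lambda>B. B - K) {B. K \<subseteq> B \<and> B \<subseteq> S}" by (intro inj_onI) blast
  moreover have "(\<lambda>B. B - K) ` {B. K \<subseteq> B \<and> B \<subseteq> S} \<subseteq> Pow (S - K)" by auto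
  ultimately have "card {B. K \<subseteq> B \<and> B \<subseteq> S} \<le> card (Pow (S - K))"
    using assms by (intro card_inj_on_le) auto
  also have "\<dots> = 2 ^ (card S - card K)"
    using assms by (simp add: card_Pow card_Diff_subset finite_subset)
  finally show ?thesis .
qed

lemma finite_bounded_extensional:
  assumes "finite V"
  shows "finite {h \<in> extensional V. \<forall>v\<in>V. \<bar>h v :: int\<bar> \<le> b}"
proof (rule finite_subset)
  show "{h \<in> extensional V. \<forall>v\<in>V. \<bar>h v\<bar> \<le> b} \<subseteq> V \<rightarrow>\<^sub>E {-b..b}" by (auto simp: PiE_iff abs_le_iff extensional_def)
  show "finite (V \<rightarrow>\<^sub>E {-b..b})" using assms by (simp add: finite_PiE)
qed

lemma all_homs_adj: "h \<in> all_homs X Y nb \<Longrightarrow> x \<in> X \<Longrightarrow> y \<in> nb x \<Longrightarrow> \<bar>h x - h y\<bar> = 1"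
  by (simp add: all_homs_def)

context bireg begin

lemma all_homs_swap: "all_homs Y X nb = all_homs X Y nb"
proof -
  have "(\<forall>y\<in>Y. \<forall>x\<in>nb y. \<bar>h y - h x\<bar> = 1) \<longleftrightarrow> (\<forall>x\<in>X. \<forall>y\<in>nb x. \<bar>h x - h y\<bar> = 1)" for h :: "'a \<Rightarrow> int"
    by (metis abs_minus_commute nb_X nb_Y nb_sym subsetD)
  then show ?thesis unfolding all_homs_def by (simp add: Un_commute)
qed

text \<open>Parity makes these homomorphisms a lattice: if f x \<noteq> g x the two values differ by
  at least 2, so the order of f and g cannot be reversed at a neighbour of x.\<close>

lemma join_meet:
  assumes f: "f \<in> even_homs X Y nb" and g: "g \<in> even_homs X Y nb"
  shows "(\<lambda>v. max (f v) (g v)) \<in> even_homs X Y nb" "(\<lambda>v. min (f v) (g v)) \<in> even_homs X Y nb"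
proof -
  have "\<bar>max (f x) (g x) - max (f y) (g y)\<bar> = 1 \<and> \<bar>min (f x) (g x) - min (f y) (g y)\<bar> = 1"
    if x: "x \<in> X" and y: "y \<in> nb x" for x y
  proof -
    have adj: "\<bar>f x - f y\<bar> = 1" "\<bar>g x - g y\<bar> = 1"
      using f g x y by (auto simp: even_homs_def intro: all_homs_adj)
    have "even (f x)" "even (g x)" using f g x by (auto simp: even_homs_def)
    then have "f x = g x \<or> f x \<ge> g x + 2 \<or> g x \<ge> f x + 2" by presburger
    then show ?thesis using adj by (auto simp: max_def min_def abs_if split: if_splits)
  qed
  then show "(\<lambda>v. max (f v) (g v)) \<in> even_homs X Y nb" "(\<lambda>v. min (f v) (g v)) \<in> even_homs X Y nb"
    using f g by (auto simp: even_homs_def all_homs_def extensional_def max_def min_def)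
qed

lemma finite_upper: "finite (upper X Y nb j)"
  by (rule finite_subset[OF _ finite_bounded_extensional[of "X \<union> Y" "int j"]])
    (use finite_X finite_Y in \<open>auto simp: upper_def even_homs_def all_homs_def\<close>)

text \<open>Peeling off one level exchanges the sides. A homomorphism is determined by its peeled
  version and by B = \<open>high X f\<close>; the peeled one forces B to contain the neighbourhood
  of its own level set, and the remaining elements of \<open>S\<close> are free.\<close>

lemma upper_step:
  assumes j: "j \<ge> 1" and S: "S \<subseteq> X"
  shows "card {f \<in> upper X Y nb (Suc j). high X f \<subseteq> S}
    \<le> (\<Sum>f\<in>{f \<in> upper Y X nb j. Nb (high Y f) \<subseteq> S}. 2 ^ (card S - card (Nb (high Y f))))"
proof -
  interpret sw: bireg Y X nb d N by (rule swap)
  \<comment> \<open>Raising the zeros on \<open>X\<close> to 2 and subtracting 1 gives the ground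
    state 1 on \<open>X\<close> and 0 on \<open>Y\<close>. Only the distinction between 0 and 2 on
    \<open>X\<close> is lost, and \<open>high X f\<close> records it.\<close>
  define down where "down = (\<lambda>f::'a \<Rightarrow> int. \<lambda>v\<in>X \<union> Y. (if v \<in> X then max (f v) 2 else f v) - 1)"
  define P where "P = {f \<in> upper X Y nb (Suc j). high X f \<subseteq> S}"
  define Q where "Q = {f \<in> upper Y X nb j. Nb (high Y f) \<subseteq> S}"
  have finS: "finite S" using S finite_sub by auto
  have finQ: "finite Q" using sw.finite_upper by (simp add: Q_def)
  have YX: "y \<notin> X" if "y \<in> Y" for y using that disj by auto
  have maps: "(down f, high X f) \<in> (SIGMA f:Q. {B. Nb (high Y f) \<subseteq> B \<and> B \<subseteq> S})" if "f \<in> P" for f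
  proof -
    have f: "f \<in> all_homs X Y nb" "\<And>x. x \<in> X \<Longrightarrow> even (f x) \<and> 0 \<le> f x \<and> f x \<le> int (Suc j)"
      "\<And>y. y \<in> Y \<Longrightarrow> odd (f y) \<and> 1 \<le> f y \<and> f y \<le> int (Suc j)" "high X f \<subseteq> S"
      using that by (auto simp: P_def upper_def even_homs_def)
    have "\<bar>down f x - down f y\<bar> = 1" if "x \<in> X" "y \<in> nb x" for x y
    proof -
      have "y \<in> Y" using that nb_X by auto
      moreover have "\<bar>f x - f y\<bar> = 1" using f(1) that by (rule all_homs_adj)
      moreover have "f x = 0 \<or> f x \<ge> 2" using f(2)[OF that(1)] by presburger
      ultimately show ?thesis using that YX f(3)[of y] by (auto simp: down_def)
    qed
    then have "down f \<in> all_homs Y X nb" unfolding all_homs_swap by (auto simp: all_homs_def down_def)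
    moreover have "even (down f y)" "0 \<le> down f y" "down f y \<le> int j" if "y \<in> Y" for y
      using f(3)[OF that] that YX by (auto simp: down_def)
    moreover have "odd (down f x)" "1 \<le> down f x" "down f x \<le> int j" if "x \<in> X" for x
      using f(2)[OF that] that j by (auto simp: down_def max_def)
    ultimately have 1: "down f \<in> upper Y X nb j" by (auto simp: upper_def even_homs_def)
    have hi: "high Y (down f) = {y \<in> Y. 3 \<le> f y}" using YX by (auto simp: high_def down_def)
    have "Nb (high Y (down f)) \<subseteq> high X f"
    proof
      fix x assume "x \<in> Nb (high Y (down f))"
      then obtain y where y: "y \<in> Y" "3 \<le> f y" "x \<in> nb y" by (auto simp: nbhd_def hi)
      then have "x \<in> X" "y \<in> nb x" using nb_Y nb_sym by auto
      then show "x \<in> high X f" using y all_homs_adj[OF f(1), of x y] by (auto simp: high_def)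
    qed
    then show ?thesis using 1 f(4) by (auto simp: Q_def)
  qed
  have inj: "inj_on (\<lambda>f. (down f, high X f)) P"
  proof (rule inj_onI)
    fix f g assume fg: "f \<in> P" "g \<in> P" and "(down f, high X f) = (down g, high X g)"
    then have eq: "down f = down g" "high X f = high X g" by auto
    have mem: "f \<in> extensional (X \<union> Y)" "g \<in> extensional (X \<union> Y)"
      "\<And>x. x \<in> X \<Longrightarrow> even (f x) \<and> 0 \<le> f x" "\<And>x. x \<in> X \<Longrightarrow> even (g x) \<and> 0 \<le> g x"
      using fg by (auto simp: P_def upper_def even_homs_def all_homs_def)
    show "f = g"
    proof (rule extensionalityI[OF mem(1,2)])
      fix v assume v: "v \<in> X \<union> Y"
      have e: "down f v = down g v" using eq by simp
      show "f v = g v"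
      proof (cases "v \<in> X")
        case True
        have "2 \<le> f v \<longleftrightarrow> 2 \<le> g v" using eq(2) True by (auto simp: high_def)
        moreover have "max (f v) 2 = max (g v) 2" using e True by (simp add: down_def)
        moreover have "f v = 0 \<or> 2 \<le> f v" "g v = 0 \<or> 2 \<le> g v" using mem(3,4)[OF True] by presburger+
        ultimately show ?thesis by (auto simp: max_def split: if_splits)
      next
        case False
        then show ?thesis using e v by (simp add: down_def)
      qed
    qed
  qed
  have "card P \<le> card (SIGMA f:Q. {B. Nb (high Y f) \<subseteq> B \<and> B \<subseteq> S})"
    using maps finQ finS by (intro card_inj_on_le[OF inj]) auto
  also have "\<dots> = (\<Sum>f\<in>Q. card {B. Nb (high Y f) \<subseteq> B \<and> B \<subseteq> S})"
    using finQ finS by (intro card_SigmaI) auto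
  also have "\<dots> \<le> (\<Sum>f\<in>Q. 2 ^ (card S - card (Nb (high Y f))))"
    using finS by (intro sum_mono card_between) (auto simp: Q_def)
  finally show ?thesis by (simp add: P_def Q_def)
qed

lemma sum_upper_high:
  fixes c :: "'a set \<Rightarrow> real"
  shows "(\<Sum>f | f \<in> upper X Y nb j \<and> P (high X f). c (high X f))
    = (\<Sum>A | A \<subseteq> X \<and> P A. real (card {f \<in> upper X Y nb j. high X f = A}) * c A)"
proof -
  let ?F = "{f \<in> upper X Y nb j. P (high X f)}"
  have "(\<Sum>f\<in>?F. c (high X f)) = (\<Sum>A | A \<subseteq> X \<and> P A. \<Sum>f | f \<in> ?F \<and> high X f = A. c (high X f))"
    using finite_upper finite_X by (intro sum.group[symmetric]) (auto simp: high_def)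
  also have "\<dots> = (\<Sum>A | A \<subseteq> X \<and> P A. real (card {f \<in> upper X Y nb j. high X f = A}) * c A)"
  proof (rule sum.cong[OF refl])
    fix A assume "A \<in> {A. A \<subseteq> X \<and> P A}"
    then have "{f. f \<in> ?F \<and> high X f = A} = {f \<in> upper X Y nb j. high X f = A}" by auto
    then show "(\<Sum>f | f \<in> ?F \<and> high X f = A. c (high X f)) = real (card {f \<in> upper X Y nb j. high X f = A}) * c A"
      by simp
  qed
  finally show ?thesis .
qed

lemma card_upper_high:
  assumes "S \<subseteq> X"
  shows "(\<Sum>A\<in>Pow S. real (card {f \<in> upper X Y nb j. high X f = A})) = real (card {f \<in> upper X Y nb j. high X f \<subseteq> S})"
proof -
  have "{A. A \<subseteq> X \<and> A \<subseteq> S} = Pow S" using assms by auto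
  then show ?thesis using sum_upper_high[where j = j and P = "\<lambda>A. A \<subseteq> S" and c = "\<lambda>_. 1"] by simp
qed

end

section \<open>The recursion over levels\<close>

context bireg_num begin

text \<open>The price of one level: the first summand bounds the number of closed sets of defect
  below \<open>t0\<close>, the 1 pays for the container sum over all larger defects.\<close>

definition Mfac :: real where
  "Mfac = 2 * 2 powr (L * (real d * t0)) + 1"

lemma Mfac_ge: "Mfac \<ge> 1" by (simp add: Mfac_def)

text \<open>By the isoperimetric dichotomy such a set, or the complement of its neighbourhood, has
  at most d t0 elements; a closed set is determined by either.\<close>

lemma card_small_closed:
  assumes "real d * t0 \<le> real N"
  shows "finite {C. C \<subseteq> X \<and> cl C = C \<and> real (defect C) < t0}"
    "real (card {C. C \<subseteq> X \<and> cl C = C \<and> real (defect C) < t0}) \<le> 2 * 2 powr (L * (real d * t0))"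
proof -
  define k where "k = real d * t0"
  have kpos: "k > 0" using d_pos t0 by (simp add: k_def)
  have "exp 1 * real N \<le> 2 powr L * (6 * ln (real d) / real d * t0)" by (rule L(1))
  also have "\<dots> \<le> 2 powr L * k"
  proof -
    have "6 * ln (real d) / real d \<le> real d" using frac(1) d4 by linarith
    then show ?thesis unfolding k_def using t0 by (intro mult_left_mono mult_right_mono) auto
  qed
  finally have eN: "exp 1 * real N / k \<le> 2 powr L" using kpos by (simp add: pos_divide_le_eq)
  have cnt: "real (card {T. T \<subseteq> U \<and> real (card T) \<le> k}) \<le> 2 powr (L * k)"
    if "finite U" "card U = N" for U :: "'a set"
  proof -
    have "real (card {T. T \<subseteq> U \<and> real (card T) \<le> k}) \<le> (exp 1 * real N / k) powr k"
      using that assms kpos by (intro card_subsets_le) (auto simp: k_def)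
    also have "\<dots> \<le> (2 powr L) powr k" using eN kpos by (intro powr_mono2) auto
    finally show ?thesis by (simp add: powr_powr)
  qed
  define CC where "CC = {C. C \<subseteq> X \<and> cl C = C \<and> real (defect C) < t0}"
  define C1 where "C1 = {T. T \<subseteq> X \<and> real (card T) \<le> k}"
  define C2 where "C2 = {T. T \<subseteq> Y \<and> real (card T) \<le> k}"
  have fin: "finite C1" "finite C2" using finite_X finite_Y by (auto simp: C1_def C2_def)
  have sub: "CC \<subseteq> C1 \<union> (\<lambda>Q. {x \<in> X. nb x \<subseteq> Y - Q}) ` C2"
  proof
    fix C assume "C \<in> CC"
    then have C: "C \<subseteq> X" "cl C = C" "real (defect C) < t0" by (auto simp: CC_def)
    have "real d * (real (card (Nb C)) - real (card C)) \<le> k"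
      using real_defect[OF C(1)] C d_pos by (simp add: k_def)
    then have "real (card C) \<le> k \<or> real N - real (card (Nb C)) \<le> k" using iso_X[OF C(1)] by linarith
    then show "C \<in> C1 \<union> (\<lambda>Q. {x \<in> X. nb x \<subseteq> Y - Q}) ` C2"
    proof
      assume "real N - real (card (Nb C)) \<le> k"
      moreover have "Nb C \<subseteq> Y" by (rule Nb_subset[OF C(1)])
      then have "card (Y - Nb C) = N - card (Nb C)" "card (Nb C) \<le> N"
        using card_Diff_subset[of "Nb C" Y] finite_sub(2) card_Y card_Nb_le_N[OF C(1)] by auto
      ultimately have "Y - Nb C \<in> C2" by (simp add: C2_def of_nat_diff)
      moreover have "C = {x \<in> X. nb x \<subseteq> Y - (Y - Nb C)}"
        using C(2) \<open>Nb C \<subseteq> Y\<close> by (auto simp: cl_def Diff_Diff_Int Int_absorb1)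
      ultimately show ?thesis by blast
    qed (use C in \<open>auto simp: C1_def\<close>)
  qed
  have f2: "finite ((\<lambda>Q. {x \<in> X. nb x \<subseteq> Y - Q}) ` C2)" using fin by auto
  then show "finite CC" using sub fin finite_subset by blast
  have "card CC \<le> card (C1 \<union> (\<lambda>Q. {x \<in> X. nb x \<subseteq> Y - Q}) ` C2)"
    using sub fin f2 by (intro card_mono) auto
  also have "\<dots> \<le> card C1 + card ((\<lambda>Q. {x \<in> X. nb x \<subseteq> Y - Q}) ` C2)" by (rule card_Un_le)
  also have "\<dots> \<le> card C1 + card C2" using fin by (intro add_left_mono card_image_le)
  finally have "real (card CC) \<le> real (card C1) + real (card C2)" by linarith
  also have "\<dots> \<le> 2 * 2 powr (L * k)"
    using cnt[OF finite_X card_X] cnt[OF finite_Y card_Y] by (simp add: C1_def C2_def)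
  finally show "real (card CC) \<le> 2 * 2 powr (L * (real d * t0))" by (simp add: k_def)
qed

text \<open>Sets of small defect are grouped by their closure C; a group weighs at most \<tau> 2 ^
  (|C| - |N(C)|) \<le> \<tau>, so only the number of closures matters.\<close>

lemma total_sum_le:
  fixes W :: "'a set \<Rightarrow> real"
  assumes W: "\<And>A. W A \<ge> 0" and \<tau>: "\<tau> \<ge> 0"
    and WS: "\<And>S. S \<subseteq> X \<Longrightarrow> (\<Sum>A\<in>Pow S. W A) \<le> \<tau> * 2 powr real (card S)"
    and t0N: "real d * t0 \<le> real N"
  shows "(\<Sum>A\<in>Pow X. W A * 2 powr (- real (card (Nb A)))) \<le> \<tau> * Mfac"
proof -
  define f where "f = (\<lambda>A. W A * 2 powr (- real (card (Nb A))))"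
  define CC where "CC = {C. C \<subseteq> X \<and> cl C = C \<and> real (defect C) < t0}"
  define big where "big = {A. A \<subseteq> X \<and> t0 \<le> real (defect A)}"
  define small where "small = {A. A \<subseteq> X \<and> real (defect A) < t0}"
  have f0: "f A \<ge> 0" for A using W by (simp add: f_def)
  have fin: "finite big" "finite small" using finite_X by (auto simp: big_def small_def)
  have finCC: "finite CC" and cardCC: "real (card CC) \<le> 2 * 2 powr (L * (real d * t0))"
    using card_small_closed[OF t0N] by (auto simp: CC_def)
  have "Pow X = big \<union> small" "big \<inter> small = {}" by (auto simp: big_def small_def)
  then have "sum f (Pow X) = sum f big + sum f small" using fin by (simp add: sum.union_disjoint)
  also have "sum f big \<le> \<tau> * 2 powr (- (\<gamma> * t0 / 2))"
    unfolding f_def big_def by (rule container_sum[OF W \<tau> WS]) auto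
  also have "\<dots> \<le> \<tau> * 1"
  proof (rule mult_left_mono[OF _ \<tau>])
    have "- (\<gamma> * t0 / 2) \<le> 0" using \<gamma> t0 by simp
    then show "2 powr (- (\<gamma> * t0 / 2)) \<le> 1" using powr_mono[of "- (\<gamma> * t0 / 2)" 0 2] by simp
  qed
  also have "sum f small \<le> (\<Sum>C\<in>CC. sum f {A. A \<subseteq> X \<and> cl A = C})"
  proof (rule sum_cover_le[OF finCC])
    show "small \<subseteq> (\<Union>C\<in>CC. {A. A \<subseteq> X \<and> cl A = C})"
    proof
      fix A assume "A \<in> small"
      then have A: "A \<subseteq> X" "real (defect A) < t0" by (auto simp: small_def)
      have idem: "cl (cl A) = cl A" using Nb_cl[OF A(1)] by (auto simp: cl_def)
      then have "cl A \<in> CC" using A Nb_cl[OF A(1)] cl_subset by (auto simp: CC_def defect_def)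
      then show "A \<in> (\<Union>C\<in>CC. {A. A \<subseteq> X \<and> cl A = C})" using A by auto
    qed
  qed (use finite_X f0 in auto)
  also have "\<dots> \<le> real (card CC) * \<tau>"
  proof (rule sum_bounded_above)
    fix C assume "C \<in> CC"
    then have C: "C \<subseteq> X" by (auto simp: CC_def)
    have "sum f {A. A \<subseteq> X \<and> cl A = C} = (\<Sum>A | A \<subseteq> X \<and> cl A = C. W A) * 2 powr (- real (card (Nb C)))"
      unfolding sum_distrib_right f_def using Nb_cl by (intro sum.cong) auto
    also have "(\<Sum>A | A \<subseteq> X \<and> cl A = C. W A) \<le> (\<Sum>A\<in>Pow C. W A)"
      using W C finite_sub by (intro sum_mono2) (auto dest: subsetD[OF subset_cl])
    also have "\<dots> \<le> \<tau> * 2 powr real (card C)" by (rule WS[OF C])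
    finally have "sum f {A. A \<subseteq> X \<and> cl A = C} \<le> \<tau> * 2 powr (real (card C) - real (card (Nb C)))"
      by (simp add: powr_shift[symmetric])
    also have "\<dots> \<le> \<tau> * 2 powr 0"
      using card_le_Nb[OF C] \<tau> by (intro mult_left_mono powr_mono) auto
    finally show "sum f {A. A \<subseteq> X \<and> cl A = C} \<le> \<tau>" by simp
  qed
  also have "\<dots> \<le> (2 * 2 powr (L * (real d * t0))) * \<tau>" using cardCC \<tau> by (rule mult_right_mono)
  finally show ?thesis by (simp add: f_def Mfac_def algebra_simps)
qed

end

text \<open>The sides alternate with the level, hence the generalisation over \<open>X\<close> and
  \<open>Y\<close>. Confining the level set to \<open>S\<close> gives the bound exactly the form of
  the hypothesis \<open>WS\<close>, so that it feeds the next step; at height 1 only the ground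
  state remains.\<close>

lemma upper_bound:
  assumes "bireg_num X Y nb d N \<theta> \<psi> \<gamma> L t0" "real d * t0 \<le> real N" "S \<subseteq> X" "j \<ge> 1"
  shows "real (card {f \<in> upper X Y nb j. high X f \<subseteq> S})
    \<le> bireg_num.Mfac d L t0 ^ j * 2 powr real (card S)"
  using assms(4,1,3)
proof (induction j arbitrary: X Y S rule: dec_induct)
  case base
  interpret bireg_num X Y nb d N \<theta> \<psi> \<gamma> L t0 by fact
  have "f = (\<lambda>v\<in>X \<union> Y. if v \<in> X then 0 else 1)" if "f \<in> upper X Y nb 1" for f
  proof (rule extensionalityI)
    show "f \<in> extensional (X \<union> Y)" using that by (simp add: upper_def even_homs_def all_homs_def)
    fix v assume v: "v \<in> X \<union> Y"
    show "f v = (\<lambda>v\<in>X \<union> Y. if v \<in> X then 0 else 1) v"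
    proof (cases "v \<in> X")
      case True
      then have "even (f v)" "0 \<le> f v" "f v \<le> 1" using that by (auto simp: upper_def even_homs_def)
      then have "f v = 0" by presburger
      then show ?thesis using True by simp
    next
      case False
      then show ?thesis using that v by (auto simp: upper_def)
    qed
  qed auto
  then have sing: "{f \<in> upper X Y nb 1. high X f \<subseteq> S} \<subseteq> {\<lambda>v\<in>X \<union> Y. if v \<in> X then 0 else 1}" by blast
  then have "card {f \<in> upper X Y nb 1. high X f \<subseteq> S} \<le> 1"
    using card_mono[OF _ sing] by simp
  moreover have "1 \<le> Mfac * 2 powr real (card S)"
    using Mfac_ge mult_mono[of 1 Mfac 1 "2 powr real (card S)"] by (simp add: ge_one_powr_ge_zero)
  ultimately show ?case by simp
next
  case (step j)
  interpret bireg_num X Y nb d N \<theta> \<psi> \<gamma> L t0 by fact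
  interpret sw: bireg_num Y X nb d N \<theta> \<psi> \<gamma> L t0 by (rule swap_num)
  define W where "W = (\<lambda>A. real (card {f \<in> upper Y X nb j. high Y f = A}))"
  define \<tau> where "\<tau> = Mfac ^ j"
  have \<tau>0: "\<tau> \<ge> 0" using Mfac_ge by (simp add: \<tau>_def)
  have WS: "(\<Sum>A\<in>Pow S'. W A) \<le> \<tau> * 2 powr real (card S')" if "S' \<subseteq> Y" for S'
    unfolding W_def using sw.card_upper_high[OF that, of j] step.IH[OF swap_num that] by (simp add: \<tau>_def)
  have finS: "finite S" using step.prems finite_sub by auto
  have "real (card {f \<in> upper X Y nb (Suc j). high X f \<subseteq> S})
    \<le> real (\<Sum>f\<in>{f \<in> upper Y X nb j. Nb (high Y f) \<subseteq> S}. 2 ^ (card S - card (Nb (high Y f))))"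
    using upper_step[OF step.hyps(1) step.prems(2)] by (simp only: of_nat_le_iff)
  also have "\<dots> = (\<Sum>f\<in>{f \<in> upper Y X nb j. Nb (high Y f) \<subseteq> S}. 2 powr real (card S) * 2 powr (- real (card (Nb (high Y f)))))"
    unfolding of_nat_sum
  proof (rule sum.cong[OF refl])
    fix f assume "f \<in> {f \<in> upper Y X nb j. Nb (high Y f) \<subseteq> S}"
    then have "card (Nb (high Y f)) \<le> card S" using finS by (auto intro: card_mono)
    then have "real (card S - card (Nb (high Y f))) = real (card S) - real (card (Nb (high Y f)))" by simp
    then show "real (2 ^ (card S - card (Nb (high Y f)))) = 2 powr real (card S) * 2 powr (- real (card (Nb (high Y f))))"
      using powr_shift[of 1 "real (card S)" "real (card (Nb (high Y f)))"]
        powr_realpow[of 2 "card S - card (Nb (high Y f))"] by simp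
  qed
  also have "\<dots> = 2 powr real (card S) * (\<Sum>A | A \<subseteq> Y \<and> Nb A \<subseteq> S. W A * 2 powr (- real (card (Nb A))))"
    unfolding sum_distrib_left[symmetric] W_def
    using sw.sum_upper_high[where j = j and P = "\<lambda>A. Nb A \<subseteq> S" and c = "\<lambda>A. 2 powr (- real (card (Nb A)))"] by simp
  also have "\<dots> \<le> 2 powr real (card S) * (\<Sum>A\<in>Pow Y. W A * 2 powr (- real (card (Nb A))))"
    using finite_Y by (intro mult_left_mono sum_mono2) (auto simp: W_def)
  also have "\<dots> \<le> 2 powr real (card S) * (\<tau> * Mfac)"
    using WS \<tau>0 assms(2) by (intro mult_left_mono sw.total_sum_le) (auto simp: W_def)
  finally show ?case by (simp add: \<tau>_def algebra_simps)
qed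

section \<open>Level sets of two-sided homomorphisms\<close>

context bireg_num begin

lemma even_homs_neg:
  assumes "h \<in> even_homs X Y nb"
  shows "(\<lambda>v\<in>X \<union> Y. - h v) \<in> even_homs X Y nb"
proof -
  have "\<bar>- h x - - h y\<bar> = 1" if "x \<in> X" "y \<in> nb x" for x y
    using assms that all_homs_adj[of h X Y nb x y] by (simp add: even_homs_def abs_minus_commute)
  moreover have "y \<in> Y" if "x \<in> X" "y \<in> nb x" for x y using that nb_X by auto
  ultimately show ?thesis using assms by (auto simp: even_homs_def all_homs_def)
qed

text \<open>Splitting \<open>h\<close> into its positive and negative part relative to the ground state
  (0 on the first side, 1 on the second) turns it into two one-sided homomorphisms whose supports
  are separated.\<close>

lemma level_bound:
  assumes t0N: "real d * t0 \<le> real N" and t': "t0 \<le> t'"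
    and \<tau>: "\<tau> = Mfac ^ (J + 1)"
  shows "real (card {h \<in> even_homs X Y nb. (\<forall>v\<in>X \<union> Y. \<bar>h v\<bar> \<le> int J) \<and> t' \<le> real (defect (high X h))})
    \<le> \<tau> ^ 2 * 2 powr (real N - \<gamma> * t' / 2)"
proof -
  interpret sw: bireg_num Y X nb d N \<theta> \<psi> \<gamma> L t0 by (rule swap_num)
  have \<tau>1: "\<tau> \<ge> 1" unfolding \<tau> by (rule one_le_power[OF Mfac_ge])
  define P where "P = {h \<in> even_homs X Y nb. (\<forall>v\<in>X \<union> Y. \<bar>h v\<bar> \<le> int J) \<and> t' \<le> real (defect (high X h))}"
  define Q where "Q = {f \<in> upper X Y nb (J + 1). t' \<le> real (defect (high X f))}"
  define LL where "LL = (\<lambda>f. {l \<in> upper Y X nb (J + 1). high Y l \<subseteq> Y - Nb (high X f)})"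
  define up where "up = (\<lambda>h::'a \<Rightarrow> int. \<lambda>v\<in>X \<union> Y. if v \<in> X then max (h v) 0 else max (h v) 1)"
  \<comment> \<open>The reflection 1 - min turns the negative part into a one-sided homomorphism
    with the sides exchanged; it raises the largest possible value to J + 1.\<close>
  define lo where "lo = (\<lambda>h::'a \<Rightarrow> int. \<lambda>v\<in>X \<union> Y. 1 - (if v \<in> X then min (h v) 0 else min (h v) 1))"
  have YX: "y \<notin> X" if "y \<in> Y" for y using that disj by auto
  have finQ: "finite Q" using finite_upper by (simp add: Q_def)
  have maps: "(up h, lo h) \<in> (SIGMA f:Q. LL f)" if "h \<in> P" for h
  proof -
    have h: "h \<in> all_homs X Y nb" "\<And>x. x \<in> X \<Longrightarrow> even (h x) \<and> \<bar>h x\<bar> \<le> int J"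
      "\<And>y. y \<in> Y \<Longrightarrow> odd (h y) \<and> \<bar>h y\<bar> \<le> int J" "t' \<le> real (defect (high X h))"
      using that by (auto simp: P_def even_homs_def)
    have adj: "\<bar>up h x - up h y\<bar> = 1 \<and> \<bar>lo h x - lo h y\<bar> = 1" if "x \<in> X" "y \<in> nb x" for x y
    proof -
      have y: "y \<in> Y" using that nb_X by auto
      moreover have "\<bar>h x - h y\<bar> = 1" using h(1) that by (rule all_homs_adj)
      moreover have "h x \<le> -2 \<or> h x = 0 \<or> h x \<ge> 2" using h(2)[OF that(1)] by presburger
      ultimately show ?thesis using that YX by (auto simp: up_def lo_def max_def min_def)
    qed
    have u1: "up h \<in> all_homs X Y nb" using adj by (auto simp: all_homs_def up_def)
    have l1: "lo h \<in> all_homs Y X nb" unfolding all_homs_swap using adj by (auto simp: all_homs_def lo_def)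
    have "even (up h x)" "0 \<le> up h x" "up h x \<le> int (J + 1)" if "x \<in> X" for x
      using h(2)[OF that] that by (auto simp: up_def max_def)
    moreover have "odd (up h y)" "1 \<le> up h y" "up h y \<le> int (J + 1)" if "y \<in> Y" for y
      using h(3)[OF that] that YX by (auto simp: up_def max_def)
    ultimately have "up h \<in> upper X Y nb (J + 1)" using u1 by (auto simp: upper_def even_homs_def)
    moreover have hi: "high X (up h) = high X h" by (auto simp: high_def up_def)
    ultimately have 1: "up h \<in> Q" using h(4) by (simp add: Q_def)
    have "odd (lo h x)" "1 \<le> lo h x" "lo h x \<le> int (J + 1)" if "x \<in> X" for x
      using h(2)[OF that] that by (auto simp: lo_def min_def)
    moreover have "even (lo h y)" "0 \<le> lo h y" "lo h y \<le> int (J + 1)" if "y \<in> Y" for y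
      using h(3)[OF that] that YX by (auto simp: lo_def min_def)
    ultimately have l2: "lo h \<in> upper Y X nb (J + 1)" using l1 by (auto simp: upper_def even_homs_def)
    have "high Y (lo h) \<subseteq> Y - Nb (high X h)"
    proof
      fix y assume "y \<in> high Y (lo h)"
      then have y: "y \<in> Y" "h y \<le> -1" using YX by (auto simp: high_def lo_def)
      have "y \<notin> Nb (high X h)"
      proof
        assume "y \<in> Nb (high X h)"
        then obtain x where "x \<in> X" "2 \<le> h x" "y \<in> nb x" by (auto simp: nbhd_def high_def)
        then show False using all_homs_adj[OF h(1)] y by fastforce
      qed
      then show "y \<in> Y - Nb (high X h)" using y by auto
    qed
    then show ?thesis using 1 l2 hi by (simp add: LL_def)
  qed
  have inj: "inj_on (\<lambda>h. (up h, lo h)) P"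
  proof (rule inj_onI)
    fix f g assume fg: "f \<in> P" "g \<in> P" and "(up f, lo f) = (up g, lo g)"
    then have eq: "up f = up g" "lo f = lo g" by auto
    have mem: "f \<in> extensional (X \<union> Y)" "g \<in> extensional (X \<union> Y)"
      using fg by (auto simp: P_def even_homs_def all_homs_def)
    show "f = g"
    proof (rule extensionalityI[OF mem])
      fix v assume v: "v \<in> X \<union> Y"
      have "up f v = up g v" "lo f v = lo g v" using eq by auto
      then show "f v = g v" using v by (auto simp: up_def lo_def max_def min_def split: if_splits)
    qed
  qed
  have "card P \<le> card (SIGMA f:Q. LL f)"
    using maps finQ sw.finite_upper by (intro card_inj_on_le[OF inj]) (auto simp: LL_def)
  also have "\<dots> = (\<Sum>f\<in>Q. card (LL f))" using finQ sw.finite_upper by (intro card_SigmaI) (auto simp: LL_def)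
  finally have "real (card P) \<le> (\<Sum>f\<in>Q. real (card (LL f)))" by (metis of_nat_le_iff of_nat_sum)
  \<comment> \<open>The lower part lives on the complement of N(A) for the upper level set A.
    Counting it produces the factor 2 ^ (- |N(A)|) that \<open>container_sum\<close>
    expects.\<close>
  also have "\<dots> \<le> (\<Sum>f\<in>Q. \<tau> * 2 powr real N * 2 powr (- real (card (Nb (high X f)))))"
  proof (rule sum_mono)
    fix f
    have hX: "high X f \<subseteq> X" by (rule high_subset)
    have "real (card (LL f)) \<le> \<tau> * 2 powr real (card (Y - Nb (high X f)))"
      unfolding LL_def \<tau> by (rule upper_bound[OF swap_num t0N]) auto
    also have "real (card (Y - Nb (high X f))) = real N - real (card (Nb (high X f)))"
      using card_Diff_subset[OF finite_Nb[OF hX] Nb_subset[OF hX]] card_Nb_le_N[OF hX] card_Y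
      by (simp add: of_nat_diff)
    finally show "real (card (LL f)) \<le> \<tau> * 2 powr real N * 2 powr (- real (card (Nb (high X f))))"
      by (simp add: powr_shift)
  qed
  also have "\<dots> = \<tau> * 2 powr real N * (\<Sum>A | A \<subseteq> X \<and> t' \<le> real (defect A).
      real (card {f \<in> upper X Y nb (J + 1). high X f = A}) * 2 powr (- real (card (Nb A))))"
    unfolding sum_distrib_left[symmetric] Q_def
    using sum_upper_high[where j = "J + 1" and P = "\<lambda>A. t' \<le> real (defect A)" and c = "\<lambda>A. 2 powr (- real (card (Nb A)))"] by simp
  also have "\<dots> \<le> \<tau> * 2 powr real N * (\<tau> * 2 powr (- (\<gamma> * t' / 2)))"
  proof (intro mult_left_mono container_sum)
    fix S assume S: "S \<subseteq> X"
    show "(\<Sum>A\<in>Pow S. real (card {f \<in> upper X Y nb (J + 1). high X f = A})) \<le> \<tau> * 2 powr real (card S)"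
      unfolding card_upper_high[OF S] \<tau> using S by (intro upper_bound[OF bireg_num_axioms t0N]) auto
  qed (use \<tau>1 t' in auto)
  also have "\<dots> = \<tau> ^ 2 * (2 powr real N * 2 powr (- (\<gamma> * t' / 2)))" by (simp add: power2_eq_square)
  finally show ?thesis by (simp add: P_def powr_add[symmetric])
qed

end

section \<open>Phases and excursions\<close>

text \<open>\<open>t1\<close> is the defect from which on level sets are rare, \<open>jj\<close> the
  expansion of sets of density at most 3 ^ (- jj), \<open>J\<close> the largest variation of a
  homomorphism and \<open>s\<close> the number of simultaneous excursions. \<open>room\<close>
  leaves space for s vertices with disjoint second neighbourhoods; \<open>amp\<close> is the final
  balance in \<open>above_single\<close> between the price \<open>Mfac\<close>, the saving from s
  excursions and the error from doubling a phase.\<close>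

locale hom_graph = bireg_num +
  fixes J jj s :: nat and t1 :: real
  assumes t0N: "real d * t0 \<le> real N" and t01: "t0 \<le> t1" and jj: "1 \<le> jj" "jj \<le> d" and s1: "1 \<le> s"
    and thin: "4 * real d ^ 2 * t1 * 3 ^ jj \<le> real N"
    and isoj_X: "A \<subseteq> X \<Longrightarrow> real (card A) * 3 ^ jj \<le> real N \<Longrightarrow>
      real jj * real (card A) \<le> real d * (real (card (nbhd nb A)) - real (card A))"
    and isoj_Y: "A \<subseteq> Y \<Longrightarrow> real (card A) * 3 ^ jj \<le> real N \<Longrightarrow>
      real jj * real (card A) \<le> real d * (real (card (nbhd nb A)) - real (card A))"
    and bounded: "h \<in> all_homs X Y nb \<Longrightarrow> u \<in> X \<union> Y \<Longrightarrow> v \<in> X \<union> Y \<Longrightarrow> \<bar>h u - h v\<bar> \<le> int J"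
    and trans_X: "u \<in> X \<Longrightarrow> u' \<in> X \<Longrightarrow> \<exists>\<pi>. bij_betw \<pi> X X \<and> bij_betw \<pi> Y Y \<and> (\<forall>v\<in>X \<union> Y. nb (\<pi> v) = \<pi> ` nb v) \<and> \<pi> u = u'"
    and trans_Y: "u \<in> Y \<Longrightarrow> u' \<in> Y \<Longrightarrow> \<exists>\<pi>. bij_betw \<pi> X X \<and> bij_betw \<pi> Y Y \<and> (\<forall>v\<in>X \<union> Y. nb (\<pi> v) = \<pi> ` nb v) \<and> \<pi> u = u'"
    and room: "real s * real d ^ 4 \<le> real N" and st0: "t0 \<le> real s * (real d - 1) * real jj / 2"
    and amp: "Mfac ^ (2 * (2 * J + 5)) * (2 powr (- (\<gamma> * (real s * (real d - 1) * real jj / 2) / 2))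
      + 2 * real s * 2 powr (- (\<gamma> * (t1 * real jj) / 2))) \<le> 2 powr (- (4 * real d * real s))"
begin

lemma swap_hom: "hom_graph Y X nb d N \<theta> \<psi> \<gamma> L t0 J jj s t1"
proof (intro hom_graph.intro swap_num, unfold_locales)
  show "\<bar>h u - h v\<bar> \<le> int J" if "h \<in> all_homs Y X nb" "u \<in> Y \<union> X" "v \<in> Y \<union> X" for h u v
    using that bounded by (simp add: all_homs_swap Un_commute)
  show "\<exists>\<pi>. bij_betw \<pi> Y Y \<and> bij_betw \<pi> X X \<and> (\<forall>v\<in>Y \<union> X. nb (\<pi> v) = \<pi> ` nb v) \<and> \<pi> u = u'"
    if "u \<in> X" "u' \<in> X" for u u' using trans_X[OF that] by (auto simp: Un_commute)
  show "\<exists>\<pi>. bij_betw \<pi> Y Y \<and> bij_betw \<pi> X X \<and> (\<forall>v\<in>Y \<union> X. nb (\<pi> v) = \<pi> ` nb v) \<and> \<pi> u = u'"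
    if "u \<in> Y" "u' \<in> Y" for u u' using trans_Y[OF that] by (auto simp: Un_commute)
qed (fact t0N t01 jj s1 thin isoj_X isoj_Y room st0 amp)+

text \<open>The exponent is one more than the cap 2 J + 4 in \<open>levels\<close>. That cap is
  reached when a homomorphism bounded by J is shifted so that a level k with |k| \<le> J + 2 moves
  to 2.\<close>

definition \<tau> :: real where "\<tau> = Mfac ^ (2 * J + 5)"

text \<open>In \<open>phase_step\<close> two consecutive level sets contribute up to d t1
  exceptional vertices each.\<close>

definition eps :: real where "eps = 2 * real d * t1"

definition phase :: "real \<Rightarrow> ('a \<Rightarrow> int) set" where
  "phase e = {h \<in> even_homs X Y nb. real (card {x \<in> X. h x \<noteq> 0}) \<le> e}"

definition above :: "'a set \<Rightarrow> ('a \<Rightarrow> int) set" where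
  "above U = {h. \<forall>u\<in>U. 3 \<le> h u}"

definition neg :: "('a \<Rightarrow> int) \<Rightarrow> 'a \<Rightarrow> int" where
  "neg h = (\<lambda>v\<in>X \<union> Y. - h v)"

lemma t1_pos: "t1 > 0" using t0 t01 by linarith

lemma eps_pos: "eps > 0" using t1_pos d_pos by (simp add: eps_def)

lemma eps_thin: "2 * eps * real d * 3 ^ jj \<le> real N"
  using thin by (simp add: eps_def power2_eq_square algebra_simps)

lemma eps_N: "4 * eps < real N"
proof -
  have "eps * (2 * 4 * 1) \<le> eps * (2 * real d * 3 ^ jj)"
    using d4 eps_pos by (intro mult_left_mono mult_mono) auto
  also have "\<dots> \<le> real N" using eps_thin by (simp add: algebra_simps)
  finally show ?thesis using eps_pos by linarith
qed

lemma levels: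
  assumes "t0 \<le> t'"
  shows "real (card {h \<in> even_homs X Y nb. (\<forall>v\<in>X \<union> Y. \<bar>h v\<bar> \<le> int (2 * J + 4)) \<and> t' \<le> real (defect (high X h))})
    \<le> \<tau> ^ 2 * 2 powr (real N - \<gamma> * t' / 2)"
  using level_bound[OF t0N assms, of \<tau> "2 * J + 4"] by (simp add: \<tau>_def numeral_eq_Suc)

lemma finite_capped: "finite {h \<in> even_homs X Y nb. (\<forall>v\<in>X \<union> Y. \<bar>h v\<bar> \<le> b) \<and> P h}"
  by (rule finite_subset[OF _ finite_bounded_extensional[of "X \<union> Y" b]])
    (use finite_X finite_Y in \<open>auto simp: even_homs_def all_homs_def\<close>)

lemma phase_zero:
  assumes "h \<in> phase e" "e < real N"
  shows "\<exists>x\<in>X. h x = 0"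
proof (rule ccontr)
  assume "\<not> ?thesis"
  then have "{x \<in> X. h x \<noteq> 0} = X" by auto
  then show False using assms card_X by (simp add: phase_def)
qed

lemma phase_bounded:
  assumes h: "h \<in> phase e" "e < real N" and v: "v \<in> X \<union> Y"
  shows "\<bar>h v\<bar> \<le> int J"
proof -
  obtain x where x: "x \<in> X" "h x = 0" using phase_zero[OF h] by auto
  have "h \<in> all_homs X Y nb" using h by (simp add: phase_def even_homs_def)
  then show ?thesis using bounded[of h v x] v x by simp
qed

lemma finite_phase: "e < real N \<Longrightarrow> finite (phase e)"
  by (rule finite_subset[OF _ finite_capped[of "int J" "\<lambda>_. True"]])
    (auto simp: phase_bounded, auto simp: phase_def)

lemma neg_even: "h \<in> even_homs X Y nb \<Longrightarrow> neg h \<in> even_homs X Y nb"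
  unfolding neg_def by (rule even_homs_neg)

lemma neg_neg: "h \<in> even_homs X Y nb \<Longrightarrow> neg (neg h) = h"
  by (rule extensionalityI[of _ "X \<union> Y"]) (auto simp: neg_def even_homs_def all_homs_def)

lemma neg_phase: "h \<in> phase e \<Longrightarrow> neg h \<in> phase e"
proof -
  assume h: "h \<in> phase e"
  have "{x \<in> X. neg h x \<noteq> 0} = {x \<in> X. h x \<noteq> 0}" by (auto simp: neg_def)
  then show ?thesis using h neg_even by (simp add: phase_def)
qed

lemma card_Nb_le: "A \<subseteq> X \<Longrightarrow> real (card (Nb A)) \<le> real d * real (card A)"
proof -
  assume A: "A \<subseteq> X"
  have "card (Nb A) \<le> (\<Sum>x\<in>A. card (nb x))" unfolding nbhd_def using A finite_sub by (intro card_UN_le) auto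
  also have "\<dots> = (\<Sum>x\<in>A. d)" using A deg_X by (intro sum.cong) auto
  finally have "card (Nb A) \<le> d * card A" by (simp add: mult.commute)
  then have "real (card (Nb A)) \<le> real (d * card A)" by (simp only: of_nat_le_iff)
  then show ?thesis by simp
qed

text \<open>The closure has at most |N(A)| \<le> 2 d eps elements, which \<open>eps_thin\<close>
  makes sparse enough for the strong expansion axiom.\<close>

lemma defect_ge:
  assumes A: "A \<subseteq> X" "real (card A) \<le> 2 * eps"
  shows "real jj * real (card (cl A)) \<le> real d * real (defect A)"
proof -
  have "real (card (cl A)) * 3 ^ jj \<le> real (card (Nb A)) * 3 ^ jj" using card_cl_le[OF A(1)] by simp
  also have "\<dots> \<le> (real d * (2 * eps)) * 3 ^ jj"
    using card_Nb_le[OF A(1)] mult_left_mono[OF A(2), of "real d"] by (intro mult_right_mono) auto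
  also have "\<dots> \<le> real N" using eps_thin by (simp add: algebra_simps)
  finally show ?thesis using isoj_X[OF cl_subset, of A] Nb_cl[OF A(1)] real_defect[OF A(1)] by simp
qed

text \<open>One sign accounts for more than eps / 2 of the nonzero vertices, and up to
  \<open>neg\<close> it is the positive one. By strong expansion that level set has defect at least
  t1 jj, so the level estimate applies; the factor 2 is for the two signs.\<close>

lemma phase_gap: "real (card (phase (2 * eps) - phase eps)) \<le> 2 * (\<tau> ^ 2 * 2 powr (real N - \<gamma> * (t1 * real jj) / 2))"
proof -
  define K where "K = {h \<in> even_homs X Y nb. (\<forall>v\<in>X \<union> Y. \<bar>h v\<bar> \<le> int (2 * J + 4)) \<and> t1 * real jj \<le> real (defect (high X h))}"
  have "t1 \<le> t1 * real jj" using jj t1_pos by simp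
  then have cK: "real (card K) \<le> \<tau> ^ 2 * 2 powr (real N - \<gamma> * (t1 * real jj) / 2)"
    using levels[of "t1 * real jj"] t01 by (simp add: K_def)
  have finK: "finite K" using finite_capped by (simp add: K_def)
  have key: "h \<in> K" if h: "h \<in> phase (2 * eps)" and big: "real (card (high X h)) > eps / 2" for h
  proof -
    have "card (high X h) \<le> card {x \<in> X. h x \<noteq> 0}"
      using finite_X by (intro card_mono) (auto simp: high_def)
    then have hi: "real (card (high X h)) \<le> 2 * eps" using h by (simp add: phase_def)
    have "card (high X h) \<le> card (cl (high X h))"
      using cl_subset finite_sub subset_cl[OF high_subset] by (intro card_mono) auto
    then have "eps / 2 \<le> real (card (cl (high X h)))" using big by linarith
    then have "real jj * (eps / 2) \<le> real d * real (defect (high X h))"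
      using defect_ge[OF high_subset hi] mult_left_mono[of "eps / 2" "real (card (cl (high X h)))" "real jj"] by simp
    then have "real d * (t1 * real jj) \<le> real d * real (defect (high X h))" by (simp add: eps_def algebra_simps)
    then have "t1 * real jj \<le> real (defect (high X h))" using d_pos by simp
    moreover have "\<bar>h v\<bar> \<le> int (2 * J + 4)" if "v \<in> X \<union> Y" for v
      using phase_bounded[OF h _ that] eps_N eps_pos by simp
    ultimately show ?thesis using h by (simp add: K_def phase_def)
  qed
  have sub: "phase (2 * eps) - phase eps \<subseteq> K \<union> neg ` K"
  proof
    fix h assume h: "h \<in> phase (2 * eps) - phase eps"
    then have he: "h \<in> even_homs X Y nb" and big: "real (card {x \<in> X. h x \<noteq> 0}) > eps"
      by (auto simp: phase_def)
    have "{x \<in> X. h x \<noteq> 0} \<subseteq> high X h \<union> high X (neg h)"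
    proof
      fix x assume x: "x \<in> {x \<in> X. h x \<noteq> 0}"
      then have "even (h x)" "h x \<noteq> 0" using he by (auto simp: even_homs_def)
      then have "2 \<le> h x \<or> 2 \<le> - h x" by presburger
      then show "x \<in> high X h \<union> high X (neg h)" using x by (auto simp: high_def neg_def)
    qed
    then have "card {x \<in> X. h x \<noteq> 0} \<le> card (high X h \<union> high X (neg h))"
      using finite_X by (intro card_mono) (auto simp: high_def)
    also have "\<dots> \<le> card (high X h) + card (high X (neg h))" by (rule card_Un_le)
    finally have "real (card (high X h)) > eps / 2 \<or> real (card (high X (neg h))) > eps / 2" using big by linarith
    then have "h \<in> K \<or> neg h \<in> K" using key h neg_phase by blast
    then show "h \<in> K \<union> neg ` K" using neg_neg[OF he] by (metis UnI1 UnI2 imageI)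
  qed
  have "card (phase (2 * eps) - phase eps) \<le> card (K \<union> neg ` K)" using sub finK by (intro card_mono) auto
  also have "\<dots> \<le> card K + card (neg ` K)" by (rule card_Un_le)
  also have "\<dots> \<le> card K + card K" using finK by (intro add_left_mono card_image_le)
  finally show ?thesis using cK by linarith
qed

section \<open>Well spread excursions and amplification\<close>

lemma card_NbNb: "y \<in> Y \<Longrightarrow> real d * (real d - 1) \<le> real (card (Nb (nb y)))"
proof -
  assume y: "y \<in> Y"
  have "(\<Sum>x\<in>nb y \<inter> X. real (card (nb x \<inter> Y))) \<le> real (card (Nb (nb y \<inter> X) \<inter> Y)) + real d"
    by (rule paths_le[OF y]) auto
  moreover have nbX: "nb y \<inter> X = nb y" using nb_Y y by auto
  moreover have "Nb (nb y) \<inter> Y = Nb (nb y)" using Nb_subset[of "nb y"] nb_Y y by auto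
  moreover have "(\<Sum>x\<in>nb y. real (card (nb x \<inter> Y))) = (\<Sum>x\<in>nb y. real d)"
  proof (rule sum.cong[OF refl])
    fix x assume "x \<in> nb y"
    then have "x \<in> X" using nb_Y y by auto
    then show "real (card (nb x \<inter> Y)) = real d" using nb_X deg_X by (simp add: Int_absorb2)
  qed
  ultimately show ?thesis using deg_Y[OF y] by (simp add: algebra_simps)
qed

text \<open>Each new vertex is taken outside the four-step neighbourhood of \<open>S\<close>, which
  has at most k d ^ 4 elements; its second neighbourhood is then disjoint from the earlier
  ones.\<close>

lemma spread_exists:
  "real k * real d ^ 4 \<le> real N \<Longrightarrow>
    \<exists>S \<subseteq> Y. card S = k \<and> real k * (real d * (real d - 1)) \<le> real (card (Nb (Nb S)))"
proof (induction k)
  case (Suc k)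
  interpret sw: hom_graph Y X nb d N \<theta> \<psi> \<gamma> L t0 J jj s t1 by (rule swap_hom)
  have "real k * real d ^ 4 \<le> real (Suc k) * real d ^ 4" by (intro mult_right_mono) auto
  then obtain S where S: "S \<subseteq> Y" "card S = k" "real k * (real d * (real d - 1)) \<le> real (card (Nb (Nb S)))"
    using Suc by auto
  define B where "B = Nb (Nb (Nb (Nb S)))"
  have sub: "Nb S \<subseteq> X" "Nb (Nb S) \<subseteq> Y" "Nb (Nb (Nb S)) \<subseteq> X" "B \<subseteq> Y"
    using S Nb_subset sw.Nb_subset by (auto simp: B_def)
  have "real (card B) \<le> real d * (real d * (real d * (real d * real (card S))))"
    unfolding B_def using sub S
    by (intro order_trans[OF card_Nb_le] order_trans[OF sw.card_Nb_le] mult_left_mono) auto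
  also have "\<dots> = real k * real d ^ 4" by (simp add: S numeral_eq_Suc)
  also have "\<dots> < real (Suc k) * real d ^ 4" using d_pos by (intro mult_strict_right_mono) auto
  also have "\<dots> \<le> real N" by fact
  finally have "card B < card Y" using card_Y by simp
  then obtain y where y: "y \<in> Y" "y \<notin> B" using sub card_mono[of B Y] finite_sub by (metis not_less subsetI)
  have return: "v \<in> Nb (Nb T)" if "T \<subseteq> Y" "v \<in> T" for v T
  proof -
    have vY: "v \<in> Y" using that by auto
    then have "card (nb v) > 0" using deg_Y d_pos by simp
    then obtain x where x: "x \<in> nb v" by (metis card_gt_0_iff ex_in_conv)
    then have "x \<in> X" "v \<in> nb x" using nb_Y nb_sym vY by auto
    then show ?thesis using x that by (auto simp: nbhd_def)
  qed
  have "y \<notin> S" using y return[OF S(1)] return[OF sub(2)] by (auto simp: B_def)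
  have disj2: "Nb (nb y) \<inter> Nb (Nb S) = {}"
  proof (rule ccontr)
    assume "Nb (nb y) \<inter> Nb (Nb S) \<noteq> {}"
    then obtain x z where z: "z \<in> Nb (Nb S)" "x \<in> nb y" "z \<in> nb x" by (auto simp: nbhd_def)
    then have "x \<in> X" "z \<in> Y" using nb_Y y sub by auto
    then have "x \<in> nb z" "y \<in> nb x" using z nb_sym y by auto
    then show False using z y unfolding B_def nbhd_def by blast
  qed
  have "Nb (Nb (insert y S)) = Nb (nb y) \<union> Nb (Nb S)" by (auto simp: nbhd_def)
  moreover have "finite (Nb (nb y))" "finite (Nb (Nb S))"
    using finite_Nb sub nb_Y y by auto
  ultimately have "card (Nb (Nb (insert y S))) = card (Nb (nb y)) + card (Nb (Nb S))"
    using disj2 by (simp add: card_Un_disjoint)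
  then have "real (Suc k) * (real d * (real d - 1)) \<le> real (card (Nb (Nb (insert y S))))"
    using S(3) card_NbNb[OF y(1)] by (simp add: algebra_simps)
  moreover have "card (insert y S) = Suc k" using \<open>y \<notin> S\<close> S finite_sub by simp
  ultimately show ?case using S(1) y(1) by (intro exI[of _ "insert y S"]) auto
qed (auto intro!: exI[of _ "{}"])

text \<open>Values \<ge> 3 on \<open>S\<close> force values \<ge> 2 on N(S), so the level set A has
  |N(A)| \<ge> s d (d - 1). Inserting |cl A| = |N(A)| - defect into the expansion bound gives jj
  |N(A)| \<le> (d + jj) defect \<le> 2 d defect, a defect proportional to s.\<close>

lemma above_bound:
  assumes S: "S \<subseteq> Y" "real s * (real d * (real d - 1)) \<le> real (card (Nb (Nb S)))"
  shows "real (card (phase eps \<inter> above S)) \<le> \<tau> ^ 2 * 2 powr (real N - \<gamma> * (real s * (real d - 1) * real jj / 2) / 2)"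
proof -
  define tt where "tt = real s * (real d - 1) * real jj / 2"
  define K where "K = {h \<in> even_homs X Y nb. (\<forall>v\<in>X \<union> Y. \<bar>h v\<bar> \<le> int (2 * J + 4)) \<and> tt \<le> real (defect (high X h))}"
  have finK: "finite K" using finite_capped by (simp add: K_def)
  have "phase eps \<inter> above S \<subseteq> K"
  proof
    fix h assume h: "h \<in> phase eps \<inter> above S"
    then have hh: "h \<in> all_homs X Y nb" and he: "h \<in> even_homs X Y nb" by (auto simp: phase_def even_homs_def)
    define A where "A = high X h"
    have AX: "A \<subseteq> X" by (simp add: A_def high_subset)
    have "card A \<le> card {x \<in> X. h x \<noteq> 0}"
      using finite_X unfolding A_def by (intro card_mono) (auto simp: high_def)
    then have Ae: "real (card A) \<le> 2 * eps" using h eps_pos by (simp add: phase_def)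
    have "Nb S \<subseteq> A"
    proof
      fix x assume "x \<in> Nb S"
      then obtain y where y: "y \<in> S" "x \<in> nb y" by (auto simp: nbhd_def)
      then have "y \<in> Y" "3 \<le> h y" using S h by (auto simp: above_def)
      moreover from this have "x \<in> X" "y \<in> nb x" using y nb_Y nb_sym by blast+
      ultimately show "x \<in> A" using all_homs_adj[OF hh, of x y] by (auto simp: A_def high_def)
    qed
    then have "Nb (Nb S) \<subseteq> Nb A" by (auto simp: nbhd_def)
    then have "card (Nb (Nb S)) \<le> card (Nb A)" using finite_Nb[OF AX] by (intro card_mono)
    then have g: "real s * (real d * (real d - 1)) \<le> real (card (Nb A))" using S(2) by linarith
    have iso: "real jj * real (card (cl A)) \<le> real d * real (defect A)" by (rule defect_ge[OF AX Ae])
    have def': "real (card (cl A)) = real (card (Nb A)) - real (defect A)" using real_defect[OF AX] by simp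
    have "real jj * real (card (Nb A)) \<le> (real d + real jj) * real (defect A)"
      using iso unfolding def' by (simp add: algebra_simps)
    also have "\<dots> \<le> (2 * real d) * real (defect A)" using jj by (intro mult_right_mono) auto
    finally have "real jj * (real s * (real d * (real d - 1))) \<le> (2 * real d) * real (defect A)"
      using mult_left_mono[OF g, of "real jj"] by simp
    then have "real d * (2 * tt) \<le> real d * (2 * real (defect A))" by (simp add: tt_def algebra_simps)
    then have "tt \<le> real (defect A)" using d_pos by simp
    moreover have "\<bar>h v\<bar> \<le> int (2 * J + 4)" if "v \<in> X \<union> Y" for v
      using phase_bounded[OF _ _ that, of h eps] h eps_N eps_pos by simp
    ultimately show "h \<in> K" using he by (simp add: K_def A_def)
  qed
  then have "card (phase eps \<inter> above S) \<le> card K" using finK by (intro card_mono)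
  moreover have "real (card K) \<le> \<tau> ^ 2 * 2 powr (real N - \<gamma> * tt / 2)"
    using levels[of tt] st0 by (simp add: K_def tt_def)
  ultimately show ?thesis by (simp add: tt_def)
qed

text \<open>Composition with an automorphism carrying \<open>u\<close> to \<open>u'\<close>
  preserves the phase. Used in both directions, it makes the count independent of the
  vertex.\<close>

lemma card_above_le:
  assumes "u \<in> Y" "u' \<in> Y"
  shows "card (phase eps \<inter> above {u'}) \<le> card (phase eps \<inter> above {u})"
proof -
  obtain \<pi> where \<pi>: "bij_betw \<pi> X X" "bij_betw \<pi> Y Y" "\<And>v. v \<in> X \<union> Y \<Longrightarrow> nb (\<pi> v) = \<pi> ` nb v" "\<pi> u = u'"
    using trans_Y[OF assms] by auto
  have im: "\<pi> ` X = X" "\<pi> ` Y = Y" using \<pi> by (auto simp: bij_betw_def)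
  have mem: "\<pi> x \<in> X" if "x \<in> X" for x using im that by auto
  have memY: "\<pi> y \<in> Y" if "y \<in> Y" for y using im that by auto
  define T where "T = (\<lambda>h::'a \<Rightarrow> int. \<lambda>v\<in>X \<union> Y. h (\<pi> v))"
  have inj: "inj_on T (phase eps \<inter> above {u'})"
  proof (rule inj_onI)
    fix f g assume fg: "f \<in> phase eps \<inter> above {u'}" "g \<in> phase eps \<inter> above {u'}" and eq: "T f = T g"
    have ext: "f \<in> extensional (X \<union> Y)" "g \<in> extensional (X \<union> Y)"
      using fg by (auto simp: phase_def even_homs_def all_homs_def)
    show "f = g"
    proof (rule extensionalityI[OF ext])
      fix v assume "v \<in> X \<union> Y"
      then obtain w where w: "w \<in> X \<union> Y" "v = \<pi> w" using im by (metis Un_iff imageE)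
      then show "f v = g v" using fun_cong[OF eq, of w] by (simp add: T_def)
    qed
  qed
  have "T h \<in> phase eps \<inter> above {u}" if h: "h \<in> phase eps \<inter> above {u'}" for h
  proof -
    have he: "h \<in> all_homs X Y nb" "\<And>x. x \<in> X \<Longrightarrow> even (h x)" "\<And>y. y \<in> Y \<Longrightarrow> odd (h y)"
      "real (card {x \<in> X. h x \<noteq> 0}) \<le> eps" "3 \<le> h u'"
      using h by (auto simp: phase_def even_homs_def above_def)
    have "\<bar>T h x - T h y\<bar> = 1" if "x \<in> X" "y \<in> nb x" for x y
    proof -
      have "\<pi> y \<in> nb (\<pi> x)" using \<pi>(3)[of x] that by auto
      moreover have "y \<in> Y" using that nb_X by auto
      ultimately show ?thesis using that all_homs_adj[OF he(1), of "\<pi> x" "\<pi> y"] mem by (simp add: T_def)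
    qed
    then have "T h \<in> even_homs X Y nb"
      using he mem memY by (auto simp: even_homs_def all_homs_def T_def)
    moreover have "card {x \<in> X. T h x \<noteq> 0} \<le> card {x \<in> X. h x \<noteq> 0}"
    proof (rule card_inj_on_le[of \<pi>])
      show "inj_on \<pi> {x \<in> X. T h x \<noteq> 0}" using \<pi>(1) by (auto simp: bij_betw_def inj_on_def)
      show "\<pi> ` {x \<in> X. T h x \<noteq> 0} \<subseteq> {x \<in> X. h x \<noteq> 0}" using mem by (auto simp: T_def)
    qed (use finite_X in auto)
    ultimately show ?thesis using he \<pi>(4) assms by (auto simp: phase_def above_def T_def)
  qed
  moreover have "finite (phase eps \<inter> above {u})" using finite_phase[of eps] eps_N eps_pos by auto
  ultimately show ?thesis by (intro card_inj_on_le[OF inj]) auto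
qed

text \<open>Joins and meets stay in the phase at the price of doubling the exceptional set, so Daykin's
  inequality makes the probabilities of the increasing events \<open>above U\<close> supermultiplicative up to
  the (negligible) mass of the doubled phase.\<close>

lemma above_supermult:
  assumes "real (card (phase (2 * eps))) \<le> Z"
  shows "real (card (phase eps \<inter> above U)) * real (card (phase eps \<inter> above U'))
    \<le> (real (card (phase eps \<inter> above (U \<union> U'))) + real (card (phase (2 * eps) - phase eps))) * Z"
proof -
  define A where "A = phase eps \<inter> above U"
  define B where "B = phase eps \<inter> above U'"
  define JJ where "JJ = {(\<lambda>v. max (f v) (g v)) | f g. f \<in> A \<and> g \<in> B}"
  define MM where "MM = {(\<lambda>v. min (f v) (g v)) | f g. f \<in> A \<and> g \<in> B}"
  have fin2: "finite (phase (2 * eps))" "finite (phase eps)"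
    using finite_phase eps_N eps_pos by auto
  have finAB: "finite A" "finite B" using fin2 by (auto simp: A_def B_def)
  have ext: "A \<subseteq> extensional (X \<union> Y)" "B \<subseteq> extensional (X \<union> Y)"
    by (auto simp: A_def B_def phase_def even_homs_def all_homs_def)
  have "finite (X \<union> Y)" using finite_X finite_Y by simp
  from daykin[OF this finAB ext] have "card A * card B \<le> card JJ * card MM" by (simp add: JJ_def MM_def)
  then have D: "real (card A) * real (card B) \<le> real (card JJ) * real (card MM)"
    by (metis of_nat_le_iff of_nat_mult)
  have few: "real (card {x \<in> X. k x \<noteq> 0}) \<le> 2 * eps"
    if fg: "f \<in> A" "g \<in> B" and k: "\<And>x. f x = 0 \<Longrightarrow> g x = 0 \<Longrightarrow> k x = 0" for f g k :: "'a \<Rightarrow> int"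
  proof -
    have "card {x \<in> X. k x \<noteq> 0} \<le> card ({x \<in> X. f x \<noteq> 0} \<union> {x \<in> X. g x \<noteq> 0})"
      using finite_X k by (intro card_mono) auto
    also have "\<dots> \<le> card {x \<in> X. f x \<noteq> 0} + card {x \<in> X. g x \<noteq> 0}" by (rule card_Un_le)
    finally show ?thesis using fg by (simp add: A_def B_def phase_def)
  qed
  have JJs: "JJ \<subseteq> phase (2 * eps) \<inter> above (U \<union> U')"
  proof
    fix k assume "k \<in> JJ"
    then obtain f g where fg: "f \<in> A" "g \<in> B" "k = (\<lambda>v. max (f v) (g v))" by (auto simp: JJ_def)
    have "k \<in> even_homs X Y nb" using join_meet(1) fg by (auto simp: A_def B_def phase_def)
    moreover have "real (card {x \<in> X. k x \<noteq> 0}) \<le> 2 * eps" using fg by (intro few[of f g]) auto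
    moreover have "k \<in> above (U \<union> U')" using fg by (auto simp: A_def B_def above_def max_def)
    ultimately show "k \<in> phase (2 * eps) \<inter> above (U \<union> U')" by (simp add: phase_def)
  qed
  have MMs: "MM \<subseteq> phase (2 * eps)"
  proof
    fix k assume "k \<in> MM"
    then obtain f g where fg: "f \<in> A" "g \<in> B" "k = (\<lambda>v. min (f v) (g v))" by (auto simp: MM_def)
    have "k \<in> even_homs X Y nb" using join_meet(2) fg by (auto simp: A_def B_def phase_def)
    moreover have "real (card {x \<in> X. k x \<noteq> 0}) \<le> 2 * eps" using fg by (intro few[of f g]) auto
    ultimately show "k \<in> phase (2 * eps)" by (simp add: phase_def)
  qed
  have "card JJ \<le> card ((phase eps \<inter> above (U \<union> U')) \<union> (phase (2 * eps) - phase eps))"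
    using JJs fin2 by (intro card_mono) auto
  also have "\<dots> \<le> card (phase eps \<inter> above (U \<union> U')) + card (phase (2 * eps) - phase eps)" by (rule card_Un_le)
  finally have J': "real (card JJ) \<le> real (card (phase eps \<inter> above (U \<union> U'))) + real (card (phase (2 * eps) - phase eps))"
    by linarith
  have "card MM \<le> card (phase (2 * eps))" using MMs fin2 by (intro card_mono)
  then have M': "real (card MM) \<le> Z" using assms by linarith
  have "real (card JJ) * real (card MM) \<le>
    (real (card (phase eps \<inter> above (U \<union> U'))) + real (card (phase (2 * eps) - phase eps))) * Z"
    using J' M' by (intro mult_mono) auto
  then show ?thesis using D by (simp add: A_def B_def)
qed

text \<open>With p the normalised count for one vertex and \<rho> that of the phase gap,
  supermultiplicativity gives p ^ |U| - |U| \<rho> \<le> q U by induction; each factor adds an error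
  of at most \<rho> because p \<le> 1. For a spread set of s vertices \<open>amp\<close> bounds the
  right side by the s-th power of the claim, and an s-th root finishes.\<close>

lemma above_single:
  assumes Z: "real (card (phase (2 * eps))) \<le> Z" "2 powr real N \<le> Z" and u: "u \<in> Y"
  shows "real (card (phase eps \<inter> above {u})) \<le> Z * 2 powr (- (4 * real d))"
proof -
  define q where "q = (\<lambda>U. real (card (phase eps \<inter> above U)) / Z)"
  define \<rho> where "\<rho> = real (card (phase (2 * eps) - phase eps)) / Z"
  define p where "p = q {u}"
  have Zpos: "Z > 0" using Z(2) by (smt (verit) powr_gt_zero)
  have \<rho>0: "\<rho> \<ge> 0" using Zpos by (simp add: \<rho>_def)
  have p0: "p \<ge> 0" using Zpos by (simp add: p_def q_def)
  have fin: "finite (phase eps)" "finite (phase (2 * eps))" using finite_phase eps_N eps_pos by auto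
  have "phase eps \<inter> above {u} \<subseteq> phase (2 * eps)" using eps_pos by (auto simp: phase_def)
  then have "card (phase eps \<inter> above {u}) \<le> card (phase (2 * eps))" using fin by (intro card_mono)
  then have "real (card (phase eps \<inter> above {u})) \<le> Z" using Z(1) by linarith
  then have p1: "p \<le> 1" using Zpos by (simp add: p_def q_def)
  have pu: "q {v} = p" if "v \<in> Y" for v
    using card_above_le[OF that u] card_above_le[OF u that] by (simp add: p_def q_def)
  have super: "q U * q U' \<le> q (U \<union> U') + \<rho>" for U U'
  proof -
    have "q U * q U' * (Z * Z) \<le> (q (U \<union> U') + \<rho>) * (Z * Z)"
      using above_supermult[OF Z(1), of U U'] Zpos by (simp add: q_def \<rho>_def algebra_simps)
    then show ?thesis using Zpos by (simp add: mult_le_cancel_right)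
  qed
  have ind: "p ^ card U - real (card U) * \<rho> \<le> q U" if "finite U" "U \<noteq> {}" "U \<subseteq> Y" for U
    using that
  proof (induction U rule: finite_ne_induct)
    case (singleton v)
    then show ?case using pu[of v] \<rho>0 by simp
  next
    case (insert v U)
    have "p * (p ^ card U - real (card U) * \<rho>) \<le> p * q U" using insert p0 by (intro mult_left_mono) auto
    also have "\<dots> = q {v} * q U" using pu insert by simp
    also have "\<dots> \<le> q (insert v U) + \<rho>" using super[of "{v}" U] by simp
    finally have "p ^ Suc (card U) - p * (real (card U) * \<rho>) \<le> q (insert v U) + \<rho>" by (simp add: algebra_simps)
    moreover have "p * (real (card U) * \<rho>) \<le> 1 * (real (card U) * \<rho>)" using p1 \<rho>0 by (intro mult_right_mono) auto
    ultimately show ?case using insert by (simp add: algebra_simps)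
  qed
  obtain S where S: "S \<subseteq> Y" "card S = s" "real s * (real d * (real d - 1)) \<le> real (card (Nb (Nb S)))"
    using spread_exists[OF room] by auto
  have "finite S" "S \<noteq> {}" using S s1 finite_sub by auto
  from ind[OF this S(1)] have "p ^ s \<le> q S + real s * \<rho>" using S by simp
  also have "\<dots> \<le> \<tau> ^ 2 * 2 powr (- (\<gamma> * (real s * (real d - 1) * real jj / 2) / 2))
     + real s * (2 * (\<tau> ^ 2 * 2 powr (- (\<gamma> * (t1 * real jj) / 2))))"
  proof (intro add_mono mult_left_mono)
    have *: "real n / Z \<le> c * 2 powr (- b)" if "real n \<le> c * 2 powr (real N - b)" "c \<ge> 0" for n c b
    proof -
      have "2 powr (real N - b) = 2 powr real N * 2 powr (- b)" using powr_shift[of 1 "real N" b] by simp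
      then have "real n \<le> c * 2 powr (- b) * 2 powr real N" using that(1) by (metis mult.assoc mult.commute)
      also have "\<dots> \<le> c * 2 powr (- b) * Z" using Z(2) that(2) by (intro mult_left_mono) auto
      finally show ?thesis using Zpos by (simp add: pos_divide_le_eq)
    qed
    show "q S \<le> \<tau> ^ 2 * 2 powr (- (\<gamma> * (real s * (real d - 1) * real jj / 2) / 2))"
      unfolding q_def by (rule *[OF above_bound[OF S(1,3)]]) auto
    show "\<rho> \<le> 2 * (\<tau> ^ 2 * 2 powr (- (\<gamma> * (t1 * real jj) / 2)))"
      unfolding \<rho>_def using *[of "card (phase (2 * eps) - phase eps)" "2 * \<tau> ^ 2" "\<gamma> * (t1 * real jj) / 2"] phase_gap by simp
  qed auto
  also have "\<dots> = Mfac ^ (2 * (2 * J + 5)) * (2 powr (- (\<gamma> * (real s * (real d - 1) * real jj / 2) / 2))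
      + 2 * real s * 2 powr (- (\<gamma> * (t1 * real jj) / 2)))"
  proof -
    have "Mfac ^ (2 * (2 * J + 5)) = \<tau> ^ 2" unfolding \<tau>_def by (metis power_mult mult.commute)
    then show ?thesis by (simp only: distrib_left mult.assoc mult.left_commute)
  qed
  also have "\<dots> \<le> 2 powr (- (4 * real d * real s))" by (rule amp)
  also have "\<dots> = (2 powr (- (4 * real d))) ^ s" by (simp add: powr_realpow[symmetric] powr_powr)
  finally have "p \<le> 2 powr (- (4 * real d))"
    using s1 power_strict_mono[of "2 powr (- (4 * real d))" p s] by (smt (verit) One_nat_def Suc_le_eq powr_ge_zero)
  then show ?thesis using Zpos by (simp add: p_def q_def pos_divide_le_eq mult.commute)
qed

section \<open>Typical rooted homomorphisms have a phase\<close>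

definition normal :: "'a \<Rightarrow> ('a \<Rightarrow> int) \<Rightarrow> 'a \<Rightarrow> int" where
  "normal v0 g = (\<lambda>v\<in>X \<union> Y. g v - g v0)"

lemma normal_hom:
  assumes g: "g \<in> all_homs X Y nb" and v0: "v0 \<in> X \<union> Y"
  shows "normal v0 g \<in> all_homs X Y nb" "normal v0 g v0 = 0"
proof -
  have "\<bar>normal v0 g x - normal v0 g y\<bar> = 1" if "x \<in> X" "y \<in> nb x" for x y
    using that all_homs_adj[OF g that] nb_X by (auto simp: normal_def)
  then show "normal v0 g \<in> all_homs X Y nb" by (auto simp: all_homs_def normal_def)
  show "normal v0 g v0 = 0" using v0 by (simp add: normal_def)
qed

lemma finite_rooted:
  assumes "v0 \<in> X \<union> Y"
  shows "finite {h \<in> all_homs X Y nb. h v0 = 0}"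
proof (rule finite_subset[OF _ finite_bounded_extensional[of "X \<union> Y" "int J"]])
  show "{h \<in> all_homs X Y nb. h v0 = 0} \<subseteq> {h \<in> extensional (X \<union> Y). \<forall>v\<in>X \<union> Y. \<bar>h v\<bar> \<le> int J}"
    using bounded[OF _ _ assms] by (force simp: all_homs_def)
qed (use finite_X finite_Y in auto)

text \<open>Since 4 eps < N, two members of the doubled phase vanish at a common vertex of
  \<open>X\<close>. This fixes the relative shift, so moving the root value to 0 loses
  nothing.\<close>

lemma card_phase_le:
  assumes v0: "v0 \<in> X \<union> Y"
  shows "card (phase (2 * eps)) \<le> card {h \<in> all_homs X Y nb. h v0 = 0}"
proof (rule card_inj_on_le[OF _ _ finite_rooted[OF v0]])
  show "normal v0 ` phase (2 * eps) \<subseteq> {h \<in> all_homs X Y nb. h v0 = 0}"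
    using normal_hom[OF _ v0] by (auto simp: phase_def even_homs_def)
  show "inj_on (normal v0) (phase (2 * eps))"
  proof (rule inj_onI)
    fix f g assume fg: "f \<in> phase (2 * eps)" "g \<in> phase (2 * eps)" and eq: "normal v0 f = normal v0 g"
    have ext: "f \<in> extensional (X \<union> Y)" "g \<in> extensional (X \<union> Y)"
      using fg by (auto simp: phase_def even_homs_def all_homs_def)
    have "\<exists>x\<in>X. f x = 0 \<and> g x = 0"
    proof (rule ccontr)
      assume "\<not> ?thesis"
      then have "X \<subseteq> {x \<in> X. f x \<noteq> 0} \<union> {x \<in> X. g x \<noteq> 0}" by auto
      then have "card X \<le> card ({x \<in> X. f x \<noteq> 0} \<union> {x \<in> X. g x \<noteq> 0})"
        using finite_X by (intro card_mono) auto
      also have "\<dots> \<le> card {x \<in> X. f x \<noteq> 0} + card {x \<in> X. g x \<noteq> 0}" by (rule card_Un_le)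
      finally have "real N \<le> 2 * eps + 2 * eps" using fg card_X by (simp add: phase_def)
      then show False using eps_N by linarith
    qed
    then obtain x where x: "x \<in> X" "f x = 0" "g x = 0" by auto
    have d: "f v - f v0 = g v - g v0" if "v \<in> X \<union> Y" for v
      using fun_cong[OF eq, of v] that by (simp add: normal_def)
    have "f v0 = g v0" using d[of x] x by simp
    then show "f = g" using d by (intro extensionalityI[OF ext]) simp
  qed
qed

lemma card_rooted_ge:
  assumes v0: "v0 \<in> X"
  shows "2 powr real N \<le> real (card {h \<in> all_homs X Y nb. h v0 = 0})"
proof -
  define F where "F = (\<lambda>B. \<lambda>v\<in>X \<union> Y. if v \<in> X then 0 else if v \<in> B then 1 else (-1::int))"
  have "card (Pow Y) \<le> card {h \<in> all_homs X Y nb. h v0 = 0}"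
  proof (rule card_inj_on_le[of F])
    show "inj_on F (Pow Y)"
    proof (rule inj_onI)
      fix A B assume AB: "A \<in> Pow Y" "B \<in> Pow Y" and eq: "F A = F B"
      have "y \<in> A \<longleftrightarrow> y \<in> B" if "y \<in> Y" for y
      proof -
        have "y \<notin> X" using that disj by auto
        then show ?thesis using fun_cong[OF eq, of y] that by (auto simp: F_def split: if_splits)
      qed
      then show "A = B" using AB by auto
    qed
    show "F ` Pow Y \<subseteq> {h \<in> all_homs X Y nb. h v0 = 0}"
    proof
      fix h assume "h \<in> F ` Pow Y"
      then obtain B where h: "h = F B" by auto
      have "\<bar>h x - h y\<bar> = 1" if "x \<in> X" "y \<in> nb x" for x y
      proof -
        have "y \<in> Y" "y \<notin> X" using that nb_X disj by auto
        then show ?thesis using that by (simp add: h F_def)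
      qed
      then show "h \<in> {h \<in> all_homs X Y nb. h v0 = 0}" using v0 by (auto simp: all_homs_def h F_def)
    qed
  qed (use finite_rooted v0 in auto)
  then have "real (2 ^ N) \<le> real (card {h \<in> all_homs X Y nb. h v0 = 0})"
    using finite_Y card_Y by (simp only: card_Pow of_nat_le_iff)
  then show ?thesis by (simp add: powr_realpow)
qed

text \<open>A neighbour of level k has value \<ge> k - 1, and on \<open>Y\<close> the value k is
  excluded by parity. So a value other than k - 1 occurs only outside N(A) or inside the next level
  set B. The former set has at most d t1 elements by assumption; so has B, because its defect is
  small and its neighbourhood is not nearly everything.\<close>

lemma phase_step:
  assumes h: "h \<in> all_homs X Y nb" and par: "\<And>y. y \<in> Y \<Longrightarrow> h y \<noteq> k"
    and A: "real N - real (card (Nb {x \<in> X. k \<le> h x})) \<le> real d * t1"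
    and B: "\<not> real N - real (card (Nb {y \<in> Y. k + 1 \<le> h y})) \<le> real d * t1"
    and db: "real (bireg.defect Y nb {y \<in> Y. k + 1 \<le> h y}) < t1"
  shows "real (card {y \<in> Y. h y \<noteq> k - 1}) \<le> eps"
proof -
  interpret sw: hom_graph Y X nb d N \<theta> \<psi> \<gamma> L t0 J jj s t1 by (rule swap_hom)
  define A' where "A' = {x \<in> X. k \<le> h x}"
  define B' where "B' = {y \<in> Y. k + 1 \<le> h y}"
  have sub: "A' \<subseteq> X" "B' \<subseteq> Y" by (auto simp: A'_def B'_def)
  have "y \<in> (Y - Nb A') \<union> B'" if y: "y \<in> Y" "h y \<noteq> k - 1" for y
  proof (cases "y \<in> Nb A'")
    case True
    then obtain x where "x \<in> X" "k \<le> h x" "y \<in> nb x" by (auto simp: nbhd_def A'_def)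
    then have "k - 1 \<le> h y" using all_homs_adj[OF h, of x y] by auto
    then have "k + 1 \<le> h y" using y par[OF y(1)] by linarith
    then show ?thesis using y by (simp add: B'_def)
  qed (use y in auto)
  then have "card {y \<in> Y. h y \<noteq> k - 1} \<le> card ((Y - Nb A') \<union> B')"
    using finite_Y sub finite_sub by (intro card_mono) auto
  also have "\<dots> \<le> card (Y - Nb A') + card B'" by (rule card_Un_le)
  finally have 1: "real (card {y \<in> Y. h y \<noteq> k - 1}) \<le> real (card (Y - Nb A')) + real (card B')" by linarith
  have "real (card (Y - Nb A')) = real N - real (card (Nb A'))"
    using card_Diff_subset[OF finite_Nb[OF sub(1)] Nb_subset[OF sub(1)]] card_Nb_le_N[OF sub(1)] card_Y
    by (simp add: of_nat_diff)
  then have 2: "real (card (Y - Nb A')) \<le> real d * t1" using A by (simp add: A'_def)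
  have "min (real (card (sw.cl B'))) (real N - real (card (Nb B'))) \<le> real d * real (sw.defect B')"
    using iso_Y[OF sw.cl_subset, of B'] sw.Nb_cl[OF sub(2)] sw.real_defect[OF sub(2)] by simp
  also have "\<dots> \<le> real d * t1" using db by (intro mult_left_mono) (auto simp: B'_def)
  finally have "real (card (sw.cl B')) \<le> real d * t1" using B by (simp add: B'_def min_def split: if_splits)
  moreover have "card B' \<le> card (sw.cl B')"
    using sw.subset_cl[OF sub(2)] finite_subset[OF sw.cl_subset finite_Y] by (intro card_mono)
  ultimately show ?thesis using 1 2 by (simp add: eps_def)
qed

text \<open>A discrete intermediate value argument: the level set at - J has full neighbourhood and
  the one at J + 1 is empty, so at some k in between the neighbourhood ceases to be nearly
  everything.\<close>

lemma phase_exists: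
  assumes h: "h \<in> even_homs X Y nb" and hb: "\<And>v. v \<in> X \<union> Y \<Longrightarrow> \<bar>h v\<bar> \<le> int J"
    and even: "\<And>k. even k \<Longrightarrow> \<bar>k\<bar> \<le> int J + 2 \<Longrightarrow> real (defect {x \<in> X. k \<le> h x}) < t1"
    and odd: "\<And>k. odd k \<Longrightarrow> \<bar>k\<bar> \<le> int J + 2 \<Longrightarrow> real (bireg.defect Y nb {y \<in> Y. k \<le> h y}) < t1"
  shows "(\<exists>c. even c \<and> real (card {x \<in> X. h x \<noteq> c}) \<le> eps) \<or> (\<exists>c. odd c \<and> real (card {y \<in> Y. h y \<noteq> c}) \<le> eps)"
proof -
  interpret sw: hom_graph Y X nb d N \<theta> \<psi> \<gamma> L t0 J jj s t1 by (rule swap_hom)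
  \<comment> \<open>Level k is cut on the side whose values have the parity of k.\<close>
  define A where "A = (\<lambda>k. {v \<in> (if even k then X else Y). k \<le> h v})"
  define P where "P = (\<lambda>k. real N - real (card (Nb (A k))) \<le> real d * t1)"
  have hh: "h \<in> all_homs X Y nb" "\<And>x. x \<in> X \<Longrightarrow> even (h x)" "\<And>y. y \<in> Y \<Longrightarrow> odd (h y)"
    using h by (auto simp: even_homs_def)
  have full: "Nb X = Y" "Nb Y = X"
  proof -
    have "nb v \<noteq> {}" if "v \<in> X \<union> Y" for v using that deg_X deg_Y d_pos by (metis Un_iff card.empty less_numeral_extra(3))
    then have "\<exists>x\<in>X. y \<in> nb x" if "y \<in> Y" for y using that nb_sym nb_Y by (metis UnCI ex_in_conv subsetD)
    moreover have "\<exists>y\<in>Y. x \<in> nb y" if "x \<in> X" for x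
      using that nb_sym nb_X \<open>\<And>v. v \<in> X \<union> Y \<Longrightarrow> nb v \<noteq> {}\<close> by (metis UnCI ex_in_conv subsetD)
    ultimately show "Nb X = Y" "Nb Y = X" using nb_X nb_Y unfolding nbhd_def by blast+
  qed
  have lo: "P (- int J)"
  proof -
    have "A (- int J) = (if even (- int J) then X else Y)"
      using hb by (force simp: A_def abs_le_iff)
    then have "card (Nb (A (- int J))) = N" using full card_X card_Y by simp
    then show ?thesis using t1_pos by (simp add: P_def)
  qed
  have hi: "\<not> P (int J + 1)"
  proof -
    have "A (int J + 1) = {}" using hb by (force simp: A_def abs_le_iff split: if_splits)
    then have "card (Nb (A (int J + 1))) = 0" by (simp add: nbhd_def)
    moreover have "real d * t1 < real N" using eps_N eps_pos by (simp add: eps_def)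
    ultimately show ?thesis by (simp add: P_def)
  qed
  have "\<exists>k. - int J \<le> k \<and> k \<le> int J \<and> P k \<and> \<not> P (k + 1)"
  proof (rule ccontr)
    assume neg: "\<not> ?thesis"
    have "k \<le> int J + 1 \<longrightarrow> P k" if "- int J \<le> k" for k
      using that
    proof (induction k rule: int_ge_induct)
      case (step i)
      then show ?case using neg by auto
    qed (use lo in auto)
    then show False using hi by auto
  qed
  then obtain k where k: "- int J \<le> k" "k \<le> int J" "P k" "\<not> P (k + 1)" by auto
  show ?thesis
  proof (cases "even k")
    case True
    then have "real (card {y \<in> Y. h y \<noteq> k - 1}) \<le> eps"
      using k odd[of "k + 1"] hh(3) by (intro phase_step[OF hh(1)]) (auto simp: P_def A_def)
    then show ?thesis using True by (intro disjI2 exI[of _ "k - 1"]) auto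
  next
    case False
    have "h \<in> all_homs Y X nb" using hh(1) all_homs_swap by simp
    then have "real (card {x \<in> X. h x \<noteq> k - 1}) \<le> sw.eps"
      using k False even[of "k + 1"] hh(2) by (intro sw.phase_step) (auto simp: P_def A_def)
    then show ?thesis using False by (intro disjI1 exI[of _ "k - 1"]) (auto simp: eps_def sw.eps_def)
  qed
qed

text \<open>If the values on \<open>Y\<close> were all c - 1 or c + 1, each vertex of
  \<open>X\<close> would stay within distance 2 of c and the range would be at most 5. By parity the
  first escape is to distance 3; \<open>neg\<close> reduces the downward case to the upward
  one.\<close>

lemma escape_cover:
  assumes v0: "v0 \<in> X \<union> Y" and h: "h \<in> all_homs X Y nb" "h v0 = 0"
    and c: "\<And>x. x \<in> X \<Longrightarrow> even (h x - c)" "\<And>y. y \<in> Y \<Longrightarrow> odd (h y - c)" "real (card {x \<in> X. h x \<noteq> c}) \<le> eps"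
    and range: "card (h ` (X \<union> Y)) \<ge> 6"
  shows "h \<in> (\<Union>u\<in>Y. normal v0 ` (phase eps \<inter> above {u})) \<union> (\<Union>u\<in>Y. (normal v0 \<circ> neg) ` (phase eps \<inter> above {u}))"
proof -
  define g where "g = (\<lambda>v\<in>X \<union> Y. h v - c)"
  have "\<bar>g x - g y\<bar> = 1" if "x \<in> X" "y \<in> nb x" for x y
    using all_homs_adj[OF h(1) that] that nb_X by (auto simp: g_def)
  then have ge: "g \<in> even_homs X Y nb" using c by (auto simp: even_homs_def all_homs_def g_def)
  have "{x \<in> X. g x \<noteq> 0} = {x \<in> X. h x \<noteq> c}" by (auto simp: g_def)
  then have gp: "g \<in> phase eps" using ge c(3) by (simp add: phase_def)
  have ng: "normal v0 g = h"
    by (rule extensionalityI[of _ "X \<union> Y"]) (use h v0 in \<open>auto simp: normal_def g_def all_homs_def\<close>)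
  have "\<exists>y\<in>Y. 3 \<le> g y \<or> g y \<le> -3"
  proof (rule ccontr)
    assume neg: "\<not> ?thesis"
    have gy: "\<bar>h y - c\<bar> = 1" if "y \<in> Y" for y
    proof -
      have "\<bar>h y - c\<bar> < 3" "odd (h y - c)" using neg that c by (auto simp: g_def)
      then show ?thesis by presburger
    qed
    have "h ` (X \<union> Y) \<subseteq> {c - 2..c + 2}"
    proof
      fix i assume "i \<in> h ` (X \<union> Y)"
      then obtain v where v: "v \<in> X \<union> Y" "i = h v" by auto
      show "i \<in> {c - 2..c + 2}"
      proof (cases "v \<in> X")
        case True
        then have "card (nb v) > 0" using deg_X d_pos by simp
        then obtain y where "y \<in> nb v" by (metis card_gt_0_iff ex_in_conv)
        then have "\<bar>h v - h y\<bar> = 1" "y \<in> Y" using all_homs_adj[OF h(1) True] nb_X True by auto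
        then show ?thesis using gy[of y] v by auto
      next
        case False
        then show ?thesis using gy[of v] v by auto
      qed
    qed
    then have "card (h ` (X \<union> Y)) \<le> card {c - 2..c + 2}" by (intro card_mono) auto
    then show False using range by simp
  qed
  then obtain y where y: "y \<in> Y" "3 \<le> g y \<or> g y \<le> -3" by auto
  show ?thesis
  proof (cases "3 \<le> g y")
    case True
    then have "g \<in> phase eps \<inter> above {y}" using gp by (simp add: above_def)
    then show ?thesis using ng y(1) by blast
  next
    case False
    then have "neg g \<in> phase eps \<inter> above {y}" using y neg_phase[OF gp] by (simp add: above_def neg_def)
    moreover have "(normal v0 \<circ> neg) (neg g) = h" using neg_neg[OF ge] ng by simp
    ultimately show ?thesis using y(1) by (metis (no_types, lifting) UN_I UnI2 image_eqI)
  qed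
qed

lemma card_escape_le:
  assumes v0: "v0 \<in> X \<union> Y" and Z: "2 powr real N \<le> Z" "Z = real (card {h \<in> all_homs X Y nb. h v0 = 0})"
  shows "real (card ((\<Union>u\<in>Y. normal v0 ` (phase eps \<inter> above {u})) \<union> (\<Union>u\<in>Y. (normal v0 \<circ> neg) ` (phase eps \<inter> above {u}))))
    \<le> 2 * real N * (Z * 2 powr (- (4 * real d)))" (is "real (card (?A \<union> ?B)) \<le> _")
    "finite ((\<Union>u\<in>Y. normal v0 ` (phase eps \<inter> above {u})) \<union> (\<Union>u\<in>Y. (normal v0 \<circ> neg) ` (phase eps \<inter> above {u})))"
proof -
  have fin: "finite (phase eps)" using finite_phase eps_N eps_pos by auto
  have Z1: "real (card (phase (2 * eps))) \<le> Z" using card_phase_le[OF v0] Z by simp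
  have "real (card ?A) \<le> real (card Y) * (Z * 2 powr (- (4 * real d)))"
    using fin finite_Y above_single[OF Z1 Z(1)] by (intro card_image_UN_le) auto
  moreover have "real (card ?B) \<le> real (card Y) * (Z * 2 powr (- (4 * real d)))"
    using fin finite_Y above_single[OF Z1 Z(1)] by (intro card_image_UN_le) auto
  moreover have "card (?A \<union> ?B) \<le> card ?A + card ?B" by (rule card_Un_le)
  ultimately show "real (card (?A \<union> ?B)) \<le> 2 * real N * (Z * 2 powr (- (4 * real d)))" by (simp add: card_Y)
  show "finite (?A \<union> ?B)" using fin finite_Y by auto
qed

text \<open>The shift by k - 2 turns the level set at k into \<open>high\<close>, and J + |k - 2|
  \<le> 2 J + 4 keeps the shifted map within the cap of \<open>levels\<close>.\<close>

lemma card_bad_level: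
  assumes k: "\<bar>k\<bar> \<le> int J + 2" and v0: "v0 \<in> X \<union> Y"
    and H: "\<And>h. h \<in> H \<Longrightarrow> h \<in> all_homs X Y nb \<and> h v0 = 0 \<and> (\<forall>x\<in>X. even (h x - k)) \<and> (\<forall>y\<in>Y. odd (h y - k))"
  shows "real (card {h \<in> H. t1 \<le> real (defect {x \<in> X. k \<le> h x})}) \<le> \<tau> ^ 2 * 2 powr (real N - \<gamma> * t1 / 2)"
proof -
  define K where "K = {h \<in> even_homs X Y nb. (\<forall>v\<in>X \<union> Y. \<bar>h v\<bar> \<le> int (2 * J + 4)) \<and> t1 \<le> real (defect (high X h))}"
  define sh where "sh = (\<lambda>h::'a \<Rightarrow> int. \<lambda>v\<in>X \<union> Y. h v - (k - 2))"
  have "card {h \<in> H. t1 \<le> real (defect {x \<in> X. k \<le> h x})} \<le> card K"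
  proof (rule card_inj_on_le[of sh])
    show "inj_on sh {h \<in> H. t1 \<le> real (defect {x \<in> X. k \<le> h x})}"
    proof (rule inj_onI)
      fix f g assume fg: "f \<in> {h \<in> H. t1 \<le> real (defect {x \<in> X. k \<le> h x})}"
        "g \<in> {h \<in> H. t1 \<le> real (defect {x \<in> X. k \<le> h x})}" and eq: "sh f = sh g"
      have ext: "f \<in> extensional (X \<union> Y)" "g \<in> extensional (X \<union> Y)"
        using fg H by (auto simp: all_homs_def)
      show "f = g"
      proof (rule extensionalityI[OF ext])
        fix v assume "v \<in> X \<union> Y"
        then show "f v = g v" using fun_cong[OF eq, of v] by (simp add: sh_def)
      qed
    qed
    show "sh ` {h \<in> H. t1 \<le> real (defect {x \<in> X. k \<le> h x})} \<subseteq> K"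
    proof
      fix g assume "g \<in> sh ` {h \<in> H. t1 \<le> real (defect {x \<in> X. k \<le> h x})}"
      then obtain h where g: "g = sh h" and h: "h \<in> H" "t1 \<le> real (defect {x \<in> X. k \<le> h x})" by auto
      have hh: "h \<in> all_homs X Y nb" "h v0 = 0" "\<And>x. x \<in> X \<Longrightarrow> even (h x - k)" "\<And>y. y \<in> Y \<Longrightarrow> odd (h y - k)"
        using H[OF h(1)] by auto
      have "\<bar>g x - g y\<bar> = 1" if "x \<in> X" "y \<in> nb x" for x y
        using all_homs_adj[OF hh(1) that] that nb_X by (auto simp: g sh_def)
      moreover have "even (g x)" if "x \<in> X" for x using hh(3)[OF that] that by (auto simp: g sh_def)
      moreover have "odd (g y)" if "y \<in> Y" for y using hh(4)[OF that] that by (auto simp: g sh_def)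
      ultimately have "g \<in> even_homs X Y nb" by (auto simp: even_homs_def all_homs_def g sh_def)
      moreover have "\<bar>g v\<bar> \<le> int (2 * J + 4)" if "v \<in> X \<union> Y" for v
        using bounded[OF hh(1) that v0] hh(2) k that by (simp add: g sh_def)
      moreover have "high X g = {x \<in> X. k \<le> h x}" by (auto simp: high_def g sh_def)
      ultimately show "g \<in> K" using h(2) by (simp add: K_def)
    qed
    show "finite K" using finite_capped by (simp add: K_def)
  qed
  then show ?thesis using levels[OF t01] by (simp add: K_def)
qed

theorem card_wide_le:
  assumes v0: "v0 \<in> X" and par: "\<And>h. h \<in> all_homs X Y nb \<Longrightarrow> h v0 = 0 \<Longrightarrow> h \<in> even_homs X Y nb"
    and Z: "Z = real (card {h \<in> all_homs X Y nb. h v0 = 0})"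
  shows "real (card {h \<in> all_homs X Y nb. h v0 = 0 \<and> 6 \<le> card (h ` (X \<union> Y))})
    \<le> Z * (real (2 * J + 5) * (\<tau> ^ 2 * 2 powr (- (\<gamma> * t1 / 2))) + 4 * real N * 2 powr (- (4 * real d)))"
proof -
  interpret sw: hom_graph Y X nb d N \<theta> \<psi> \<gamma> L t0 J jj s t1 by (rule swap_hom)
  define H where "H = {h \<in> all_homs X Y nb. h v0 = 0}"
  have v0': "v0 \<in> X \<union> Y" "v0 \<in> Y \<union> X" using v0 by auto
  have finH: "finite H" using finite_rooted v0 by (simp add: H_def)
  have Z2: "2 powr real N \<le> Z" using card_rooted_ge[OF v0] Z by simp
  have Z': "Z = real (card {h \<in> all_homs Y X nb. h v0 = 0})" using Z by (simp add: all_homs_swap)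
  have Hpar: "h \<in> all_homs X Y nb" "h v0 = 0" "\<And>x. x \<in> X \<Longrightarrow> even (h x)" "\<And>y. y \<in> Y \<Longrightarrow> odd (h y)" if "h \<in> H" for h
    using that par[of h] by (auto simp: H_def even_homs_def)
  define KX where "KX = (\<Union>u\<in>Y. normal v0 ` (phase eps \<inter> above {u})) \<union> (\<Union>u\<in>Y. (normal v0 \<circ> neg) ` (phase eps \<inter> above {u}))"
  define KY where "KY = (\<Union>u\<in>X. sw.normal v0 ` (sw.phase sw.eps \<inter> sw.above {u})) \<union> (\<Union>u\<in>X. (sw.normal v0 \<circ> sw.neg) ` (sw.phase sw.eps \<inter> sw.above {u}))"
  have cKX: "real (card KX) \<le> 2 * real N * (Z * 2 powr (- (4 * real d)))" "finite KX"
    using card_escape_le[OF v0'(1) Z2 Z] by (simp_all add: KX_def)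
  have cKY: "real (card KY) \<le> 2 * real N * (Z * 2 powr (- (4 * real d)))" "finite KY"
    using sw.card_escape_le[OF v0'(2) Z2 Z'] by (simp_all add: KY_def)
  define Bad where "Bad = (\<lambda>k::int. if even k then {h \<in> H. t1 \<le> real (defect {x \<in> X. k \<le> h x})}
    else {h \<in> H. t1 \<le> real (sw.defect {y \<in> Y. k \<le> h y})})"
  define I where "I = {- (int J + 2)..int J + 2}"
  have finI: "finite I" "card I = 2 * J + 5" by (auto simp: I_def)
  have cBad: "real (card (Bad k)) \<le> Z * (\<tau> ^ 2 * 2 powr (- (\<gamma> * t1 / 2)))" if k: "k \<in> I" for k
  proof -
    have kb: "\<bar>k\<bar> \<le> int J + 2" using k by (auto simp: I_def)
    have "real (card (Bad k)) \<le> \<tau> ^ 2 * 2 powr (real N - \<gamma> * t1 / 2)"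
    proof (cases "even k")
      case True
      then show ?thesis using card_bad_level[OF kb v0'(1), of H] Hpar by (simp add: Bad_def)
    next
      case False
      have "h \<in> all_homs Y X nb \<and> h v0 = 0 \<and> (\<forall>y\<in>Y. even (h y - k)) \<and> (\<forall>x\<in>X. odd (h x - k))" if "h \<in> H" for h
        using Hpar[OF that] False by (auto simp: all_homs_swap)
      then show ?thesis using sw.card_bad_level[OF kb v0'(2), of H] False
        by (simp add: Bad_def \<tau>_def sw.\<tau>_def)
    qed
    also have "\<dots> = \<tau> ^ 2 * 2 powr (- (\<gamma> * t1 / 2)) * 2 powr real N"
      using powr_shift[of 1 "real N" "\<gamma> * t1 / 2"] by (simp add: mult.commute)
    also have "\<dots> \<le> \<tau> ^ 2 * 2 powr (- (\<gamma> * t1 / 2)) * Z" using Z2 by (intro mult_left_mono) auto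
    finally show ?thesis by (simp add: mult.commute)
  qed
  have finBad: "finite (Bad k)" for k using finH by (simp add: Bad_def)
  have "{h \<in> H. 6 \<le> card (h ` (X \<union> Y))} \<subseteq> (\<Union>k\<in>I. Bad k) \<union> (KX \<union> KY)"
  proof
    fix h assume "h \<in> {h \<in> H. 6 \<le> card (h ` (X \<union> Y))}"
    then have h: "h \<in> H" "6 \<le> card (h ` (X \<union> Y))" by auto
    note hp = Hpar[OF h(1)]
    show "h \<in> (\<Union>k\<in>I. Bad k) \<union> (KX \<union> KY)"
    proof (cases "h \<in> (\<Union>k\<in>I. Bad k)")
      case False
      then have nb: "h \<notin> Bad k" if "\<bar>k\<bar> \<le> int J + 2" for k
        using that by (auto simp: I_def abs_le_iff)
      have "(\<exists>c. even c \<and> real (card {x \<in> X. h x \<noteq> c}) \<le> eps) \<or> (\<exists>c. odd c \<and> real (card {y \<in> Y. h y \<noteq> c}) \<le> eps)"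
      proof (rule phase_exists)
        show "h \<in> even_homs X Y nb" using par hp by auto
        show "\<bar>h v\<bar> \<le> int J" if "v \<in> X \<union> Y" for v using bounded[OF hp(1) that v0'(1)] hp(2) by simp
        show "real (defect {x \<in> X. k \<le> h x}) < t1" if "even k" "\<bar>k\<bar> \<le> int J + 2" for k
          using nb[OF that(2)] that h(1) by (simp add: Bad_def not_le)
        show "real (sw.defect {y \<in> Y. k \<le> h y}) < t1" if "odd k" "\<bar>k\<bar> \<le> int J + 2" for k
          using nb[OF that(2)] that h(1) by (simp add: Bad_def not_le)
      qed
      then show ?thesis
      proof (elim disjE exE conjE)
        fix c :: int assume c: "even c" "real (card {x \<in> X. h x \<noteq> c}) \<le> eps"
        have "h \<in> KX" unfolding KX_def
          using hp c h by (intro escape_cover[OF v0'(1), of _ c]) auto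
        then show ?thesis by simp
      next
        fix c :: int assume c: "odd c" "real (card {y \<in> Y. h y \<noteq> c}) \<le> eps"
        have "h \<in> KY" unfolding KY_def
          using hp c h
          by (intro sw.escape_cover[OF v0'(2), of _ c]) (auto simp: all_homs_swap Un_commute eps_def sw.eps_def)
        then show ?thesis by simp
      qed
    qed simp
  qed
  then have "card {h \<in> H. 6 \<le> card (h ` (X \<union> Y))} \<le> card ((\<Union>k\<in>I. Bad k) \<union> (KX \<union> KY))"
    using finI finBad cKX cKY by (intro card_mono) auto
  also have "\<dots> \<le> card (\<Union>k\<in>I. Bad k) + (card KX + card KY)"
    by (rule order_trans[OF card_Un_le add_left_mono[OF card_Un_le]])
  finally have "real (card {h \<in> H. 6 \<le> card (h ` (X \<union> Y))}) \<le> real (card (\<Union>k\<in>I. Bad k)) + (real (card KX) + real (card KY))"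
    by linarith
  also have "real (card (\<Union>k\<in>I. Bad k)) \<le> real (card I) * (Z * (\<tau> ^ 2 * 2 powr (- (\<gamma> * t1 / 2))))"
    using card_image_UN_le[of I Bad "Z * (\<tau> ^ 2 * 2 powr (- (\<gamma> * t1 / 2)))" "\<lambda>x. x"] finI finBad cBad by simp
  finally have "real (card {h \<in> H. 6 \<le> card (h ` (X \<union> Y))}) \<le> real (2 * J + 5) * (Z * (\<tau> ^ 2 * 2 powr (- (\<gamma> * t1 / 2))))
    + (2 * real N * (Z * 2 powr (- (4 * real d))) + 2 * real N * (Z * 2 powr (- (4 * real d))))"
    using cKX(1) cKY(1) unfolding finI(2) by linarith
  then show ?thesis by (simp add: H_def algebra_simps)
qed

end

section \<open>The middle layers as set systems\<close>

definition lay :: "nat \<Rightarrow> nat \<Rightarrow> nat set set" where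
  "lay n k = {A. A \<subseteq> {..<n} \<and> card A = k}"

text \<open>Bit vectors are replaced by their supports, to which Kruskal--Katona applies. Strict
  inclusion in either direction gives one neighbourhood function for both layers.\<close>

locale mid =
  fixes d n N :: nat and X Y :: "nat set set" and nb :: "nat set \<Rightarrow> nat set set"
  assumes d1: "d \<ge> 1"
  defines "n \<equiv> 2 * d - 1" and "N \<equiv> n choose d" and "X \<equiv> lay n (d - 1)" and "Y \<equiv> lay n d"
    and "nb \<equiv> \<lambda>A. {B \<in> X \<union> Y. A \<subset> B \<or> B \<subset> A}"
begin

section \<open>Degrees and codegrees\<close>

lemma n_eq: "n = d + (d - 1)" using d1 by (simp add: n_def)

lemma XD: "A \<in> X \<Longrightarrow> A \<subseteq> {..<n}" "A \<in> X \<Longrightarrow> finite A" "A \<in> X \<Longrightarrow> card A = d - 1"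
  by (auto simp: X_def lay_def intro: finite_subset)

lemma YD: "A \<in> Y \<Longrightarrow> A \<subseteq> {..<n}" "A \<in> Y \<Longrightarrow> finite A" "A \<in> Y \<Longrightarrow> card A = d"
  by (auto simp: Y_def lay_def intro: finite_subset)

lemma nb_X_eq: "A \<in> X \<Longrightarrow> nb A = {B \<in> Y. A \<subseteq> B}"
proof -
  assume A: "A \<in> X"
  have no: "\<not> A \<subset> B" "\<not> B \<subset> A" if "B \<in> X" for B
    using psubset_card_mono[of B A] psubset_card_mono[of A B] XD[OF A] XD[OF that] by auto
  have "\<not> B \<subseteq> A" if "B \<in> Y" for B using card_mono[of A B] XD[OF A] YD[OF that] d1 by fastforce
  then show ?thesis using no by (auto simp: nb_def)
qed

lemma nb_Y_eq: "B \<in> Y \<Longrightarrow> nb B = {A \<in> X. A \<subseteq> B}"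
proof -
  assume B: "B \<in> Y"
  have no: "\<not> A \<subset> B" "\<not> B \<subset> A" if "A \<in> Y" for A
    using psubset_card_mono[of B A] psubset_card_mono[of A B] YD[OF B] YD[OF that] by auto
  have "\<not> B \<subseteq> A" if "A \<in> X" for A using card_mono[of A B] YD[OF B] XD[OF that] d1 by fastforce
  then show ?thesis using no by (auto simp: nb_def)
qed

lemma nb_X_img: "A \<in> X \<Longrightarrow> nb A = (\<lambda>i. insert i A) ` ({..<n} - A)"
proof
  assume A: "A \<in> X"
  show "nb A \<subseteq> (\<lambda>i. insert i A) ` ({..<n} - A)"
  proof
    fix B assume "B \<in> nb A"
    then have B: "B \<in> Y" "A \<subseteq> B" using nb_X_eq[OF A] by auto
    have "card (B - A) = 1" using card_Diff_subset[of A B] B XD[OF A] YD[OF B(1)] d1 by auto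
    then obtain i where "B - A = {i}" by (auto simp: card_1_singleton_iff)
    then have "B = insert i A" "i \<in> {..<n} - A" using B YD[OF B(1)] by auto
    then show "B \<in> (\<lambda>i. insert i A) ` ({..<n} - A)" by blast
  qed
  show "(\<lambda>i. insert i A) ` ({..<n} - A) \<subseteq> nb A"
  proof
    fix B assume "B \<in> (\<lambda>i. insert i A) ` ({..<n} - A)"
    then obtain i where i: "i \<in> {..<n} - A" "B = insert i A" by auto
    then have "B \<in> Y" using XD[OF A] d1 by (auto simp: Y_def lay_def)
    then show "B \<in> nb A" using i nb_X_eq[OF A] by auto
  qed
qed

lemma nb_Y_img: "B \<in> Y \<Longrightarrow> nb B = (\<lambda>i. B - {i}) ` B"
proof
  assume B: "B \<in> Y"
  show "nb B \<subseteq> (\<lambda>i. B - {i}) ` B"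
  proof
    fix A assume "A \<in> nb B"
    then have A: "A \<in> X" "A \<subseteq> B" using nb_Y_eq[OF B] by auto
    have "card (B - A) = 1" using card_Diff_subset[of A B] A XD[OF A(1)] YD[OF B] d1 by auto
    then obtain i where "B - A = {i}" by (auto simp: card_1_singleton_iff)
    then have "A = B - {i}" "i \<in> B" using A by auto
    then show "A \<in> (\<lambda>i. B - {i}) ` B" by blast
  qed
  show "(\<lambda>i. B - {i}) ` B \<subseteq> nb B"
  proof
    fix A assume "A \<in> (\<lambda>i. B - {i}) ` B"
    then obtain i where i: "i \<in> B" "A = B - {i}" by auto
    then have "A \<in> X" using YD[OF B] by (auto simp: X_def lay_def)
    then show "A \<in> nb B" using i nb_Y_eq[OF B] by auto
  qed
qed

lemma finXY: "finite X" "finite Y" "X \<inter> Y = {}" "card X = N" "card Y = N"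
proof -
  show "finite X" "finite Y" by (auto simp: X_def Y_def lay_def)
  show "X \<inter> Y = {}" using d1 by (auto simp: X_def Y_def lay_def)
  show "card Y = N" by (simp add: Y_def lay_def n_subsets N_def)
  have "card X = n choose (d - 1)" by (simp add: X_def lay_def n_subsets)
  then show "card X = N" using binomial_symmetric[of d n] d1 by (simp add: N_def n_def)
qed

lemma deg_X: "A \<in> X \<Longrightarrow> card (nb A) = d"
proof -
  assume A: "A \<in> X"
  have "inj_on (\<lambda>i. insert i A) ({..<n} - A)" by (intro inj_onI) blast
  then have "card (nb A) = card ({..<n} - A)" by (simp add: nb_X_img[OF A] card_image)
  also have "\<dots> = d" using XD[OF A] d1 by (simp add: card_Diff_subset n_eq)
  finally show ?thesis .
qed

lemma deg_Y: "B \<in> Y \<Longrightarrow> card (nb B) = d"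
proof -
  assume B: "B \<in> Y"
  have "inj_on (\<lambda>i. B - {i}) B" by (intro inj_onI) blast
  then show ?thesis using YD[OF B] by (simp add: nb_Y_img[OF B] card_image)
qed

lemma codeg_X: "A \<in> X \<Longrightarrow> A' \<in> X \<Longrightarrow> A \<noteq> A' \<Longrightarrow> card (nb A \<inter> nb A') \<le> 1"
proof -
  assume A: "A \<in> X" "A' \<in> X" "A \<noteq> A'"
  have "A \<subset> A \<union> A'" using card_subset_eq[of A A'] A XD by (metis Un_upper1 psubsetI sup.absorb_iff1)
  then have c: "card (A \<union> A') \<ge> d"
    using psubset_card_mono[of "A \<union> A'" A] XD[OF A(1)] XD[OF A(2)] by simp
  have "nb A \<inter> nb A' \<subseteq> {A \<union> A'}"
  proof
    fix B assume "B \<in> nb A \<inter> nb A'"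
    then have B: "B \<in> Y" "A \<union> A' \<subseteq> B" using nb_X_eq A by auto
    then have "A \<union> A' = B" using c YD[OF B(1)] card_mono[of B "A \<union> A'"] by (intro card_subset_eq) auto
    then show "B \<in> {A \<union> A'}" by simp
  qed
  then show ?thesis using card_mono[of "{A \<union> A'}"] by fastforce
qed

lemma codeg_Y: "B \<in> Y \<Longrightarrow> B' \<in> Y \<Longrightarrow> B \<noteq> B' \<Longrightarrow> card (nb B \<inter> nb B') \<le> 1"
proof -
  assume B: "B \<in> Y" "B' \<in> Y" "B \<noteq> B'"
  have "B \<inter> B' \<subset> B" using card_subset_eq[of B' B] B YD by (metis Int_lower1 inf.absorb_iff1 psubsetI)
  then have c: "card (B \<inter> B') \<le> d - 1"
    using psubset_card_mono[of B "B \<inter> B'"] YD[OF B(1)] by simp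
  have "nb B \<inter> nb B' \<subseteq> {B \<inter> B'}"
  proof
    fix A assume "A \<in> nb B \<inter> nb B'"
    then have A: "A \<in> X" "A \<subseteq> B \<inter> B'" using nb_Y_eq B by auto
    then have "A = B \<inter> B'"
      using c XD[OF A(1)] YD[OF B(1)] card_mono[of "B \<inter> B'" A] by (intro card_subset_eq) auto
    then show "A \<in> {B \<inter> B'}" by simp
  qed
  then show ?thesis using card_mono[of "{B \<inter> B'}"] by fastforce
qed

lemma nb_sym: "A \<in> X \<Longrightarrow> B \<in> Y \<Longrightarrow> B \<in> nb A \<longleftrightarrow> A \<in> nb B"
  using nb_X_eq nb_Y_eq by auto

section \<open>Isoperimetry from the Kruskal--Katona theorem\<close>

lemma Nb_shadow: "\<A> \<subseteq> Y \<Longrightarrow> nbhd nb \<A> = shadow \<A>"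
proof -
  assume A: "\<A> \<subseteq> Y"
  have "nbhd nb \<A> = (\<Union>B\<in>\<A>. (\<lambda>i. B - {i}) ` B)" using A nb_Y_img by (force simp: nbhd_def)
  then show ?thesis by (auto simp: shadow_def)
qed

lemma kk_Y:
  assumes A: "\<A> \<subseteq> Y" "card \<A> \<le> m choose d" "d \<le> m"
  shows "d * card \<A> \<le> (m + 1 - d) * card (nbhd nb \<A>)"
proof -
  have "finite s \<and> card s = d" if "s \<in> \<A>" for s using YD(2,3) A(1) that by blast
  then show ?thesis unfolding Nb_shadow[OF A(1)]
    using kruskal_katona[OF finite_subset[OF A(1) finXY(2)] _ d1 A(2,3)] by blast
qed

definition co :: "nat set \<Rightarrow> nat set" where "co A = {..<n} - A"

lemma card_co: "A \<subseteq> {..<n} \<Longrightarrow> card (co A) = n - card A"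
  unfolding co_def using finite_subset[of A "{..<n}"] by (simp add: card_Diff_subset)

lemma co_X: "A \<in> X \<Longrightarrow> co A \<in> Y"
  using card_co[OF XD(1)] XD(3)[of A] d1 by (simp add: Y_def lay_def n_eq co_def)

lemma co_co: "A \<in> X \<union> Y \<Longrightarrow> co (co A) = A"
  using XD(1)[of A] YD(1)[of A] by (auto simp: co_def)

lemma inj_co: "inj_on co (X \<union> Y)"
  using co_co by (intro inj_onI) metis

text \<open>Complementation in the ground set exchanges the two layers and turns upper shadows into
  lower ones.\<close>

lemma kk_X:
  assumes A: "\<A> \<subseteq> X" "card \<A> \<le> m choose d" "d \<le> m"
  shows "d * card \<A> \<le> (m + 1 - d) * card (nbhd nb \<A>)"
proof -
  have sub: "co ` \<A> \<subseteq> Y" using A co_X by auto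
  have c: "card (co ` \<A>) = card \<A>" using A inj_co by (intro card_image) (auto simp: inj_on_def)
  have "nbhd nb (co ` \<A>) \<subseteq> co ` nbhd nb \<A>"
  proof
    fix C assume "C \<in> nbhd nb (co ` \<A>)"
    then obtain A where C: "A \<in> \<A>" "C \<in> nb (co A)" by (auto simp: nbhd_def)
    have AX: "A \<in> X" using C assms by auto
    have C2: "C \<in> X" "C \<subseteq> co A" using C nb_Y_eq co_X[OF AX] by auto
    have "A \<subseteq> co C" using C2 XD[OF AX] by (auto simp: co_def)
    then have "co C \<in> nb A" using nb_X_eq[OF AX] co_X C2 by auto
    moreover have "C = co (co C)" using co_co C2 by simp
    ultimately show "C \<in> co ` nbhd nb \<A>" using C by (auto simp: nbhd_def)
  qed
  moreover have "finite (nbhd nb \<A>)"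
    using A finXY(2) nb_X_eq by (intro finite_subset[OF _ finXY(2)]) (auto simp: nbhd_def)
  ultimately have "card (nbhd nb (co ` \<A>)) \<le> card (nbhd nb \<A>)"
    using surj_card_le by blast
  then have "(m + 1 - d) * card (nbhd nb (co ` \<A>)) \<le> (m + 1 - d) * card (nbhd nb \<A>)" by simp
  moreover have "d * card (co ` \<A>) \<le> (m + 1 - d) * card (nbhd nb (co ` \<A>))"
    using sub A c by (intro kk_Y) auto
  ultimately show ?thesis using c by (metis le_trans)
qed

text \<open>Up to size M = (2 d - 2 choose d), Kruskal--Katona with m = 2 d - 2 yields d |A| \<le>
  (d - 1) |N(A)|, hence |A| \<le> d (|N(A)| - |A|). A larger set contains one of size exactly M, so
  |N(A)| \<ge> (2 d - 2 choose (d - 1)) = N - M. The complement of N(A) then has at most M elements,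
  and the first case applies to it, its own neighbourhood avoiding \<open>\<A>\<close>.\<close>

lemma iso_aux:
  assumes PQ: "(P = X \<and> Q = Y) \<or> (P = Y \<and> Q = X)" and A: "\<A> \<subseteq> P" and d2: "d \<ge> 2"
  shows "min (real (card \<A>)) (real N - real (card (nbhd nb \<A>))) \<le> real d * (real (card (nbhd nb \<A>)) - real (card \<A>))"
proof -
  define M where "M = (2 * d - 2) choose d"
  have kkP: "d * card \<B> \<le> (d - 1) * card (nbhd nb \<B>)" if "\<B> \<subseteq> P" "card \<B> \<le> M" for \<B>
  proof -
    have "d * card \<B> \<le> (2 * d - 2 + 1 - d) * card (nbhd nb \<B>)"
      using PQ that d2 kk_X[of \<B> "2 * d - 2"] kk_Y[of \<B> "2 * d - 2"] by (auto simp: M_def)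
    moreover have "2 * d - 2 + 1 - d = d - 1" using d2 by simp
    ultimately show ?thesis by (simp only:)
  qed
  have kkQ: "d * card \<B> \<le> (d - 1) * card (nbhd nb \<B>)" if "\<B> \<subseteq> Q" "card \<B> \<le> M" for \<B>
  proof -
    have "d * card \<B> \<le> (2 * d - 2 + 1 - d) * card (nbhd nb \<B>)"
      using PQ that d2 kk_X[of \<B> "2 * d - 2"] kk_Y[of \<B> "2 * d - 2"] by (auto simp: M_def)
    moreover have "2 * d - 2 + 1 - d = d - 1" using d2 by simp
    ultimately show ?thesis by (simp only:)
  qed
  have small: "real a \<le> real d * (real b - real a)" if "d * a \<le> (d - 1) * b" for a b
  proof -
    have "real d * real a \<le> real (d - 1) * real b" using that by (metis of_nat_le_iff of_nat_mult)
    then have 1: "real d * real a \<le> (real d - 1) * real b" using d2 by (simp add: of_nat_diff)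
    then have "(real d - 1) * real a \<le> (real d - 1) * real b" by (simp add: algebra_simps)
    then have "real a \<le> real b" using d2 by simp
    then show ?thesis using 1 by (simp add: algebra_simps)
  qed
  have fin: "finite P" "finite Q" "card P = N" "card Q = N" using PQ finXY by auto
  have Nbsub: "nbhd nb \<A> \<subseteq> Q" using PQ A nb_X_eq nb_Y_eq by (auto simp: nbhd_def)
  have finNb: "finite (nbhd nb \<A>)" using Nbsub fin finite_subset by auto
  show ?thesis
  proof (cases "card \<A> \<le> M")
    case True
    then show ?thesis using small[OF kkP[OF A]] by linarith
  next
    case False
    then obtain \<B> where B: "\<B> \<subseteq> \<A>" "card \<B> = M" "finite \<B>"
      using obtain_subset_with_card_n[of M \<A>] by (metis nat_le_linear)
    have "d * M \<le> (d - 1) * card (nbhd nb \<B>)" using kkP[of \<B>] B A by auto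
    moreover have "d * M = (d - 1) * ((2 * d - 2) choose (d - 1))"
    proof -
      obtain e where e: "d = Suc e" using d1 by (cases d) auto
      have "Suc e * ((2 * e) choose Suc e) = (2 * e - e) * ((2 * e) choose e)"
        by (simp only: binomial_absorb_comp binomial_absorption)
      then show ?thesis by (simp add: e M_def)
    qed
    ultimately have "(2 * d - 2) choose (d - 1) \<le> card (nbhd nb \<B>)" using d2 by simp
    also have "\<dots> \<le> card (nbhd nb \<A>)" using B finNb by (intro card_mono) (auto simp: nbhd_def)
    finally have c: "(2 * d - 2) choose (d - 1) \<le> card (nbhd nb \<A>)" .
    have "N = ((2 * d - 2) choose (d - 1)) + M"
      using choose_reduce_nat[of n d] d2 by (simp add: N_def n_def M_def numeral_2_eq_2)
    then have small2: "N - card (nbhd nb \<A>) \<le> M" using c by simp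
    define \<D> where "\<D> = Q - nbhd nb \<A>"
    have cD: "card \<D> = N - card (nbhd nb \<A>)" using finNb Nbsub fin by (simp add: \<D>_def card_Diff_subset)
    have DQ: "\<D> \<subseteq> Q" by (auto simp: \<D>_def)
    have "nbhd nb \<D> \<subseteq> P - \<A>"
    proof
      fix v assume "v \<in> nbhd nb \<D>"
      then obtain w where w: "w \<in> Q" "w \<notin> nbhd nb \<A>" "v \<in> nb w" by (auto simp: \<D>_def nbhd_def)
      then have "v \<in> P" "w \<in> nb v" using PQ nb_X_eq nb_Y_eq by auto
      then show "v \<in> P - \<A>" using w by (auto simp: nbhd_def)
    qed
    then have "card (nbhd nb \<D>) \<le> card (P - \<A>)" using fin by (intro card_mono) auto
    also have "\<dots> = N - card \<A>" using A fin finite_subset[OF A] by (simp add: card_Diff_subset)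
    finally have le: "card (nbhd nb \<D>) \<le> N - card \<A>" .
    have AN: "card \<A> \<le> N" "card (nbhd nb \<A>) \<le> N" using card_mono[OF fin(1) A] card_mono[OF fin(2) Nbsub] fin by auto
    have "real (card \<D>) \<le> real d * (real (card (nbhd nb \<D>)) - real (card \<D>))"
      using small2 cD by (intro small kkQ DQ) simp
    also have "\<dots> \<le> real d * (real (N - card \<A>) - real (N - card (nbhd nb \<A>)))"
      using le cD by (intro mult_left_mono) auto
    also have "real (N - card \<A>) - real (N - card (nbhd nb \<A>)) = real (card (nbhd nb \<A>)) - real (card \<A>)"
      using AN by (simp add: of_nat_diff)
    finally show ?thesis using cD AN by (simp add: of_nat_diff)
  qed
qed

text \<open>Passing from (m + 1 choose d) to (m choose d) divides by (m + 1) / (m + 1 - d), which is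
  at most 3 as long as 2 (m + 1) \<ge> 3 d; this is where 2 j + 2 \<le> d enters.\<close>

lemma N_le_3pow: "2 * j + 2 \<le> d \<Longrightarrow> N \<le> 3 ^ j * ((n - j) choose d)"
proof (induction j)
  case (Suc j)
  define m where "m = n - Suc j"
  have m: "n - j = Suc m" "2 * Suc m \<ge> 3 * d" using Suc.prems by (auto simp: m_def n_def)
  have "(Suc m - d) * (Suc m choose d) = Suc m * (m choose d)" using binomial_absorb_comp[of "Suc m" d] by simp
  also have "\<dots> \<le> (3 * (Suc m - d)) * (m choose d)" using m by (intro mult_right_mono) auto
  finally have "(Suc m - d) * (Suc m choose d) \<le> (Suc m - d) * (3 * (m choose d))" by (simp only: ac_simps)
  moreover have "Suc m - d > 0" using m Suc.prems by simp
  ultimately have "Suc m choose d \<le> 3 * (m choose d)" by (simp only: mult_le_cancel1)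
  then have "3 ^ j * (Suc m choose d) \<le> 3 ^ j * (3 * (m choose d))" by simp
  moreover have "N \<le> 3 ^ j * (Suc m choose d)" using Suc m by simp
  ultimately have "N \<le> 3 ^ j * (3 * (m choose d))" by linarith
  then show ?case by (simp add: m_def ac_simps)
qed (simp add: N_def)

text \<open>Density at most 3 ^ (- j) permits Kruskal--Katona with m = n - j, whose ratio is (d - j)
  / d; the expansion thus grows linearly in j.\<close>

lemma isoj_aux:
  assumes A: "\<A> \<subseteq> X \<or> \<A> \<subseteq> Y" and j: "2 * j + 2 \<le> d" and c: "real (card \<A>) * 3 ^ j \<le> real N"
  shows "real j * real (card \<A>) \<le> real d * (real (card (nbhd nb \<A>)) - real (card \<A>))"
proof -
  have "real (card \<A> * 3 ^ j) \<le> real N" using c by simp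
  then have "card \<A> * 3 ^ j \<le> 3 ^ j * ((n - j) choose d)"
    using N_le_3pow[OF j] by (simp only: of_nat_le_iff)
  then have "card \<A> \<le> (n - j) choose d" by (simp add: mult.commute)
  then have "d * card \<A> \<le> (n - j + 1 - d) * card (nbhd nb \<A>)"
    using A j kk_X[of \<A> "n - j"] kk_Y[of \<A> "n - j"] by (auto simp: n_def)
  moreover have "n - j + 1 - d = d - j" using j by (simp add: n_def)
  ultimately have "real d * real (card \<A>) \<le> real (d - j) * real (card (nbhd nb \<A>))"
    by (metis of_nat_le_iff of_nat_mult)
  then have 1: "real d * real (card \<A>) \<le> (real d - real j) * real (card (nbhd nb \<A>))" using j by (simp add: of_nat_diff)
  then have "(real d - real j) * real (card \<A>) \<le> (real d - real j) * real (card (nbhd nb \<A>))"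
    by (rule order_trans[rotated]) (simp add: mult_right_mono)
  then have "real (card \<A>) \<le> real (card (nbhd nb \<A>))" using j by simp
  then have "real j * real (card \<A>) \<le> real j * real (card (nbhd nb \<A>))" by (rule mult_left_mono) simp
  then show ?thesis using 1 by (simp add: algebra_simps)
qed

section \<open>Variation, parity and symmetry\<close>

lemma hom_path:
  assumes h: "h \<in> all_homs X Y nb" and "A \<in> X" "A' \<in> X"
  shows "\<bar>h A - h A'\<bar> \<le> 2 * int (card (A - A')) \<and> even (h A - h A')"
  using assms(2,3)
proof (induction "card (A - A')" arbitrary: A rule: less_induct)
  case less
  show ?case
  proof (cases "A = A'")
    case False
    note A = XD[OF less.prems(1)] XD[OF less.prems(2)]
    have "\<not> A \<subseteq> A'" "\<not> A' \<subseteq> A" using card_subset_eq[of A A'] card_subset_eq[of A' A] A False by auto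
    \<comment> \<open>Two edges of the graph exchange an element j of \<open>A\<close> for an
      element i of \<open>A'\<close>. This changes the homomorphism by -2, 0 or 2 and brings
      \<open>A\<close> one element closer to \<open>A'\<close>.\<close>
    then obtain i j where ij: "j \<in> A" "j \<notin> A'" "i \<in> A'" "i \<notin> A" by auto
    define B where "B = insert i A"
    define C where "C = B - {j}"
    have B: "B \<in> nb A" using nb_X_img[OF less.prems(1)] ij A by (auto simp: B_def)
    then have BY: "B \<in> Y" using nb_X_eq less.prems by auto
    have C: "C \<in> nb B" using nb_Y_img[OF BY] ij by (auto simp: C_def B_def)
    then have CX: "C \<in> X" "B \<in> nb C" using nb_Y_eq[OF BY] nb_sym[OF _ BY] by auto
    have "C - A' = (A - A') - {j}" using ij by (auto simp: C_def B_def)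
    then have cc: "card (A - A') = Suc (card (C - A'))"
      using ij A by (simp add: card_Diff_singleton) (metis Diff_iff Suc_pred card_gt_0_iff empty_iff finite_Diff)
    have "\<bar>h C - h A'\<bar> \<le> 2 * int (card (C - A')) \<and> even (h C - h A')"
      using cc CX less.prems by (intro less.hyps) auto
    moreover have "\<bar>h A - h B\<bar> = 1" "\<bar>h C - h B\<bar> = 1"
      using all_homs_adj[OF h] less.prems(1) B CX by auto
    then have "h A - h C \<in> {-2, 0, 2}" by (auto simp: abs_if split: if_splits)
    ultimately show ?thesis using cc by auto presburger+
  qed simp
qed

lemma hom_parity:
  assumes h: "h \<in> all_homs X Y nb" "A0 \<in> X" "h A0 = 0"
  shows "h \<in> even_homs X Y nb"
proof -
  have e: "even (h A)" if "A \<in> X" for A using hom_path[OF h(1) that h(2)] h(3) by simp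
  have "odd (h B)" if B: "B \<in> Y" for B
  proof -
    have "nb B \<noteq> {}" using deg_Y[OF B] d1 by auto
    then obtain A where "A \<in> nb B" by auto
    then have A: "A \<in> X" "B \<in> nb A" using nb_Y_eq[OF B] nb_sym[OF _ B] by auto
    then show ?thesis using e[OF A(1)] all_homs_adj[OF h(1) A] by presburger
  qed
  then show ?thesis using e h by (simp add: even_homs_def)
qed

text \<open>At most 2 (d - 1) between two vertices of \<open>X\<close>, which differ by at most d -
  1 exchanges, and 1 more at either end when it lies in \<open>Y\<close>.\<close>

lemma hom_bounded:
  assumes h: "h \<in> all_homs X Y nb" and u: "u \<in> X \<union> Y" and v: "v \<in> X \<union> Y"
  shows "\<bar>h u - h v\<bar> \<le> int (2 * d)"
proof -
  have near: "\<exists>A\<in>X. \<bar>h w - h A\<bar> \<le> 1" if "w \<in> X \<union> Y" for w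
  proof (cases "w \<in> X")
    case False
    then have w: "w \<in> Y" using that by auto
    have "nb w \<noteq> {}" using deg_Y[OF w] d1 by auto
    then obtain A where "A \<in> nb w" by auto
    then have "A \<in> X" "w \<in> nb A" using nb_Y_eq[OF w] nb_sym[OF _ w] by auto
    then show ?thesis using all_homs_adj[OF h, of A w] by (intro bexI[of _ A]) auto
  next
    case True
    then show ?thesis by (intro bexI[of _ w]) auto
  qed
  obtain A B where AB: "A \<in> X" "\<bar>h u - h A\<bar> \<le> 1" "B \<in> X" "\<bar>h v - h B\<bar> \<le> 1" using near[OF u] near[OF v] by auto
  have "card (A - B) \<le> d - 1" using card_mono[of A "A - B"] XD[OF AB(1)] by auto
  then have "\<bar>h A - h B\<bar> \<le> 2 * int (d - 1)" using hom_path[OF h AB(1,3)] by linarith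
  then show ?thesis using AB d1 by (simp add: of_nat_diff)
qed

text \<open>A permutation of the ground set carrying u onto u' acts on both layers and preserves
  inclusion; it exists because u and u' have equal size and so have their complements.\<close>

lemma transitive:
  assumes "u \<subseteq> {..<n}" "u' \<subseteq> {..<n}" "card u = card u'"
  shows "\<exists>\<pi>. bij_betw \<pi> X X \<and> bij_betw \<pi> Y Y \<and> (\<forall>v\<in>X \<union> Y. nb (\<pi> v) = \<pi> ` nb v) \<and> \<pi> u = u'"
proof -
  have fin: "finite u" "finite u'" using assms finite_subset by auto
  obtain f where f: "bij_betw f u u'" using finite_same_card_bij[OF fin assms(3)] by auto
  have "card ({..<n} - u) = card ({..<n} - u')" using assms fin by (simp add: card_Diff_subset)
  then obtain g where g: "bij_betw g ({..<n} - u) ({..<n} - u')" 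
    using finite_same_card_bij[of "{..<n} - u" "{..<n} - u'"] by auto
  define \<sigma> where "\<sigma> = (\<lambda>i. if i \<in> u then f i else g i)"
  have "bij_betw \<sigma> u u'" using f by (subst bij_betw_cong[of u \<sigma> f]) (auto simp: \<sigma>_def)
  moreover have "bij_betw \<sigma> ({..<n} - u) ({..<n} - u')"
    using g by (subst bij_betw_cong[of _ \<sigma> g]) (auto simp: \<sigma>_def)
  ultimately have "bij_betw \<sigma> (u \<union> ({..<n} - u)) (u' \<union> ({..<n} - u'))" by (rule bij_betw_combine) auto
  then have \<sigma>: "bij_betw \<sigma> {..<n} {..<n}" using assms by (simp add: Un_absorb1)
  have \<sigma>u: "\<sigma> ` u = u'" using f by (auto simp: \<sigma>_def bij_betw_def)
  define \<pi> where "\<pi> = (\<lambda>A. \<sigma> ` A)"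
  have inj\<sigma>: "inj_on \<sigma> {..<n}" and im\<sigma>: "\<sigma> ` {..<n} = {..<n}" using \<sigma> by (auto simp: bij_betw_def)
  have sub: "\<pi> A \<subseteq> \<pi> B \<longleftrightarrow> A \<subseteq> B" if "A \<subseteq> {..<n}" "B \<subseteq> {..<n}" for A B
    using inj_on_image_subset_iff[OF inj\<sigma> that] by (simp add: \<pi>_def)
  have inj\<pi>: "inj_on \<pi> (X \<union> Y)"
  proof (rule inj_onI)
    fix A B assume AB: "A \<in> X \<union> Y" "B \<in> X \<union> Y" "\<pi> A = \<pi> B"
    then have "A \<subseteq> {..<n}" "B \<subseteq> {..<n}" using XD(1) YD(1) by blast+
    then show "A = B" using sub[of A B] sub[of B A] AB(3) by simp
  qed
  have card\<pi>: "card (\<pi> A) = card A" "\<pi> A \<subseteq> {..<n}" if "A \<subseteq> {..<n}" for A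
    using that card_image[OF inj_on_subset[OF inj\<sigma> that]] im\<sigma> by (auto simp: \<pi>_def)
  have into: "\<pi> ` X \<subseteq> X" "\<pi> ` Y \<subseteq> Y" using card\<pi> by (auto simp: X_def Y_def lay_def)
  have bX: "bij_betw \<pi> X X"
    using endo_inj_surj[OF finXY(1) into(1)] inj\<pi> by (auto simp: bij_betw_def inj_on_Un)
  have bY: "bij_betw \<pi> Y Y"
    using endo_inj_surj[OF finXY(2) into(2)] inj\<pi> by (auto simp: bij_betw_def inj_on_Un)
  have surj: "\<pi> ` (X \<union> Y) = X \<union> Y" using bX bY by (auto simp: bij_betw_def image_Un)
  have "nb (\<pi> v) = \<pi> ` nb v" if v: "v \<in> X \<union> Y" for v
  proof -
    have vn: "v \<subseteq> {..<n}" using v XD(1) YD(1) by blast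
    have ps: "\<pi> v \<subset> \<pi> B \<longleftrightarrow> v \<subset> B" "\<pi> B \<subset> \<pi> v \<longleftrightarrow> B \<subset> v" if "B \<in> X \<union> Y" for B
    proof -
      have "B \<subseteq> {..<n}" using that XD(1) YD(1) by blast
      then show "\<pi> v \<subset> \<pi> B \<longleftrightarrow> v \<subset> B" "\<pi> B \<subset> \<pi> v \<longleftrightarrow> B \<subset> v"
        using sub[OF vn] sub[OF _ vn] by (auto simp: less_le_not_le)
    qed
    show ?thesis
    proof
      show "nb (\<pi> v) \<subseteq> \<pi> ` nb v"
      proof
        fix C assume C: "C \<in> nb (\<pi> v)"
        then have "C \<in> \<pi> ` (X \<union> Y)" using surj by (simp add: nb_def)
        then obtain B where B: "B \<in> X \<union> Y" "C = \<pi> B" by auto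
        then have "B \<in> nb v" using C ps[OF B(1)] by (simp add: nb_def)
        then show "C \<in> \<pi> ` nb v" using B by auto
      qed
      show "\<pi> ` nb v \<subseteq> nb (\<pi> v)"
      proof
        fix C assume "C \<in> \<pi> ` nb v"
        then obtain B where B: "B \<in> nb v" "C = \<pi> B" by auto
        then have BV: "B \<in> X \<union> Y" by (simp add: nb_def)
        then have "C \<in> X \<union> Y" using B surj by auto
        then show "C \<in> nb (\<pi> v)" using B ps[OF BV] by (simp add: nb_def)
      qed
    qed
  qed
  then show ?thesis using bX bY \<sigma>u by (intro exI[of _ \<pi>]) (auto simp: \<pi>_def)
qed

lemma bireg_mid: "d \<ge> 2 \<Longrightarrow> bireg X Y nb d N"
proof
  assume d2: "d \<ge> 2"
  show "nb x \<subseteq> Y" if "x \<in> X" for x using nb_X_eq[OF that] by auto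
  show "nb y \<subseteq> X" if "y \<in> Y" for y using nb_Y_eq[OF that] by auto
  show "min (real (card A)) (real N - real (card (nbhd nb A))) \<le> real d * (real (card (nbhd nb A)) - real (card A))"
    if "A \<subseteq> X" for A using iso_aux[OF _ that d2] by blast
  show "min (real (card A)) (real N - real (card (nbhd nb A))) \<le> real d * (real (card (nbhd nb A)) - real (card A))"
    if "A \<subseteq> Y" for A using iso_aux[OF _ that d2] by blast
qed (use finXY deg_X deg_Y nb_sym codeg_X codeg_Y d1 in auto)

section \<open>Translation between bit vectors and sets\<close>

definition ones :: "(nat \<Rightarrow> nat) \<Rightarrow> nat set" where
  "ones v = {i \<in> {..<n}. v i = 1}"

lemma ones_bij: "bij_betw ones (verts (middle_layers_graph d)) (X \<union> Y)"
proof -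
  have vm: "verts (middle_layers_graph d) = {v \<in> cube_verts n. card (ones v) = d - 1 \<or> card (ones v) = d}"
    unfolding verts_mid by (auto simp: layer_def weight_def ones_def n_def)
  have inj: "inj_on ones (cube_verts n)"
  proof (rule inj_onI)
    fix u v assume uv: "u \<in> cube_verts n" "v \<in> cube_verts n" "ones u = ones v"
    show "u = v"
    proof
      fix i show "u i = v i"
      proof (cases "i < n")
        case True
        then have "u i \<in> {0, 1}" "v i \<in> {0, 1}" using uv by (auto simp: cube_verts_def PiE_iff)
        moreover have "u i = 1 \<longleftrightarrow> v i = 1" using uv(3) True by (auto simp: ones_def)
        ultimately show ?thesis by auto
      next
        case False
        then show ?thesis using uv by (auto simp: cube_verts_def PiE_iff extensional_def)
      qed
    qed
  qed
  have "X \<union> Y \<subseteq> ones ` verts (middle_layers_graph d)"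
  proof
    fix A assume A: "A \<in> X \<union> Y"
    define v where "v = (\<lambda>i\<in>{..<n}. if i \<in> A then 1 else (0::nat))"
    have "A \<subseteq> {..<n}" using A XD(1) YD(1) by blast
    then have "ones v = A" by (auto simp: ones_def v_def)
    moreover have "v \<in> cube_verts n" by (auto simp: v_def cube_verts_def)
    ultimately show "A \<in> ones ` verts (middle_layers_graph d)"
      using A XD(3) YD(3) unfolding vm by (intro image_eqI[of _ _ v]) auto
  qed
  moreover have "ones ` verts (middle_layers_graph d) \<subseteq> X \<union> Y"
    unfolding vm by (auto simp: X_def Y_def lay_def ones_def)
  moreover have "inj_on ones (verts (middle_layers_graph d))"
    using inj by (rule inj_on_subset) (auto simp: vm)
  ultimately show ?thesis by (auto simp: bij_betw_def)
qed

text \<open>The sizes differ by at most one, so a strict inclusion between supports means exactly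
  one differing coordinate; conversely a one-element symmetric difference leaves one of the two
  differences empty.\<close>

lemma edge_ones:
  assumes uv: "u \<in> verts (middle_layers_graph d)" "v \<in> verts (middle_layers_graph d)"
  shows "{u, v} \<in> edges (middle_layers_graph d) \<longleftrightarrow> ones v \<in> nb (ones u)"
proof -
  have mem: "ones u \<in> X \<union> Y" "ones v \<in> X \<union> Y" using ones_bij uv by (auto simp: bij_betw_def)
  have cube: "u \<in> cube_verts n" "v \<in> cube_verts n" using uv by (auto simp: verts_mid layer_def n_def)
  have "{i \<in> {..<n}. u i \<noteq> v i} = (ones u - ones v) \<union> (ones v - ones u)"
  proof -
    have "u i \<in> {0, 1} \<and> v i \<in> {0, 1}" if "i < n" for i using cube that by (auto simp: cube_verts_def PiE_iff)
    then show ?thesis by (fastforce simp: ones_def)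
  qed
  then have "{u, v} \<in> edges (middle_layers_graph d) \<longleftrightarrow> card ((ones u - ones v) \<union> (ones v - ones u)) = 1"
    using uv edge_mid_iff[of u v d] by (simp add: n_def)
  also have "\<dots> \<longleftrightarrow> ones u \<subset> ones v \<or> ones v \<subset> ones u"
  proof
    assume "card ((ones u - ones v) \<union> (ones v - ones u)) = 1"
    then obtain i where i: "(ones u - ones v) \<union> (ones v - ones u) = {i}" by (auto simp: card_1_singleton_iff)
    have u: "j = i" if "j \<in> ones u" "j \<notin> ones v" for j
      using that unfolding singleton_iff[symmetric] i[symmetric] by simp
    have v: "j = i" if "j \<in> ones v" "j \<notin> ones u" for j
      using that unfolding singleton_iff[symmetric] i[symmetric] by simp
    have "i \<in> (ones u - ones v) \<union> (ones v - ones u)" unfolding i by simp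
    then show "ones u \<subset> ones v \<or> ones v \<subset> ones u" using u v by (auto simp: psubset_eq)
  next
    have one: "card (B - A) = 1" if "A \<subset> B" "A \<in> X \<union> Y" "B \<in> X \<union> Y" for A B
    proof -
      have fin: "finite A" "finite B" using that XD(2) YD(2) by blast+
      have cs: "card A = d - 1 \<or> card A = d" "card B = d - 1 \<or> card B = d" using that XD(3) YD(3) by blast+
      have "card A < card B" using psubset_card_mono[OF fin(2) that(1)] .
      moreover have "card (B - A) = card B - card A" using card_Diff_subset[OF fin(1)] that by auto
      ultimately show ?thesis using cs d1 by auto
    qed
    assume "ones u \<subset> ones v \<or> ones v \<subset> ones u"
    then show "card ((ones u - ones v) \<union> (ones v - ones u)) = 1"
    proof
      assume s: "ones u \<subset> ones v"
      then have "(ones u - ones v) \<union> (ones v - ones u) = ones v - ones u" by auto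
      then show ?thesis using one[OF s mem] by simp
    next
      assume s: "ones v \<subset> ones u"
      then have "(ones u - ones v) \<union> (ones v - ones u) = ones u - ones v" by auto
      then show ?thesis using one[OF s mem(2,1)] by simp
    qed
  qed
  also have "\<dots> \<longleftrightarrow> ones v \<in> nb (ones u)" using mem by (auto simp: nb_def)
  finally show ?thesis .
qed

lemma Hom_transfer:
  assumes v0: "v0 \<in> layer n (d - 1)"
  defines "H \<equiv> {g \<in> all_homs X Y nb. g (ones v0) = 0}"
  shows "ones v0 \<in> X" "card (Hom_at (middle_layers_graph d) v0) = card H"
    "card {h \<in> Hom_at (middle_layers_graph d) v0. \<not> hom_range (middle_layers_graph d) h \<le> 5}
      \<le> card {g \<in> all_homs X Y nb. g (ones v0) = 0 \<and> 6 \<le> card (g ` (X \<union> Y))}"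
proof -
  define V where "V = verts (middle_layers_graph d)"
  have bij: "bij_betw ones V (X \<union> Y)" unfolding V_def by (rule ones_bij)
  have im: "ones ` V = X \<union> Y" and injV: "inj_on ones V" using bij unfolding bij_betw_def by simp_all
  have v0V: "v0 \<in> V" using v0 by (auto simp: V_def verts_mid n_def)
  show oX: "ones v0 \<in> X" using v0 by (auto simp: X_def lay_def layer_def weight_def ones_def)
  define \<Psi> where "\<Psi> = (\<lambda>g::nat set \<Rightarrow> int. \<lambda>v\<in>V. g (ones v))"
  have HomI: "\<Psi> g \<in> Hom_at (middle_layers_graph d) v0" if "g \<in> H" for g
  proof -
    have g: "g \<in> all_homs X Y nb" "g (ones v0) = 0" using that by (auto simp: H_def)
    have "\<bar>\<Psi> g u - \<Psi> g v\<bar> = 1" if e: "{u, v} \<in> edges (middle_layers_graph d)" for u v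
    proof -
      have uv: "u \<in> V" "v \<in> V" using e edge_mid_iff by (auto simp: V_def)
      then have adj: "ones v \<in> nb (ones u)" "ones u \<in> X \<union> Y" using e edge_ones im by (auto simp: V_def)
      have "\<bar>g (ones u) - g (ones v)\<bar> = 1"
      proof (cases "ones u \<in> X")
        case True
        then show ?thesis using all_homs_adj[OF g(1) True adj(1)] by simp
      next
        case False
        then have "ones u \<in> Y" using adj by auto
        then have "ones v \<in> X" "ones u \<in> nb (ones v)" using adj nb_Y_eq nb_sym by auto
        then show ?thesis using all_homs_adj[OF g(1), of "ones v" "ones u"] by simp
      qed
      then show ?thesis using uv by (simp add: \<Psi>_def)
    qed
    then show ?thesis using g v0V by (auto simp: Hom_at_def \<Psi>_def V_def)
  qed
  have inj: "inj_on \<Psi> H"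
  proof (rule inj_onI)
    fix f g assume fg: "f \<in> H" "g \<in> H" and eq: "\<Psi> f = \<Psi> g"
    have ext: "f \<in> extensional (X \<union> Y)" "g \<in> extensional (X \<union> Y)" using fg by (auto simp: H_def all_homs_def)
    show "f = g"
    proof (rule extensionalityI[OF ext])
      fix A assume "A \<in> X \<union> Y"
      then obtain v where "v \<in> V" "A = ones v" using im by blast
      then show "f A = g A" using fun_cong[OF eq, of v] by (simp add: \<Psi>_def)
    qed
  qed
  have surj: "\<exists>g\<in>H. h = \<Psi> g" if h: "h \<in> Hom_at (middle_layers_graph d) v0" for h
  proof -
    define g where "g = (\<lambda>A\<in>X \<union> Y. h (inv_into V ones A))"
    have gv: "g (ones v) = h v" if "v \<in> V" for v
      using that im inv_into_f_f[OF injV that] by (auto simp: g_def)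
    have "\<bar>g A - g B\<bar> = 1" if A: "A \<in> X" and B: "B \<in> nb A" for A B
    proof -
      have "A \<in> ones ` V" "B \<in> ones ` V" unfolding im using A B nb_X_eq by auto
      then obtain u v where uv: "u \<in> V" "v \<in> V" "A = ones u" "B = ones v" by (elim imageE)
      then have "{u, v} \<in> edges (middle_layers_graph d)" using edge_ones B by (auto simp: V_def)
      then have "\<bar>h u - h v\<bar> = 1" using h by (auto simp: Hom_at_def)
      then show ?thesis using gv uv by simp
    qed
    then have "g \<in> H" using gv[OF v0V] h by (auto simp: H_def all_homs_def g_def Hom_at_def)
    moreover have "h = \<Psi> g"
    proof (rule extensionalityI[of _ V])
      show "h \<in> extensional V" using h by (auto simp: Hom_at_def V_def PiE_def)
      show "\<Psi> g \<in> extensional V" by (simp add: \<Psi>_def)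
      show "h v = \<Psi> g v" if "v \<in> V" for v using gv[OF that] that by (simp add: \<Psi>_def)
    qed
    ultimately show ?thesis by blast
  qed
  have imH: "\<Psi> ` H = Hom_at (middle_layers_graph d) v0" using HomI surj by blast
  then show "card (Hom_at (middle_layers_graph d) v0) = card H" using card_image[OF inj] by metis
  have rng: "\<Psi> g ` V = g ` (X \<union> Y)" for g unfolding im[symmetric] by (force simp: \<Psi>_def image_image)
  define K where "K = {g \<in> all_homs X Y nb. g (ones v0) = 0 \<and> 6 \<le> card (g ` (X \<union> Y))}"
  have "finite H" using finite_imageD[OF _ inj] imH finite_Hom_at_mid[OF d1] v0 by (simp add: n_def)
  then have finK: "finite K" by (rule rev_finite_subset) (auto simp: K_def H_def)
  have "{h \<in> Hom_at (middle_layers_graph d) v0. \<not> hom_range (middle_layers_graph d) h \<le> 5} \<subseteq> \<Psi> ` K"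
  proof
    fix h assume h: "h \<in> {h \<in> Hom_at (middle_layers_graph d) v0. \<not> hom_range (middle_layers_graph d) h \<le> 5}"
    then obtain g where g: "g \<in> H" "h = \<Psi> g" using surj by auto
    have "6 \<le> card (h ` V)" using h by (simp add: hom_range_def V_def)
    then have "g \<in> K" using g rng by (simp add: K_def H_def)
    then show "h \<in> \<Psi> ` K" using g by auto
  qed
  then show "card {h \<in> Hom_at (middle_layers_graph d) v0. \<not> hom_range (middle_layers_graph d) h \<le> 5} \<le> card K"
    using surj_card_le[OF finK] by blast
qed

end

section \<open>Choice of parameters\<close>

text \<open>Here x is d, with L = x ^ (1/10), \<gamma> = x ^ (-1/20), \<theta> = x ^ (-3/10) and
  \<psi> = x ^ (7/10). Up to logarithms the encoding cost per unit of t is x ^ (-3/10), the common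
  order of ln x / x * \<theta> x and L / (\<theta> \<psi>), and so is the slope \<psi> / x. The
  saving \<gamma> has to dominate this, to tend to 0 faster than 1 / ln x for \<open>caseR\<close>,
  and to keep \<gamma> L unbounded for \<open>gjj\<close>; any exponent strictly between -1/10 and 0
  would do asymptotically.\<close>

definition large :: "real \<Rightarrow> bool" where
  "large x \<longleftrightarrow> x \<ge> 4 \<and> x powr (-3/10) \<le> 1/2 \<and> x powr (7/10) \<le> x / 2 \<and> x powr (-1/20) \<le> 1 \<and>
    6 * ln x / x \<le> 1 \<and> 4 / (x powr (-3/10) * x powr (7/10)) \<le> 1 \<and>
    exp 1 \<le> 2 powr (x powr (1/10) / 2) * (6 * ln x / x) \<and>
    exp 1 \<le> 2 powr (x powr (1/10) / 2) * (2 / x powr (7/10)) \<and>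
    6 * ln x / x * (x powr (1/10) + x powr (-3/10) * x * log 2 (exp 1 / x powr (-3/10)))
      + 4 / (x powr (-3/10) * x powr (7/10)) * x powr (1/10) + 2 / x powr (7/10) * x powr (1/10)
      \<le> x powr (-1/20) / 16 \<and>
    x powr (-1/20) * log 2 (2 * exp 1 * x ^ 2 / x powr (-1/20)) \<le> 1 / 4 \<and>
    4 * x powr (7/10) / x \<le> x powr (-1/20) / 4 \<and>
    4 * x * 2 powr (x powr (1/10) / 2) \<le> 2 powr x \<and>
    4 * x + 4 \<le> x powr (-1/20) * 2 powr x / 16 \<and>
    x \<le> 2 powr (x powr (1/10) / 2) \<and> 16 \<le> x powr (1/10) \<and> x powr (1/10) / 4 + 2 \<le> x \<and>
    4 * x ^ 2 \<le> 2 powr (x powr (1/10) / 20) \<and> 2 * x ^ 2 \<le> 2 powr (x powr (1/10) / 4) \<and>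
    (8 * x + 10) * (x powr (1/10) * x + 2) * (2 * x) \<le> 2 powr (x powr (1/10) / 4) \<and>
    48 \<le> x powr (-1/20) * (x powr (1/10) / 8 - 1) \<and> 1 / x \<le> x powr (-1/20) / 4"

lemma eventually_large: "eventually large at_top"
  unfolding large_def
  by (intro eventually_conj; real_asymp)

lemma powr2_sum_le:
  fixes a b c :: real
  assumes "a \<le> c - 1" "b \<le> c - 1"
  shows "2 powr a + 2 powr b \<le> 2 powr c"
proof -
  have "2 powr a + 2 powr b \<le> 2 powr (c - 1) + 2 powr (c - 1)" using assms by (intro add_mono powr_mono) auto
  also have "\<dots> = 2 powr c" by (simp add: powr_diff)
  finally show ?thesis .
qed

section \<open>Verification of the parameters\<close>

context mid begin

lemma N_bounds: "4 ^ d / (4 * real d) \<le> real N" "N \<le> 4 ^ d"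
proof -
  obtain e where e: "d = Suc e" using d1 by (cases d) auto
  have "(2 * d) choose d = 2 * N"
  proof -
    have "N = n choose e" using binomial_symmetric[of d n] by (simp add: N_def n_def e)
    then show ?thesis by (simp add: N_def n_def e)
  qed
  then have "4 ^ d / (2 * real d) \<le> 2 * real N" using central_binomial_lower_bound[of d] d1 by simp
  then show "4 ^ d / (4 * real d) \<le> real N" by (simp add: field_simps)
  have "N \<le> 2 ^ n" unfolding N_def by (rule binomial_le_pow2)
  also have "\<dots> \<le> 2 ^ (2 * d)" by (intro power_increasing) (auto simp: n_def)
  finally show "N \<le> 4 ^ d" by (simp add: power_mult)
qed

lemma real_N_le: "real N \<le> 4 ^ d"
  using N_bounds(2) by (metis of_nat_le_iff of_nat_numeral of_nat_power)

abbreviation "D \<equiv> real d"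
abbreviation "L \<equiv> D powr (1/10)"
abbreviation "\<gamma> \<equiv> D powr (-1/20)"
abbreviation "\<theta> \<equiv> D powr (-3/10)"
abbreviation "\<psi> \<equiv> D powr (7/10)"
text \<open>Naming a vertex in a set of size \<kappa> t0 costs log (e N / (\<kappa> t0)) = L / 2 +
  log (e / \<kappa>) bits; \<kappa> is only polynomially small, so \<open>L\<close> bits
  suffice.\<close>

abbreviation "t0 \<equiv> real N * 2 powr (- (L / 2))"
text \<open>The factor 2 ^ (L / 4) over \<open>t0\<close> beats every polynomial in d, while the
  density 2 ^ (- L / 4) is low enough for the strong expansion.\<close>

abbreviation "t1 \<equiv> real N * 2 powr (- (L / 4))"
text \<open>The choice L / 8 gives 3 ^ jj \<le> 2 ^ (L / 5), which stays below N / t1 = 2 ^ (L / 4)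
  with room for polynomial factors.\<close>

abbreviation "jj \<equiv> nat \<lfloor>L / 8\<rfloor>"
text \<open>Large enough that 2 ^ (d s) covers all powers of \<open>Mfac\<close>, small enough that
  the error from the phase gap is below 2 ^ (- 6 d s) and that the spread vertices fit into the
  graph.\<close>

abbreviation "s \<equiv> nat \<lfloor>t1 / D ^ 2\<rfloor>"

context
  assumes large: "large D"
begin

lemma D4: "D \<ge> 4" using large by (simp add: large_def)

lemma t0_ge: "2 powr D \<le> t0"
proof -
  have "2 powr D * (4 * D * 2 powr (L / 2)) \<le> 2 powr D * 2 powr D"
    using large by (intro mult_left_mono) (auto simp: large_def)
  also have "\<dots> = 4 ^ d" by (simp add: powr_add[symmetric] powr_realpow[symmetric] powr_powr[of 2 2, simplified, symmetric])
  finally have "2 powr D * 2 powr (L / 2) \<le> 4 ^ d / (4 * D)" using D4 by (simp add: field_simps)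
  also have "\<dots> \<le> real N" by (rule N_bounds)
  finally have "2 powr D * 2 powr (L / 2) * 2 powr (- (L / 2)) \<le> real N * 2 powr (- (L / 2))"
    by (intro mult_right_mono) auto
  then show ?thesis by (simp add: mult.assoc powr_add[symmetric])
qed

lemma t01: "t1 = t0 * 2 powr (L / 4)"
  by (simp add: mult.assoc powr_add[symmetric])

lemma t0_pos: "t0 \<ge> 1"
  using t0_ge ge_one_powr_ge_zero[of 2 D] by simp

lemma D_le_t0: "D \<le> t0"
proof -
  have "D < 2 ^ d" using of_nat_less_two_power[of d, where 'a = real] .
  moreover have "2 ^ d \<le> t0" using t0_ge by (simp add: powr_realpow)
  ultimately show ?thesis by linarith
qed

lemma num: "bireg_num X Y nb d N \<theta> \<psi> \<gamma> L t0"
proof (intro bireg_num.intro bireg_mid, unfold_locales)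
  have lg: "large D" by (rule large)
  show "2 \<le> d" "4 \<le> d" using D4 by auto
  show "t0 * ln D \<ge> D"
  proof -
    have "ln D \<ge> 1" using D4 ln_ge_iff[of D 1] exp_le by simp
    then show ?thesis using D_le_t0 t0_pos mult_left_mono[of 1 "ln D" t0] by linarith
  qed
  have half: "2 powr L * 2 powr (- (L / 2)) = 2 powr (L / 2)" by (simp add: powr_add[symmetric])
  have eN: "exp 1 * real N \<le> 2 powr L * (\<kappa> * t0)" if "exp 1 \<le> 2 powr (L / 2) * \<kappa>" for \<kappa>
  proof -
    have "exp 1 * real N \<le> 2 powr (L / 2) * \<kappa> * real N" using that by (intro mult_right_mono) auto
    then show ?thesis unfolding half[symmetric] by (simp add: algebra_simps)
  qed
  show "exp 1 * real N \<le> 2 powr L * (6 * ln D / D * t0)" using lg by (intro eN) (auto simp: large_def)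
  show "exp 1 * real N \<le> 2 powr L * (2 / \<psi> * t0)" using lg by (intro eN) (auto simp: large_def)
  show "4 * (real N + 1) ^ 2 \<le> 2 powr (\<gamma> * t0 / 16)"
  proof -
    have "real N + 1 \<le> 4 ^ d + 4 ^ d"
      using real_N_le one_le_power[of "4::real" d] by linarith
    then have "(real N + 1) ^ 2 \<le> (2 * 4 ^ d) ^ 2" by (intro power_mono) auto
    also have "\<dots> = 2 ^ (4 * d + 2)"
    proof -
      have "((4::real) ^ d) ^ 2 = (4 ^ 2) ^ d" by (metis power_mult mult.commute)
      then show ?thesis by (simp add: power_mult_distrib power_add power_mult)
    qed
    finally have "4 * (real N + 1) ^ 2 \<le> 2 ^ (4 * d + 4)" by (simp add: power_add)
    also have "\<dots> = 2 powr (4 * D + 4)" by (simp add: powr_realpow[symmetric])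
    also have "\<dots> \<le> 2 powr (\<gamma> * t0 / 16)"
    proof (intro powr_mono)
      have "4 * D + 4 \<le> \<gamma> * 2 powr D / 16" using lg by (simp add: large_def)
      also have "\<dots> \<le> \<gamma> * t0 / 16" using t0_ge by (intro divide_right_mono mult_left_mono) auto
      finally show "4 * D + 4 \<le> \<gamma> * t0 / 16" .
    qed auto
    finally show ?thesis .
  qed
qed (use large t0_pos D4 in \<open>auto simp: large_def\<close>)

lemma s_bounds: "t1 / (2 * D ^ 2) \<le> real s" "real s \<le> t1 / D ^ 2" "1 \<le> s"
proof -
  define z where "z = t1 / D ^ 2"
  have "2 * D ^ 2 \<le> 2 powr (L / 4)" using large by (simp add: large_def)
  also have "\<dots> \<le> t1" unfolding t01 using t0_pos mult_right_mono[of 1 t0 "2 powr (L / 4)"] by simp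
  finally have "D ^ 2 \<le> t1" using zero_le_power2[of D] by linarith
  then have z: "z \<ge> 1" using D4 by (simp add: z_def pos_le_divide_eq)
  have sz: "s = nat \<lfloor>z\<rfloor>" by (simp add: z_def)
  have s: "real s \<le> z" "z < real s + 1" using z unfolding sz by linarith+
  then show "real s \<le> t1 / D ^ 2" by (simp add: z_def)
  show s1: "1 \<le> s" unfolding sz using z by (simp add: le_nat_iff le_floor_iff)
  have "z / 2 \<le> real s" using s s1 by linarith
  then show "t1 / (2 * D ^ 2) \<le> real s" by (simp add: z_def)
qed

lemma jj_bounds: "L / 8 - 1 \<le> real jj" "real jj \<le> L / 8" "1 \<le> jj" "2 * jj + 2 \<le> d"
proof -
  have L: "16 \<le> L" "L / 4 + 2 \<le> D" using large by (auto simp: large_def)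
  show a: "L / 8 - 1 \<le> real jj" "real jj \<le> L / 8" using L by linarith+
  show "1 \<le> jj" using L a by linarith
  have "real (2 * jj + 2) \<le> D" using a L by simp
  then show "2 * jj + 2 \<le> d" by (simp only: of_nat_le_iff)
qed

text \<open>The logarithm of the left side is a polynomial in d times \<open>t0\<close>; the ratio
  t1 / t0 = 2 ^ (L / 4) absorbs the polynomial and leaves room for d s, which is at least t1 / (2
  d).\<close>

lemma Mfac_pow: "bireg_num.Mfac d L t0 ^ (2 * (2 * (2 * d) + 5)) \<le> 2 powr (D * real s)"
proof -
  interpret bireg_num X Y nb d N \<theta> \<psi> \<gamma> L t0 by (rule num)
  define c where "c = L * (D * t0)"
  have c0: "c \<ge> 0" using t0_pos by (simp add: c_def)
  have "1 \<le> 2 powr c" using c0 by (simp add: ge_one_powr_ge_zero)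
  then have "Mfac \<le> 4 * 2 powr c" unfolding Mfac_def c_def[symmetric] by linarith
  also have "\<dots> = 2 powr (c + 2)" by (simp add: powr_add)
  finally have M: "Mfac \<le> 2 powr (c + 2)" .
  have "Mfac ^ (2 * (2 * (2 * d) + 5)) \<le> (2 powr (c + 2)) ^ (2 * (2 * (2 * d) + 5))"
    using M Mfac_ge by (intro power_mono) auto
  also have "\<dots> = 2 powr ((c + 2) * real (2 * (2 * (2 * d) + 5)))" by (simp only: powr_realpow[symmetric] powr_powr powr_gt_zero zero_less_numeral)
  also have "\<dots> \<le> 2 powr (D * real s)"
  proof (intro powr_mono)
    have "(c + 2) * real (2 * (2 * (2 * d) + 5)) = (8 * D + 10) * (L * D * t0 + 2)" by (simp add: c_def algebra_simps)
    also have "\<dots> \<le> (8 * D + 10) * (L * D * t0 + 2 * t0)" using t0_pos D4 by (intro mult_left_mono) auto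
    also have "\<dots> = (8 * D + 10) * (L * D + 2) * t0" by (simp add: algebra_simps)
    also have "\<dots> \<le> (2 powr (L / 4) / (2 * D)) * t0"
    proof (intro mult_right_mono)
      have "(8 * D + 10) * (L * D + 2) * (2 * D) \<le> 2 powr (L / 4)" using large by (simp add: large_def)
      then show "(8 * D + 10) * (L * D + 2) \<le> 2 powr (L / 4) / (2 * D)" using D4 by (simp add: pos_le_divide_eq)
    qed (use t0_pos in auto)
    also have "\<dots> = D * (t1 / (2 * D ^ 2))" unfolding t01 using D4 by (simp add: power2_eq_square)
    also have "\<dots> \<le> D * real s" using s_bounds(1) by (intro mult_left_mono) auto
    finally show "(c + 2) * real (2 * (2 * (2 * d) + 5)) \<le> D * real s" .
  qed auto
  finally show ?thesis .
qed

lemma gjj: "48 \<le> \<gamma> * real jj"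
proof -
  have "48 \<le> \<gamma> * (L / 8 - 1)" using large by (simp add: large_def)
  also have "\<dots> \<le> \<gamma> * real jj" using jj_bounds by (intro mult_left_mono) auto
  finally show ?thesis .
qed

lemma hom_graph_mid: "hom_graph X Y nb d N \<theta> \<psi> \<gamma> L t0 (2 * d) jj s t1"
proof (intro hom_graph.intro num, unfold_locales)
  have lg: "large D" by (rule large)
  have powL: "2 powr (L / 2) * 2 powr (- (L / 2)) = 1" "2 powr (L / 4) * 2 powr (- (L / 4)) = 1"
    by (simp_all add: powr_add[symmetric])
  show "D * t0 \<le> real N"
  proof -
    have "D * t0 \<le> 2 powr (L / 2) * t0" using lg t0_pos by (intro mult_right_mono) (auto simp: large_def)
    also have "\<dots> = real N" using powL(1) by (simp add: algebra_simps)
    finally show ?thesis .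
  qed
  show "t0 \<le> t1" by (intro mult_left_mono powr_mono) auto
  show "1 \<le> jj" "jj \<le> d" "1 \<le> s" using jj_bounds s_bounds by auto
  show "4 * D\<^sup>2 * t1 * 3 ^ jj \<le> real N"
  proof -
    \<comment> \<open>The exponent 8/5 is an upper bound for log 2 3, because 3 ^ 5 = 243 < 256 = 2
      ^ 8. It makes 3 ^ jj \<le> 2 ^ (L / 5), and 1/5 + 1/20 = 1/4.\<close>
    have "(3::real) ^ jj \<le> (2 powr (8/5)) ^ jj"
    proof (rule power_mono)
      have "(2 powr (8/5)) ^ 5 = (2::real) powr 8" by (simp add: powr_power)
      also have "\<dots> = 256" using powr_realpow[of 2 8] by simp
      finally have five: "(2 powr (8/5)) ^ 5 = (256::real)" .
      show "(3::real) \<le> 2 powr (8/5)"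
      proof (rule ccontr)
        assume "\<not> ?thesis"
        then have "(2 powr (8/5)) ^ 5 < (3::real) ^ 5" by (intro power_strict_mono) auto
        then show False using five by simp
      qed
    qed auto
    also have "\<dots> = 2 powr (8/5 * real jj)" by (simp add: powr_realpow[symmetric] powr_powr)
    also have "\<dots> \<le> 2 powr (L / 5)" using jj_bounds(2) by (intro powr_mono) auto
    finally have 3: "3 ^ jj \<le> 2 powr (L / 5)" .
    have "4 * D\<^sup>2 * t1 * 3 ^ jj \<le> 2 powr (L / 20) * t1 * 2 powr (L / 5)"
      using lg 3 by (intro mult_mono) (auto simp: large_def)
    also have "\<dots> = real N * (2 powr (L / 20) * 2 powr (L / 5) * 2 powr (- (L / 4)))" by simp
    also have "2 powr (L / 20) * 2 powr (L / 5) * 2 powr (- (L / 4)) = 1" by (simp add: powr_add[symmetric])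
    finally show ?thesis by simp
  qed
  show "real jj * real (card A) \<le> D * (real (card (nbhd nb A)) - real (card A))"
    if "A \<subseteq> X" "real (card A) * 3 ^ jj \<le> real N" for A
    using that by (intro isoj_aux[OF _ jj_bounds(4)]) auto
  show "real jj * real (card A) \<le> D * (real (card (nbhd nb A)) - real (card A))"
    if "A \<subseteq> Y" "real (card A) * 3 ^ jj \<le> real N" for A
    using that by (intro isoj_aux[OF _ jj_bounds(4)]) auto
  show "\<bar>h u - h v\<bar> \<le> int (2 * d)" if "h \<in> all_homs X Y nb" "u \<in> X \<union> Y" "v \<in> X \<union> Y" for h u v
    using hom_bounded[OF that] .
  show "\<exists>\<pi>. bij_betw \<pi> X X \<and> bij_betw \<pi> Y Y \<and> (\<forall>v\<in>X \<union> Y. nb (\<pi> v) = \<pi> ` nb v) \<and> \<pi> u = u'"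
    if "u \<in> X" "u' \<in> X" for u u' using transitive[of u u'] XD(1,3)[OF that(1)] XD(1,3)[OF that(2)] by simp
  show "\<exists>\<pi>. bij_betw \<pi> X X \<and> bij_betw \<pi> Y Y \<and> (\<forall>v\<in>X \<union> Y. nb (\<pi> v) = \<pi> ` nb v) \<and> \<pi> u = u'"
    if "u \<in> Y" "u' \<in> Y" for u u' using transitive[of u u'] YD(1,3)[OF that(1)] YD(1,3)[OF that(2)] by simp
  show "real s * D ^ 4 \<le> real N"
  proof -
    have "real s * D ^ 4 \<le> t1 / D ^ 2 * D ^ 4" using s_bounds(2) by (intro mult_right_mono) auto
    also have "\<dots> = D ^ 2 * t1" using D4 by (simp add: field_simps numeral_eq_Suc)
    also have "\<dots> \<le> 2 powr (L / 4) * t1"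
    proof (intro mult_right_mono)
      have "2 * D\<^sup>2 \<le> 2 powr (L / 4)" using lg by (simp add: large_def)
      then show "D\<^sup>2 \<le> 2 powr (L / 4)" using zero_le_power2[of D] by linarith
    qed auto
    also have "\<dots> = real N" using powL(2) by (simp add: algebra_simps)
    finally show ?thesis .
  qed
  show "t0 \<le> real s * (D - 1) * real jj / 2"
  proof -
    have "2 * D\<^sup>2 \<le> 2 powr (L / 4)" using lg by (simp add: large_def)
    then have "t0 * (2 * D\<^sup>2) \<le> t1" unfolding t01 using t0_pos by (intro mult_left_mono) auto
    then have "t0 \<le> t1 / (2 * D\<^sup>2)" using D4 by (simp add: pos_le_divide_eq)
    also have "\<dots> \<le> real s * 1" using s_bounds(1) by simp
    also have "\<dots> \<le> real s * ((D - 1) * real jj / 2)"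
    proof (intro mult_left_mono)
      have "1 \<le> real jj" using jj_bounds(3) by linarith
      then have "2 * 1 \<le> (D - 1) * real jj" using D4 by (intro mult_mono[of 2 "D - 1"]) auto
      then show "1 \<le> (D - 1) * real jj / 2" by simp
    qed auto
    finally show ?thesis by (simp add: algebra_simps)
  qed
  show "bireg_num.Mfac d L t0 ^ (2 * (2 * (2 * d) + 5)) * (2 powr (- (\<gamma> * (real s * (D - 1) * real jj / 2) / 2))
      + 2 * real s * 2 powr (- (\<gamma> * (t1 * real jj) / 2))) \<le> 2 powr (- (4 * D * real s))"
  proof -
    define S where "S = real s"
    have S1: "S \<ge> 1" unfolding S_def using s_bounds(3) by linarith
    have DS: "D * S \<ge> 1" using D4 S1 mult_mono[of 1 D 1 S] by simp
    \<comment> \<open>Since \<gamma> jj \<ge> 48, the exponent is at least 12 s (d - 1) \<ge> 6 d s.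
      Adding the second term costs one d s, the powers of \<open>Mfac\<close> another, which leaves
      the 4 d s required by \<open>amp\<close>.\<close>
    have a: "- (\<gamma> * (real s * (D - 1) * real jj / 2) / 2) \<le> - (6 * D * S)"
    proof -
      have "24 * D \<le> 48 * (D - 1)" using D4 by simp
      also have "\<dots> \<le> (\<gamma> * real jj) * (D - 1)" using gjj D4 by (intro mult_right_mono) auto
      finally have "24 * D * S \<le> (\<gamma> * real jj) * (D - 1) * S" using S1 by (intro mult_right_mono) auto
      then show ?thesis by (simp add: S_def algebra_simps)
    qed
    have b: "2 * real s * 2 powr (- (\<gamma> * (t1 * real jj) / 2)) \<le> 2 powr (- (6 * D * S))"
    proof -
      have f1: "2 * real s \<le> 2 powr (2 * S)"
      proof -
        have "real (2 * s) < 2 ^ (2 * s)" by (rule of_nat_less_two_power)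
        then show ?thesis by (simp add: S_def powr_realpow[symmetric])
      qed
      have "S \<le> t1 / D ^ 2" unfolding S_def by (rule s_bounds(2))
      then have "D ^ 2 * S \<le> t1" using D4 by (simp add: pos_le_divide_eq mult.commute)
      then have f2: "24 * (D ^ 2 * S) \<le> \<gamma> * (t1 * real jj) / 2"
        using mult_right_mono[OF gjj, of t1] by (simp add: algebra_simps)
      have f3: "8 * (D * S) \<le> 24 * (D ^ 2 * S)"
      proof -
        have "1 * (D * S) \<le> D * (D * S)" using D4 DS by (intro mult_right_mono) auto
        moreover have "D ^ 2 * S = D * (D * S)" by (simp add: power2_eq_square)
        ultimately show ?thesis using DS by linarith
      qed
      have "- (\<gamma> * (t1 * real jj) / 2) \<le> - (8 * (D * S))" using f2 f3 by linarith
      then have "2 powr (- (\<gamma> * (t1 * real jj) / 2)) \<le> 2 powr (- (8 * (D * S)))" by (rule powr_mono) simp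
      then have "2 * real s * 2 powr (- (\<gamma> * (t1 * real jj) / 2)) \<le> 2 powr (2 * S) * 2 powr (- (8 * (D * S)))"
        by (rule mult_mono[OF f1]) auto
      also have "\<dots> = 2 powr (2 * S - 8 * (D * S))" by (simp add: powr_diff powr_minus divide_inverse)
      also have "\<dots> \<le> 2 powr (- (6 * D * S))"
      proof (intro powr_mono)
        have "1 * S \<le> D * S" using D4 S1 by (intro mult_right_mono) auto
        then show "2 * S - 8 * (D * S) \<le> - (6 * D * S)" by (simp add: algebra_simps)
      qed auto
      finally show ?thesis .
    qed
    have "2 powr (- (\<gamma> * (real s * (D - 1) * real jj / 2) / 2)) + 2 * real s * 2 powr (- (\<gamma> * (t1 * real jj) / 2))
      \<le> 2 powr (- (6 * D * S)) + 2 powr (- (6 * D * S))"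
      by (rule add_mono[OF powr_mono[OF a] b]) simp
    also have "\<dots> \<le> 2 powr (- (5 * D * S))" using DS by (intro powr2_sum_le) (auto simp: algebra_simps)
    finally have sum: "2 powr (- (\<gamma> * (real s * (D - 1) * real jj / 2) / 2)) + 2 * real s * 2 powr (- (\<gamma> * (t1 * real jj) / 2))
      \<le> 2 powr (- (5 * D * S))" .
    have "bireg_num.Mfac d L t0 ^ (2 * (2 * (2 * d) + 5)) * (2 powr (- (\<gamma> * (real s * (D - 1) * real jj / 2) / 2))
      + 2 * real s * 2 powr (- (\<gamma> * (t1 * real jj) / 2))) \<le> 2 powr (D * S) * 2 powr (- (5 * D * S))"
      by (rule mult_mono[OF Mfac_pow[folded S_def] sum]) auto
    also have "\<dots> = 2 powr (- (4 * D * real s))" by (simp add: powr_add[symmetric] S_def algebra_simps)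
    finally show ?thesis .
  qed
qed

text \<open>Excursions cost 2 ^ (- 4 d) per vertex against N \<le> 2 ^ (2 d) vertices, which leaves
  2 ^ (- 2 d). In the level term, \<tau> ^ 2 \<le> 2 ^ (t1 / d) uses at most half of the saving
  \<gamma> t1 / 2, and \<gamma> t1 is exponential in d up to a power.\<close>

lemma wide_fraction:
  assumes v0: "v0 \<in> layer n (d - 1)"
  shows "real (card {h \<in> Hom_at (middle_layers_graph d) v0. \<not> hom_range (middle_layers_graph d) h \<le> 5})
    \<le> real (card (Hom_at (middle_layers_graph d) v0)) * ((4 * D + 5) * 2 powr (- (2 * D)) + 4 * 2 powr (- (2 * D)))"
proof -
  interpret hom_graph X Y nb d N \<theta> \<psi> \<gamma> L t0 "2 * d" jj s t1 by (rule hom_graph_mid)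
  note tr = Hom_transfer[OF v0]
  define Z where "Z = real (card {g \<in> all_homs X Y nb. g (ones v0) = 0})"
  have "real (card {h \<in> Hom_at (middle_layers_graph d) v0. \<not> hom_range (middle_layers_graph d) h \<le> 5})
    \<le> real (card {g \<in> all_homs X Y nb. g (ones v0) = 0 \<and> 6 \<le> card (g ` (X \<union> Y))})"
    using tr(3) by (simp only: of_nat_le_iff)
  also have "\<dots> \<le> Z * (real (2 * (2 * d) + 5) * (\<tau> ^ 2 * 2 powr (- (\<gamma> * t1 / 2))) + 4 * real N * 2 powr (- (4 * D)))"
    using hom_parity tr(1) by (intro card_wide_le) (auto simp: Z_def)
  also have "\<dots> \<le> Z * ((4 * D + 5) * 2 powr (- (2 * D)) + 4 * 2 powr (- (2 * D)))"
  proof (intro mult_left_mono add_mono)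
    have "\<tau> ^ 2 = Mfac ^ (2 * (2 * (2 * d) + 5))" unfolding \<tau>_def power_mult[symmetric] by (simp only: mult.commute)
    also have "\<dots> \<le> 2 powr (D * real s)" by (rule Mfac_pow)
    also have "\<dots> \<le> 2 powr (t1 / D)"
    proof (intro powr_mono)
      have "D * real s \<le> D * (t1 / D ^ 2)" using s_bounds(2) by (intro mult_left_mono) auto
      then show "D * real s \<le> t1 / D" using D4 by (simp add: power2_eq_square)
    qed auto
    finally have "\<tau> ^ 2 * 2 powr (- (\<gamma> * t1 / 2)) \<le> 2 powr (t1 / D) * 2 powr (- (\<gamma> * t1 / 2))"
      by (intro mult_right_mono) auto
    also have "\<dots> = 2 powr (t1 / D - \<gamma> * t1 / 2)"
      using powr_shift[of 1 "t1 / D" "\<gamma> * t1 / 2"] by (simp only: mult_1_left)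
    also have "\<dots> \<le> 2 powr (- (2 * D))"
    proof (intro powr_mono)
      have "2 powr D \<le> t1" using t0_ge t01 by linarith
      then have "\<gamma> * 2 powr D \<le> \<gamma> * t1" by (intro mult_left_mono) auto
      moreover have "1 / D \<le> \<gamma> / 4" using large by (simp add: large_def)
      then have "1 / D * t1 \<le> \<gamma> / 4 * t1" using t1_pos by (intro mult_right_mono) auto
      then have "t1 / D \<le> \<gamma> * t1 / 4" by (simp only: times_divide_eq_left mult_1_left)
      moreover have "4 * D + 4 \<le> \<gamma> * 2 powr D / 16" using large by (simp add: large_def)
      ultimately show "t1 / D - \<gamma> * t1 / 2 \<le> - (2 * D)" using D4 by linarith
    qed auto
    finally have "\<tau> ^ 2 * 2 powr (- (\<gamma> * t1 / 2)) \<le> 2 powr (- (2 * D))" .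
    then show "real (2 * (2 * d) + 5) * (\<tau> ^ 2 * 2 powr (- (\<gamma> * t1 / 2))) \<le> (4 * D + 5) * 2 powr (- (2 * D))"
      by (intro mult_mono) auto
    have "real N \<le> 2 powr (2 * D)"
    proof -
      have "real N \<le> 4 ^ d" by (rule real_N_le)
      also have "(4::real) ^ d = 2 powr (2 * D)" by (simp add: powr_powr[symmetric] powr_realpow)
      finally show ?thesis .
    qed
    then have "4 * real N * 2 powr (- (4 * D)) \<le> 4 * 2 powr (2 * D) * 2 powr (- (4 * D))" by (intro mult_right_mono) auto
    also have "\<dots> = 4 * 2 powr (- (2 * D))" by (simp add: powr_add[symmetric])
    finally show "4 * real N * 2 powr (- (4 * D)) \<le> 4 * 2 powr (- (2 * D))" .
  qed (simp add: Z_def)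
  finally show ?thesis using tr(2) by (simp add: Z_def)
qed

end

end

theorem theorem1p2:
  shows "\<forall>\<epsilon>::real. \<epsilon> > 0 \<longrightarrow>
    (\<exists>D::nat. \<forall>d\<ge>D. d \<ge> 1 \<longrightarrow> (\<forall>v0 \<in> layer (2 * d - 1) (d - 1).
      \<bar>measure_pmf.prob (pmf_of_set (Hom_at (middle_layers_graph d) v0))
         {h. hom_range (middle_layers_graph d) h \<le> 5} - 1\<bar> < \<epsilon>))"
proof (intro allI impI)
  fix \<epsilon> :: real assume \<epsilon>: "\<epsilon> > 0"
  have "((\<lambda>x::real. (4 * x + 5) * 2 powr (- (2 * x)) + 4 * 2 powr (- (2 * x))) \<longlongrightarrow> 0) at_top" by real_asymp
  then have "eventually (\<lambda>x::real. (4 * x + 5) * 2 powr (- (2 * x)) + 4 * 2 powr (- (2 * x)) < \<epsilon>) at_top"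
    using \<epsilon> by (rule order_tendstoD)
  with eventually_large
  have "eventually (\<lambda>x. large x \<and> (4 * x + 5) * 2 powr (- (2 * x)) + 4 * 2 powr (- (2 * x)) < \<epsilon>) at_top"
    by (rule eventually_conj)
  then obtain B where B: "\<And>x. x \<ge> B \<Longrightarrow> large x \<and> (4 * x + 5) * 2 powr (- (2 * x)) + 4 * 2 powr (- (2 * x)) < \<epsilon>"
    by (auto simp: eventually_at_top_linorder)
  show "\<exists>D::nat. \<forall>d\<ge>D. d \<ge> 1 \<longrightarrow> (\<forall>v0 \<in> layer (2 * d - 1) (d - 1).
      \<bar>measure_pmf.prob (pmf_of_set (Hom_at (middle_layers_graph d) v0))
         {h. hom_range (middle_layers_graph d) h \<le> 5} - 1\<bar> < \<epsilon>)"
  \<comment> \<open>The threshold depends on \<epsilon> alone and is fixed before the root is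
    chosen, which gives the uniformity in \<open>v0\<close>.\<close>
  proof (intro exI[of _ "nat \<lceil>B\<rceil>"] allI impI ballI)
    fix d :: nat and v0 assume d: "nat \<lceil>B\<rceil> \<le> d" "d \<ge> 1" and v0: "v0 \<in> layer (2 * d - 1) (d - 1)"
    have "real d \<ge> B" using d(1) by linarith
    then have lg: "large (real d)"
      and small: "(4 * real d + 5) * 2 powr (- (2 * real d)) + 4 * 2 powr (- (2 * real d)) < \<epsilon>"
      using B by auto
    define H where "H = Hom_at (middle_layers_graph d) v0"
    define G where "G = {h. hom_range (middle_layers_graph d) h \<le> 5}"
    define W where "W = {h \<in> H. \<not> hom_range (middle_layers_graph d) h \<le> 5}"
    have H: "finite H" "H \<noteq> {}" using finite_Hom_at_mid[OF d(2) v0] Hom_at_mid_nonempty[OF d(2) v0] by (auto simp: H_def)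
    have cH: "real (card H) > 0" using H by (simp add: card_gt_0_iff)
    interpret mid d "2 * d - 1" "(2 * d - 1) choose d" "lay (2 * d - 1) (d - 1)" "lay (2 * d - 1) d"
      "\<lambda>A. {B \<in> lay (2 * d - 1) (d - 1) \<union> lay (2 * d - 1) d. A \<subset> B \<or> B \<subset> A}"
      by unfold_locales (use d in auto)
    have cW: "real (card W) \<le> real (card H) * ((4 * real d + 5) * 2 powr (- (2 * real d)) + 4 * 2 powr (- (2 * real d)))"
      using wide_fraction[OF lg v0] by (simp add: W_def H_def)
    have "H = (H \<inter> G) \<union> W" "(H \<inter> G) \<inter> W = {}" by (auto simp: G_def W_def)
    then have "card H = card (H \<inter> G) + card W"
      using H(1) by (metis card_Un_disjoint finite_Un)
    moreover have "measure_pmf.prob (pmf_of_set H) G = real (card (H \<inter> G)) / real (card H)"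
      using H by (simp add: measure_pmf_of_set)
    ultimately have "measure_pmf.prob (pmf_of_set H) G - 1 = - (real (card W) / real (card H))"
      using cH by (simp add: field_simps)
    moreover have "real (card W) / real (card H) \<le> (4 * real d + 5) * 2 powr (- (2 * real d)) + 4 * 2 powr (- (2 * real d))"
      using cW cH by (simp add: pos_divide_le_eq mult.commute)
    moreover have "0 \<le> real (card W) / real (card H)" by simp
    ultimately have "\<bar>measure_pmf.prob (pmf_of_set H) G - 1\<bar> < \<epsilon>" using small by linarith
    then show "\<bar>measure_pmf.prob (pmf_of_set (Hom_at (middle_layers_graph d) v0))
         {h. hom_range (middle_layers_graph d) h \<le> 5} - 1\<bar> < \<epsilon>" by (simp add: H_def G_def)
  qed
qed

end
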